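(* Let $\mathbf{A}$ be a finite, semisimple, solvable algebra. If $d_{\mathbf{A}}(n)\in O(n)$, then $\mathbf{A}$ has a Maltsev polynomial, and so it is affine.
   Context: $d_{\mathbf{A}}(n)$ is the least size of a generating set of $\mathbf{A}^n$. Semisimple: isomorphic to a subdirect product of simple algebras (equivalently, the maximal congruences intersect to $0$). Solvability is with respect to the term condition commutator. A Maltsev polynomial is a polynomial $m$ with $m(x,y,y)=x=m(y,y,x)$; affine means abelian with a Maltsev term. *)

theory Defs
  imports Main "HOL-Library.Landau_Symbols"
begin

definition is_algebra :: "'a set \<Rightarrow> ('f \<Rightarrow> nat) \<Rightarrow> ('f \<Rightarrow> 'a list \<Rightarrow> 'a) \<Rightarrow> bool" where
  "is_algebra A ar F \<longleftrightarrow> A \<noteq> {} \<and>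
     (\<forall>f xs. length xs = ar f \<and> set xs \<subseteq> A \<longrightarrow> F f xs \<in> A)"

inductive_set gen :: "('f \<Rightarrow> nat) \<Rightarrow> ('f \<Rightarrow> 'b list \<Rightarrow> 'b) \<Rightarrow> 'b set \<Rightarrow> 'b set"
  for ar F X where
  base: "x \<in> X \<Longrightarrow> x \<in> gen ar F X"
| op: "length xs = ar f \<Longrightarrow> (\<forall>x\<in>set xs. x \<in> gen ar F X) \<Longrightarrow> F f xs \<in> gen ar F X"

definition pow_carrier :: "'a set \<Rightarrow> nat \<Rightarrow> 'a list set" where
  "pow_carrier A n = {xs. length xs = n \<and> set xs \<subseteq> A}"

definition pow_op :: "('f \<Rightarrow> 'a list \<Rightarrow> 'a) \<Rightarrow> nat \<Rightarrow> 'f \<Rightarrow> 'a list list \<Rightarrow> 'a list" where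
  "pow_op F n f ts = map (\<lambda>i. F f (map (\<lambda>t. t ! i) ts)) [0..<n]"

definition d_gen :: "'a set \<Rightarrow> ('f \<Rightarrow> nat) \<Rightarrow> ('f \<Rightarrow> 'a list \<Rightarrow> 'a) \<Rightarrow> nat \<Rightarrow> nat" where
  "d_gen A ar F n = (LEAST k. \<exists>X. X \<subseteq> pow_carrier A n \<and> finite X \<and> card X = k \<and>
                          gen ar (pow_op F n) X = pow_carrier A n)"

definition is_congruence :: "'a set \<Rightarrow> ('f \<Rightarrow> nat) \<Rightarrow> ('f \<Rightarrow> 'a list \<Rightarrow> 'a) \<Rightarrow> 'a rel \<Rightarrow> bool" where
  "is_congruence A ar F \<theta> \<longleftrightarrow> equiv A \<theta> \<and>
     (\<forall>f xs ys. length xs = ar f \<and> length ys = ar f \<and> set xs \<subseteq> A \<and> set ys \<subseteq> A \<and>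
        list_all2 (\<lambda>x y. (x, y) \<in> \<theta>) xs ys \<longrightarrow> (F f xs, F f ys) \<in> \<theta>)"

definition maximal_congruence :: "'a set \<Rightarrow> ('f \<Rightarrow> nat) \<Rightarrow> ('f \<Rightarrow> 'a list \<Rightarrow> 'a) \<Rightarrow> 'a rel \<Rightarrow> bool" where
  "maximal_congruence A ar F \<theta> \<longleftrightarrow> is_congruence A ar F \<theta> \<and> \<theta> \<noteq> A \<times> A \<and>
     (\<forall>\<psi>. is_congruence A ar F \<psi> \<and> \<theta> \<subseteq> \<psi> \<longrightarrow> \<psi> = \<theta> \<or> \<psi> = A \<times> A)"

definition semisimple :: "'a set \<Rightarrow> ('f \<Rightarrow> nat) \<Rightarrow> ('f \<Rightarrow> 'a list \<Rightarrow> 'a) \<Rightarrow> bool" where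
  "semisimple A ar F \<longleftrightarrow>
     (A \<times> A) \<inter> \<Inter> {\<theta>. maximal_congruence A ar F \<theta>} = Id_on A"

inductive_set term_ops :: "('f \<Rightarrow> nat) \<Rightarrow> ('f \<Rightarrow> 'a list \<Rightarrow> 'a) \<Rightarrow> nat \<Rightarrow> ('a list \<Rightarrow> 'a) set"
  for ar F k where
  proj: "i < k \<Longrightarrow> (\<lambda>xs. xs ! i) \<in> term_ops ar F k"
| comp: "length ts = ar f \<Longrightarrow> (\<forall>t\<in>set ts. t \<in> term_ops ar F k) \<Longrightarrow>
         (\<lambda>xs. F f (map (\<lambda>t. t xs) ts)) \<in> term_ops ar F k"

inductive_set poly_ops :: "'a set \<Rightarrow> ('f \<Rightarrow> nat) \<Rightarrow> ('f \<Rightarrow> 'a list \<Rightarrow> 'a) \<Rightarrow> nat \<Rightarrow> ('a list \<Rightarrow> 'a) set"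
  for A ar F k where
  proj: "i < k \<Longrightarrow> (\<lambda>xs. xs ! i) \<in> poly_ops A ar F k"
| const: "a \<in> A \<Longrightarrow> (\<lambda>xs. a) \<in> poly_ops A ar F k"
| comp: "length ts = ar f \<Longrightarrow> (\<forall>t\<in>set ts. t \<in> poly_ops A ar F k) \<Longrightarrow>
         (\<lambda>xs. F f (map (\<lambda>t. t xs) ts)) \<in> poly_ops A ar F k"

definition term_condition :: "'a set \<Rightarrow> ('f \<Rightarrow> nat) \<Rightarrow> ('f \<Rightarrow> 'a list \<Rightarrow> 'a) \<Rightarrow>
    'a rel \<Rightarrow> 'a rel \<Rightarrow> 'a rel \<Rightarrow> bool" where
  "term_condition A ar F \<alpha> \<beta> \<delta> \<longleftrightarrow>
     (\<forall>n m t a b c d. t \<in> term_ops ar F (n + m) \<and>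
        a \<in> pow_carrier A n \<and> b \<in> pow_carrier A n \<and> c \<in> pow_carrier A m \<and> d \<in> pow_carrier A m \<and>
        list_all2 (\<lambda>x y. (x, y) \<in> \<alpha>) a b \<and> list_all2 (\<lambda>x y. (x, y) \<in> \<beta>) c d \<and>
        (t (a @ c), t (a @ d)) \<in> \<delta> \<longrightarrow> (t (b @ c), t (b @ d)) \<in> \<delta>)"

definition commutator :: "'a set \<Rightarrow> ('f \<Rightarrow> nat) \<Rightarrow> ('f \<Rightarrow> 'a list \<Rightarrow> 'a) \<Rightarrow>
    'a rel \<Rightarrow> 'a rel \<Rightarrow> 'a rel" where
  "commutator A ar F \<alpha> \<beta> =
     \<Inter> {\<delta>. is_congruence A ar F \<delta> \<and> term_condition A ar F \<alpha> \<beta> \<delta>}"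

fun derived :: "'a set \<Rightarrow> ('f \<Rightarrow> nat) \<Rightarrow> ('f \<Rightarrow> 'a list \<Rightarrow> 'a) \<Rightarrow> nat \<Rightarrow> 'a rel" where
  "derived A ar F 0 = A \<times> A"
| "derived A ar F (Suc k) = commutator A ar F (derived A ar F k) (derived A ar F k)"

definition solvable :: "'a set \<Rightarrow> ('f \<Rightarrow> nat) \<Rightarrow> ('f \<Rightarrow> 'a list \<Rightarrow> 'a) \<Rightarrow> bool" where
  "solvable A ar F \<longleftrightarrow> (\<exists>k. derived A ar F k = Id_on A)"

definition abelian :: "'a set \<Rightarrow> ('f \<Rightarrow> nat) \<Rightarrow> ('f \<Rightarrow> 'a list \<Rightarrow> 'a) \<Rightarrow> bool" where
  "abelian A ar F \<longleftrightarrow> commutator A ar F (A \<times> A) (A \<times> A) = Id_on A"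

definition is_maltsev_op :: "'a set \<Rightarrow> ('a list \<Rightarrow> 'a) \<Rightarrow> bool" where
  "is_maltsev_op A m \<longleftrightarrow> (\<forall>x\<in>A. \<forall>y\<in>A. m [x, y, y] = x \<and> m [y, y, x] = x)"

definition has_maltsev_polynomial :: "'a set \<Rightarrow> ('f \<Rightarrow> nat) \<Rightarrow> ('f \<Rightarrow> 'a list \<Rightarrow> 'a) \<Rightarrow> bool" where
  "has_maltsev_polynomial A ar F \<longleftrightarrow> (\<exists>m\<in>poly_ops A ar F 3. is_maltsev_op A m)"

definition has_maltsev_term :: "'a set \<Rightarrow> ('f \<Rightarrow> nat) \<Rightarrow> ('f \<Rightarrow> 'a list \<Rightarrow> 'a) \<Rightarrow> bool" where
  "has_maltsev_term A ar F \<longleftrightarrow> (\<exists>m\<in>term_ops ar F 3. is_maltsev_op A m)"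

definition affine :: "'a set \<Rightarrow> ('f \<Rightarrow> nat) \<Rightarrow> ('f \<Rightarrow> 'a list \<Rightarrow> 'a) \<Rightarrow> bool" where
  "affine A ar F \<longleftrightarrow> abelian A ar F \<and> has_maltsev_term A ar F"

end

theory Submission
  imports Defs "HOL-Library.Function_Algebras" "HOL-Algebra.FiniteProduct"
begin

text \<open>
  In a solvable algebra no quotient has a polynomial operation acting as a semilattice
  operation on a two-element set. On a minimal range \<open>U\<close> of an idempotent unary polynomial of a
  simple quotient this leaves two cases: binary polynomials on \<open>U\<close> depend on one variable
  only, or they form quasigroups and endow \<open>U\<close> with an abelian group structure. Either way points of
  \<open>A\<close> are separated by maps into finite abelian groups under which all polynomials become
  sums of functions of one variable each. So \<open>A\<close> embeds into an abelian group \<open>G\<close> of finite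
  exponent such that every polynomial decomposes as such a sum.

  If \<open>A\<^sup>n\<close> has a generating set of size \<open>O(n)\<close>, then counting the tuples reached by terms gives a
  term in which each of certain summands \<open>p(x\<^sub>j)\<close> occurs very often and whose frequent summands
  span all differences of elements of \<open>A\<close>. Hence \<open>A\<close> is a coset in \<open>G\<close>, unary polynomials
  are affine maps, and the combinations of the maps \<open>p \<circ> r\<close> form a right ideal \<open>J\<close> of the
  ring of unary polynomials with \<open>J A = A\<close>. Semisimplicity forces \<open>J\<close> to contain the identity, and
  then \<open>x - y + z\<close> is a polynomial.\<close>

section \<open>Iterates and clones of operations\<close>

text \<open>The obstacle is that no sum of polynomials is known to be a polynomial until the end.
  The only source of addition is one polynomial \<open>f\<close> in many variables: substituting
  inner polynomials into variables that contribute by the same map \<open>p\<close> adds up their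
  \<open>p\<close>-values. As the group has exponent dividing \<open>E\<close>, a coefficient costs
  at most \<open>E\<close> variables, and as A has at most \<open>card A ^ card A\<close> unary
  polynomial maps, every combination has bounded cost, however it was formed. Such an
  \<open>f\<close> exists because otherwise each tuple of the power would follow one of polynomially
  many patterns (in the number of generators, hence in n), and each pattern would leave at most
  \<open>card A - 1\<close> choices per coordinate. The passage to the identity follows the theory
  of the Jacobson radical. A maximal congruence separates a nonzero value of a member of J from
  zero; modulo it some member of J acts on that value as the identity, so it is not nilpotent, and a
  power of it is a new idempotent by which a given one can be enlarged.\<close>

lemma funpow_in: "x \<in> X \<Longrightarrow> f ` X \<subseteq> X \<Longrightarrow> (f ^^ n) x \<in> X"
  by (induction n) auto

text \<open>By pigeonhole an orbit in X enters a cycle within \<open>card X\<close> steps. For k at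
  least \<open>card X\<close>, \<open>fact k\<close> is a multiple of every cycle length and no
  smaller than any preperiod, so one exponent serves all starting points.\<close>

lemma funpow_fact_idem:
  assumes fin: "finite X" and f: "f ` X \<subseteq> X" and x: "x \<in> X" and k: "k \<ge> card X"
  shows "(f ^^ fact k) ((f ^^ fact k) x) = (f ^^ fact k) x"
proof -
  have "\<not> inj_on (\<lambda>i. (f ^^ i) x) {..card X}"
  proof
    assume "inj_on (\<lambda>i. (f ^^ i) x) {..card X}"
    moreover have "(\<lambda>i. (f ^^ i) x) ` {..card X} \<subseteq> X"
      using funpow_in[OF x f] by auto
    ultimately have "card {..card X} \<le> card X"
      using card_inj_on_le fin by blast
    then show False by simp
  qed
  then obtain i j where ij: "i < j" "j \<le> card X" "(f ^^ i) x = (f ^^ j) x"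
    unfolding inj_on_def by (metis atMost_iff linorder_neqE_nat)
  have step: "(f ^^ (l + (j - i))) x = (f ^^ l) x" if "l \<ge> i" for l
  proof -
    have "l + (j - i) = (l - i) + j" using that ij(1) by simp
    then have "(f ^^ (l + (j - i))) x = (f ^^ (l - i)) ((f ^^ j) x)"
      by (metis comp_apply funpow_add)
    also have "\<dots> = (f ^^ ((l - i) + i)) x"
      unfolding ij(3)[symmetric] funpow_add by simp
    also have "(l - i) + i = l" using that by simp
    finally show ?thesis .
  qed
  have mult: "(f ^^ (l + q * (j - i))) x = (f ^^ l) x" if "l \<ge> i" for l q
  proof (induction q)
    case (Suc q)
    have "(f ^^ (l + Suc q * (j - i))) x = (f ^^ ((l + q * (j - i)) + (j - i))) x"
      by (simp only: mult_Suc ac_simps)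
    also have "\<dots> = (f ^^ (l + q * (j - i))) x"
      using that by (intro step) auto
    finally show ?case using Suc by simp
  qed simp
  have "(j - i) dvd fact k"
    using ij k by (intro dvd_fact) auto
  then obtain q where q: "fact k = q * (j - i)" by (metis dvd_div_mult_self)
  have "i \<le> k" using ij k by simp
  also have "k \<le> fact k" by (rule fact_ge_self)
  finally have "i \<le> fact k" .
  from mult[OF this, of q] have "(f ^^ (fact k + fact k)) x = (f ^^ fact k) x"
    unfolding q[symmetric] .
  then show ?thesis by (simp add: funpow_add)
qed

lemma funpow_fact_inverse:
  assumes "finite X" and "f ` X \<subseteq> X" and "inj_on f X" and "x \<in> X" and "k \<ge> card X"
  shows "(f ^^ fact k) x = x"
proof -
  have *: "inj_on (f ^^ n) X" for n
  proof (induction n)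
    case (Suc n)
    then show ?case
      using assms(2,3) funpow_in[OF _ assms(2)] by (auto simp: inj_on_def)
  qed simp
  show ?thesis
    using funpow_fact_idem[OF assms(1,2,4,5)] *[of "fact k"] funpow_in[OF _ assms(2)] assms(4)
    by (meson inj_onD)
qed

text \<open>Operations read an assignment of infinitely many variables, so composition is plain
  substitution and needs no arities. By \<open>ext\<close>, membership depends only on the values at
  assignments into B. As all constants are present, this models the polynomials rather than the
  terms.\<close>

locale clone =
  fixes B :: "'a set" and C :: "((nat \<Rightarrow> 'a) \<Rightarrow> 'a) set"
  assumes fin: "finite B"
    and var: "(\<lambda>\<rho>. \<rho> v) \<in> C"
    and const: "b \<in> B \<Longrightarrow> (\<lambda>\<rho>. b) \<in> C"
    and sub: "f \<in> C \<Longrightarrow> (\<And>v. \<sigma> v \<in> C) \<Longrightarrow> (\<lambda>\<rho>. f (\<lambda>v. \<sigma> v \<rho>)) \<in> C"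
    and ext: "f \<in> C \<Longrightarrow> (\<And>\<rho>. range \<rho> \<subseteq> B \<Longrightarrow> f \<rho> = g \<rho>) \<Longrightarrow> g \<in> C"
    and rng: "f \<in> C \<Longrightarrow> range \<rho> \<subseteq> B \<Longrightarrow> f \<rho> \<in> B"
begin

definition pol1 :: "('a \<Rightarrow> 'a) set" where
  "pol1 = {g. (\<lambda>\<rho>. g (\<rho> 0)) \<in> C}"

definition pol2 :: "('a \<Rightarrow> 'a \<Rightarrow> 'a) set" where
  "pol2 = {G. (\<lambda>\<rho>. G (\<rho> 0) (\<rho> 1)) \<in> C}"

lemma app1:
  assumes "g \<in> pol1" "f \<in> C"
  shows "(\<lambda>\<rho>. g (f \<rho>)) \<in> C"
  using assms sub[of "\<lambda>\<rho>. g (\<rho> 0)" "\<lambda>_. f"] unfolding pol1_def by blast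

lemma app2:
  assumes "G \<in> pol2" "f \<in> C" "f' \<in> C"
  shows "(\<lambda>\<rho>. G (f \<rho>) (f' \<rho>)) \<in> C"
proof -
  have "(\<lambda>\<rho>. G (\<rho> 0) (\<rho> 1)) \<in> C"
    using assms(1) unfolding pol2_def by blast
  moreover have "(if v = 0 then f else f') \<in> C" for v :: nat
    using assms by simp
  ultimately have "(\<lambda>\<rho>. G ((if 0 = (0::nat) then f else f') \<rho>) ((if 1 = (0::nat) then f else f') \<rho>)) \<in> C"
    by (rule sub)
  then show ?thesis by simp
qed

lemma pol1I: "(\<lambda>\<rho>. g (\<rho> 0)) \<in> C \<Longrightarrow> g \<in> pol1"
  by (simp add: pol1_def)

lemma pol2I: "(\<lambda>\<rho>. G (\<rho> 0) (\<rho> 1)) \<in> C \<Longrightarrow> G \<in> pol2"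
  by (simp add: pol2_def)

lemma pol1_id: "(\<lambda>x. x) \<in> pol1"
  by (rule pol1I) (rule var)

lemma pol1_const: "b \<in> B \<Longrightarrow> (\<lambda>x. b) \<in> pol1"
  by (rule pol1I) (rule const)

lemma pol1_comp: "g \<in> pol1 \<Longrightarrow> h \<in> pol1 \<Longrightarrow> (\<lambda>x. g (h x)) \<in> pol1"
  using app1[of g "\<lambda>\<rho>. h (\<rho> 0)"] by (auto simp: pol1_def)

lemma pol1_funpow: "g \<in> pol1 \<Longrightarrow> (g ^^ n) \<in> pol1"
proof (induction n)
  case 0
  then show ?case using pol1_id by (simp add: id_def)
next
  case (Suc n)
  then show ?case using pol1_comp[of g "g ^^ n"] by (simp add: comp_def)
qed

lemma pol1_rng: "g \<in> pol1 \<Longrightarrow> x \<in> B \<Longrightarrow> g x \<in> B"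
  using rng[of "\<lambda>\<rho>. g (\<rho> 0)" "\<lambda>_. x"] by (auto simp: pol1_def)

lemma pol1_ext: "g \<in> pol1 \<Longrightarrow> (\<And>x. x \<in> B \<Longrightarrow> g x = h x) \<Longrightarrow> h \<in> pol1"
  unfolding pol1_def mem_Collect_eq by (erule ext) auto

lemma pol2_rng: "G \<in> pol2 \<Longrightarrow> x \<in> B \<Longrightarrow> y \<in> B \<Longrightarrow> G x y \<in> B"
  using rng[of "\<lambda>\<rho>. G (\<rho> 0) (\<rho> 1)" "\<lambda>v. if v = 0 then x else y"] by (auto simp: pol2_def)

lemma pol2_swap: "G \<in> pol2 \<Longrightarrow> (\<lambda>x y. G y x) \<in> pol2"
  by (rule pol2I, rule app2[of G, OF _ var var])

lemma pol2_left: "g \<in> pol1 \<Longrightarrow> (\<lambda>x y. g x) \<in> pol2"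
  by (rule pol2I, rule app1[of g, OF _ var])

lemma pol2_right: "g \<in> pol1 \<Longrightarrow> (\<lambda>x y. g y) \<in> pol2"
  by (rule pol2I, rule app1[of g, OF _ var])

lemma pol2_app1: "g \<in> pol1 \<Longrightarrow> G \<in> pol2 \<Longrightarrow> (\<lambda>x y. g (G x y)) \<in> pol2"
  using app1[of g "\<lambda>\<rho>. G (\<rho> 0) (\<rho> 1)"] by (intro pol2I) (simp add: pol2_def)

lemma pol2_app2:
  "G \<in> pol2 \<Longrightarrow> H \<in> pol2 \<Longrightarrow> K \<in> pol2 \<Longrightarrow> (\<lambda>x y. G (H x y) (K x y)) \<in> pol2"
  using app2[of G "\<lambda>\<rho>. H (\<rho> 0) (\<rho> 1)" "\<lambda>\<rho>. K (\<rho> 0) (\<rho> 1)"]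
  by (intro pol2I) (simp add: pol2_def)

lemma pol2_sec1: "G \<in> pol2 \<Longrightarrow> y \<in> B \<Longrightarrow> (\<lambda>x. G x y) \<in> pol1"
  by (rule pol1I, rule app2[of G, OF _ var const])

lemma pol2_sec2: "G \<in> pol2 \<Longrightarrow> x \<in> B \<Longrightarrow> (\<lambda>y. G x y) \<in> pol1"
  by (rule pol1I, rule app2[of G, OF _ const var])

lemma pol2_args:
  assumes "G \<in> pol2" "g \<in> pol1" "h \<in> pol1"
  shows "(\<lambda>x y. G (g x) (h y)) \<in> pol2"
  using pol2_app2[OF assms(1) pol2_left[OF assms(2)] pol2_right[OF assms(3)]] .

lemma pol2_iter2: "G \<in> pol2 \<Longrightarrow> (\<lambda>x y. ((\<lambda>z. G x z) ^^ n) y) \<in> pol2"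
proof (induction n)
  case 0
  then show ?case using pol2_right[OF pol1_id] by simp
next
  case (Suc n)
  then show ?case
    using pol2_app2[OF Suc.prems pol2_left[OF pol1_id] Suc.IH[OF Suc.prems]] by simp
qed

text \<open>The reflexive transitive closure consists of chains of polynomial images of the pair (x,
  y), Maltsev's description of the congruence generated by a pair.\<close>

definition trans_step :: "'a \<Rightarrow> 'a \<Rightarrow> 'a rel" where
  "trans_step x y = {(g x, g y) | g. g \<in> pol1} \<union> {(g y, g x) | g. g \<in> pol1}"

lemma trans_stepI:
  assumes "g \<in> pol1"
  shows "(g x, g y) \<in> trans_step x y" "(g y, g x) \<in> trans_step x y"
proof -
  show "(g x, g y) \<in> trans_step x y" unfolding trans_step_def using assms by blast
  show "(g y, g x) \<in> trans_step x y" unfolding trans_step_def using assms by blast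
qed

text \<open>On {z, i} the polynomial p is a meet with bottom z. This is the configuration that
  solvability excludes.\<close>

definition semilattice_pair :: "'a \<Rightarrow> 'a \<Rightarrow> bool" where
  "semilattice_pair z i \<longleftrightarrow> z \<in> B \<and> i \<in> B \<and> z \<noteq> i \<and>
     (\<exists>p\<in>pol2. p i i = i \<and> p i z = z \<and> p z i = z \<and> p z z = z)"

lemma semilattice_pairI:
  assumes "p \<in> pol2" "p i i = i" "p i z = z" "p z i = z" "p z z = z" "z \<in> B" "i \<in> B" "z \<noteq> i"
  shows "semilattice_pair z i"
  unfolding semilattice_pair_def using assms by blast

end

section \<open>Minimal sets of a simple clone without semilattice pairs\<close>

locale simple_clone = clone +
  assumes simple: "x \<in> B \<Longrightarrow> y \<in> B \<Longrightarrow> x \<noteq> y \<Longrightarrow> a \<in> B \<Longrightarrow> b \<in> B \<Longrightarrow> (a, b) \<in> (trans_step x y)\<^sup>*"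
    and no_sl: "\<not> semilattice_pair z i"
    and nontriv: "\<exists>a\<in>B. \<exists>b\<in>B. a \<noteq> b"
begin

text \<open>Otherwise f would be constant along every chain of translates of (x, y), and by
  simplicity such a chain joins a to b.\<close>

lemma separating_translation:
  assumes "x \<in> B" "y \<in> B" "x \<noteq> y" and "a \<in> B" "b \<in> B" "f a \<noteq> f b"
  obtains g where "g \<in> pol1" "f (g x) \<noteq> f (g y)"
proof -
  have "\<exists>g\<in>pol1. f (g x) \<noteq> f (g y)"
  proof (rule ccontr)
    assume neg: "\<not> ?thesis"
    have "f c = f a" if "(a, c) \<in> (trans_step x y)\<^sup>*" for c
      using that
    proof (induction rule: rtrancl_induct)
      case (step u v)
      then obtain g where "g \<in> pol1" "(u, v) = (g x, g y) \<or> (u, v) = (g y, g x)"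
        unfolding trans_step_def by blast
      with neg step.IH show ?case by auto
    qed simp
    then have "f b = f a" using simple assms by blast
    then show False using assms by simp
  qed
  then show ?thesis using that by blast
qed

text \<open>The range of e is a minimal set in the sense of tame congruence theory: no nonconstant
  unary polynomial has a strictly smaller range inside it.\<close>

definition minimal_idempotent :: "('a \<Rightarrow> 'a) \<Rightarrow> bool" where
  "minimal_idempotent e \<longleftrightarrow> e \<in> pol1 \<and> (\<forall>x\<in>B. e (e x) = e x) \<and> (\<exists>a\<in>B. \<exists>b\<in>B. e a \<noteq> e b) \<and>
     (\<forall>r\<in>pol1. r ` B \<subseteq> e ` B \<longrightarrow> (\<forall>x\<in>B. \<forall>y\<in>B. r x = r y) \<or> r ` B = e ` B)"

text \<open>Choose a nonconstant f with the smallest range. Simplicity gives g such that f o g is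
  not constant on this range, so by minimality f o g permutes it. A factorial iterate of this
  permutation is the identity there and still maps B into the range.\<close>

lemma ex_minimal_idempotent: "\<exists>e. minimal_idempotent e"
proof -
  let ?nc = "\<lambda>f. f \<in> pol1 \<and> (\<exists>a\<in>B. \<exists>b\<in>B. f a \<noteq> f b)"
  have "?nc (\<lambda>x. x)" using nontriv pol1_id by auto
  then obtain f where f: "?nc f" and min: "\<And>g. ?nc g \<Longrightarrow> card (f ` B) \<le> card (g ` B)"
    using ex_has_least_nat[of ?nc "\<lambda>x. x" "\<lambda>f. card (f ` B)"] by blast
  have min': "r ` B = f ` B" if "?nc r" "r ` B \<subseteq> f ` B" for r
    using that min[of r] by (intro card_seteq) (auto simp: fin)
  from f obtain a b where ab: "a \<in> B" "b \<in> B" "f a \<noteq> f b" by blast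
  have fB: "f a \<in> B" "f b \<in> B" using f ab pol1_rng by auto
  obtain g where g: "g \<in> pol1" "f (g (f a)) \<noteq> f (g (f b))"
    using separating_translation[OF fB ab(3) ab] .
  define k where "k = (\<lambda>x. f (g x))"
  have k: "k \<in> pol1" unfolding k_def using f g pol1_comp by blast
  have kU: "k ` (f ` B) \<subseteq> f ` B"
    unfolding k_def using f g pol1_rng by auto
  have "(\<lambda>x. k (f x)) ` B = f ` B"
    using pol1_comp[OF k, of f] g f kU ab by (intro min') (auto simp: k_def)
  then have kim: "k ` (f ` B) = f ` B" by (simp add: image_image)
  have finU: "finite (f ` B)" using fin by simp
  have kinj: "inj_on k (f ` B)"
    using kim finU by (simp add: finite_surj_inj eq_card_imp_inj_on)
  define n where "n = (fact (card (f ` B)) :: nat)"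
  define e where "e = k ^^ n"
  have e: "e \<in> pol1" unfolding e_def by (rule pol1_funpow[OF k])
  have eU: "e x = x" if "x \<in> f ` B" for x
    unfolding e_def n_def using funpow_fact_inverse[OF finU kU kinj that] by simp
  have n: "n \<noteq> 0" unfolding n_def by simp
  have kB: "k x \<in> f ` B" if "x \<in> B" for x
    unfolding k_def using that g pol1_rng by auto
  have "e x \<in> f ` B" if "x \<in> B" for x
  proof -
    obtain l where l: "n = Suc l" using n by (cases n) auto
    have "(k ^^ l) x \<in> B" using that pol1_rng[OF pol1_funpow[OF k]] by blast
    then show ?thesis unfolding e_def l using kB by simp
  qed
  moreover have "f ` B \<subseteq> e ` B"
  proof
    fix y assume "y \<in> f ` B"
    moreover then have "y \<in> B" using f pol1_rng by auto
    ultimately show "y \<in> e ` B" using eU by (metis image_eqI)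
  qed
  ultimately have im: "e ` B = f ` B" by blast
  show ?thesis
    unfolding minimal_idempotent_def
  proof (intro exI[of _ e] conjI e ballI impI)
    show "e (e x) = e x" if "x \<in> B" for x
      using that im eU by blast
    show "\<exists>a\<in>B. \<exists>b\<in>B. e a \<noteq> e b"
      using eU ab fB by (metis imageI)
    show "(\<forall>x\<in>B. \<forall>y\<in>B. r x = r y) \<or> r ` B = e ` B" if "r \<in> pol1" "r ` B \<subseteq> e ` B" for r
      using min'[of r] that im by blast
  qed
qed

definition e where
  "e = (SOME e. minimal_idempotent e)"

definition U where "U = e ` B"

lemma e_minimal: "minimal_idempotent e"
  unfolding e_def by (rule someI_ex[OF ex_minimal_idempotent])

lemmas e_props = e_minimal[unfolded minimal_idempotent_def]

lemma e_pol: "e \<in> pol1"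
  using e_props by blast

lemma e_U: "x \<in> U \<Longrightarrow> e x = x"
  using e_props unfolding U_def by blast

lemma e_in: "x \<in> B \<Longrightarrow> e x \<in> U"
  unfolding U_def by blast

lemma U_sub: "x \<in> U \<Longrightarrow> x \<in> B"
  using e_pol pol1_rng unfolding U_def by blast

lemma U_fin: "finite U"
  unfolding U_def using fin by simp

lemma U_nontriv: "\<exists>a\<in>U. \<exists>b\<in>U. a \<noteq> b"
  using e_props unfolding U_def by blast

text \<open>Precomposing with \<open>e\<close> makes r a polynomial on all of B whose range lies in
  U, to which minimality applies.\<close>

lemma const_or_perm:
  assumes r: "r \<in> pol1" "\<And>x. x \<in> U \<Longrightarrow> r x \<in> U"
    and ab: "a \<in> U" "b \<in> U" "r a \<noteq> r b"
  shows "inj_on r U" "r ` U = U"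
proof -
  have re: "(\<lambda>x. r (e x)) \<in> pol1" using r e_pol pol1_comp by blast
  have sub: "(\<lambda>x. r (e x)) ` B \<subseteq> e ` B" using r(2) e_in unfolding U_def by auto
  have "r (e a) \<noteq> r (e b)" using ab e_U by simp
  then have "(\<lambda>x. r (e x)) ` B = e ` B"
    using e_props re sub U_sub ab(1,2) by blast
  then have "r ` (e ` B) = e ` B" by (simp add: image_image)
  then show "r ` U = U" unfolding U_def .
  then show "inj_on r U" using U_fin by (simp add: eq_card_imp_inj_on)
qed

text \<open>Iterating a permutation a factorial number of times gives the identity, so
  permutations of the minimal set have polynomial inverses.\<close>

definition NU :: nat where "NU = fact (card U)"

lemma perm_NU:
  assumes "r ` U \<subseteq> U" "inj_on r U" "x \<in> U"
  shows "(r ^^ NU) x = x"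
  unfolding NU_def using funpow_fact_inverse[OF U_fin assms] by simp

lemma perm_NU1:
  assumes "r ` U \<subseteq> U" "inj_on r U" "x \<in> U"
  shows "r ((r ^^ (NU - 1)) x) = x" "(r ^^ (NU - 1)) (r x) = x"
proof -
  have "NU = Suc (NU - 1)" unfolding NU_def by simp
  then show "r ((r ^^ (NU - 1)) x) = x" "(r ^^ (NU - 1)) (r x) = x"
    using perm_NU[OF assms] by (metis funpow.simps(2) comp_apply, metis funpow_simps_right(2) comp_apply)
qed

text \<open>A constant row next to a permuting row produces a semilattice pair. After iteration in
  the second argument row b is the identity and row a is a constant z; the two cases turn this table
  into a meet.\<close>

lemma const_row_propagates:
  assumes G: "G \<in> pol2" "\<And>x y. x \<in> U \<Longrightarrow> y \<in> U \<Longrightarrow> G x y \<in> U"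
    and ab: "a \<in> U" "b \<in> U"
    and c: "\<And>y y'. y \<in> U \<Longrightarrow> y' \<in> U \<Longrightarrow> G a y = G a y'"
    and nc: "u \<in> U" "v \<in> U" "G b u \<noteq> G b v"
  shows False
proof -
  have aB: "a \<in> B" "b \<in> B" using ab U_sub by auto
  have perm: "inj_on (G b) U" "G b ` U = U"
    using const_or_perm[of "G b", OF pol2_sec2[OF G(1) aB(2)]] G(2) ab nc by auto
  define g where "g = (\<lambda>x y. ((\<lambda>z. G x z) ^^ NU) y)"
  have g: "g \<in> pol2" unfolding g_def by (rule pol2_iter2[OF G(1)])
  have gU: "g x y \<in> U" if "x \<in> U" "y \<in> U" for x y
    unfolding g_def using that G(2) by (intro funpow_in) auto
  have gb: "g b y = y" if "y \<in> U" for y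
    unfolding g_def using perm_NU[of "G b"] perm that by auto
  define z where "z = g a a"
  have zU: "z \<in> U" unfolding z_def using gU ab by blast
  have ga: "g a y = z" if "y \<in> U" for y
  proof -
    obtain l where l: "NU = Suc l" unfolding NU_def by (metis fact_nonzero not0_implies_Suc)
    have "(G a ^^ l) y \<in> U" "(G a ^^ l) a \<in> U"
      using that ab G(2) by (auto intro!: funpow_in)
    from c[OF this] show ?thesis unfolding g_def z_def l by simp
  qed
  have "semilattice_pair z b \<or> semilattice_pair b a"
  proof (cases "z = b")
    case False
    \<comment> \<open>The column of b sends a to z and fixes b, so it is a permutation of U. Its
      polynomial inverse k sends z back to a, which makes g (k x) y a meet on {z, b} with bottom
      z.\<close>
    define h where "h = (\<lambda>x. g x b)"
    have h: "h \<in> pol1" unfolding h_def using pol2_sec1[OF g aB(2)] .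
    have hh: "h a = z" "h b = b" unfolding h_def using ga gb ab by auto
    have hU: "x \<in> U \<Longrightarrow> h x \<in> U" for x unfolding h_def using gU ab by blast
    have hp: "inj_on h U" "h ` U = U"
      using const_or_perm[of h, OF h hU ab] hh False by auto
    define k where "k = h ^^ (NU - 1)"
    have k: "k \<in> pol1" unfolding k_def by (rule pol1_funpow[OF h])
    have kk: "k b = b" "k z = a"
      unfolding k_def using perm_NU1(2)[of h b] perm_NU1(2)[of h a] hp ab hh by auto
    have "(\<lambda>x y. g (k x) y) \<in> pol2" using pol2_args[OF g k pol1_id] .
    moreover have "g (k b) b = b" "g (k b) z = z" "g (k z) b = z" "g (k z) z = z"
      using kk gb ga ab zU by auto
    ultimately have "semilattice_pair z b"
      using False aB U_sub[OF zU] by (intro semilattice_pairI)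
    then show ?thesis ..
  next
    case True
    have "a \<noteq> b" using c nc by metis
    \<comment> \<open>Here row a is constantly b and row b is the identity; feeding g into its own
      first argument gives the meet on {a, b} with bottom b.\<close>
    define j where "j = (\<lambda>x y. g (g x y) y)"
    have j: "j \<in> pol2" unfolding j_def using pol2_app2[OF g g pol2_right[OF pol1_id]] .
    have "j a a = a" "j a b = b" "j b a = b" "j b b = b"
      unfolding j_def using ga gb ab True zU by auto
    then have "semilattice_pair b a"
      using \<open>a \<noteq> b\<close> aB j by (intro semilattice_pairI[of j]) auto
    then show ?thesis ..
  qed
  then show False using no_sl by blast
qed

text \<open>By \<open>const_row_propagates\<close> one nonconstant row makes all rows nonconstant,
  hence permutations of U by \<open>const_or_perm\<close>.\<close>

lemma const_transfer:
  assumes G: "G \<in> pol2" "\<And>x y. x \<in> U \<Longrightarrow> y \<in> U \<Longrightarrow> G x y \<in> U"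
    and "a \<in> U" "b \<in> U" "u \<in> U" "v \<in> U" "G b u \<noteq> G b v"
    and "u' \<in> U" "v' \<in> U" "u' \<noteq> v'"
  shows "G a u' \<noteq> G a v'"
proof -
  obtain y y' where y: "y \<in> U" "y' \<in> U" "G a y \<noteq> G a y'"
    using const_row_propagates[OF G assms(3,4) _ assms(5-7)] by blast
  have "inj_on (G a) U"
    using const_or_perm(1)[of "G a", OF pol2_sec2[OF G(1)]] G(2) U_sub assms(3) y by blast
  then show ?thesis using assms(8-10) by (meson inj_onD)
qed

end

section \<open>Types of simple clones\<close>

context clone
begin

text \<open>The last clause says that mixed second differences of h o F vanish, so that h o F is a
  sum of functions of one variable each. Placing the carrier inside B bounds the group order by
  \<open>card B\<close> without leaving the type.\<close>

definition separated_map :: "'a monoid \<Rightarrow> ('a \<Rightarrow> 'a) \<Rightarrow> bool" where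
  "separated_map \<G> h \<longleftrightarrow> comm_group \<G> \<and> carrier \<G> \<subseteq> B \<and> h ` B \<subseteq> carrier \<G> \<and>
     (\<forall>F\<in>pol2. \<forall>x\<in>B. \<forall>y\<in>B. \<forall>x'\<in>B. \<forall>y'\<in>B.
        h (F x y) \<otimes>\<^bsub>\<G>\<^esub> h (F x' y') = h (F x y') \<otimes>\<^bsub>\<G>\<^esub> h (F x' y))"

end

section \<open>From the minimal set to the whole base set\<close>

context simple_clone
begin

text \<open>Two distinct points of U generate the full congruence, so B is connected by polynomial
  images of pairs from U. Facts about U are carried to B by walking along such chains.\<close>

lemma chain_induct [consumes 2, case_names base step]:
  assumes "x \<in> B" "y \<in> B" and "P x"
    and step: "\<And>g u v. g \<in> pol1 \<Longrightarrow> u \<in> U \<Longrightarrow> v \<in> U \<Longrightarrow> P (g u) \<Longrightarrow> P (g v)"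
  shows "P y"
proof -
  obtain a b where ab: "a \<in> U" "b \<in> U" "a \<noteq> b" using U_nontriv by blast
  then have "(x, y) \<in> (trans_step a b)\<^sup>*"
    using simple assms U_sub by blast
  then show ?thesis
  proof (induction rule: rtrancl_induct)
    case (step y z)
    then show ?case using assms(4) ab unfolding trans_step_def by blast
  qed (rule \<open>P x\<close>)
qed

lemma differ_on_U:
  assumes "x \<in> B" "y \<in> B" "f x \<noteq> f y"
  obtains g u v where "g \<in> pol1" "u \<in> U" "v \<in> U" "f (g u) \<noteq> f (g v)"
proof -
  have "\<exists>g\<in>pol1. \<exists>u\<in>U. \<exists>v\<in>U. f (g u) \<noteq> f (g v)"
  proof (rule ccontr)
    assume neg: "\<not> ?thesis"
    have "f x = f y"
      using assms(1,2) by (rule chain_induct[where P = "\<lambda>z. f x = f z"]) (use neg in \<open>simp, metis\<close>)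
    then show False using assms by simp
  qed
  then show ?thesis using that by blast
qed

definition U_closed :: "('a \<Rightarrow> 'a \<Rightarrow> 'a) \<Rightarrow> bool" where
  "U_closed G \<longleftrightarrow> (\<forall>x\<in>U. \<forall>y\<in>U. G x y \<in> U)"

definition const_right :: "'a set \<Rightarrow> ('a \<Rightarrow> 'a \<Rightarrow> 'a) \<Rightarrow> bool" where
  "const_right X G \<longleftrightarrow> (\<forall>x\<in>X. \<forall>y\<in>X. \<forall>y'\<in>X. G x y = G x y')"

lemma const_rightD: "const_right X G \<Longrightarrow> x \<in> X \<Longrightarrow> y \<in> X \<Longrightarrow> y' \<in> X \<Longrightarrow> G x y = G x y'"
  unfolding const_right_def by blast

text \<open>Each pullback of F along unary polynomials to U x U falls under the hypothesis. Once F
  varies in its first argument somewhere, chain walks in both arguments show that it never varies in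
  the second.\<close>

lemma unary_type_dependence:
  assumes un: "\<And>G. G \<in> pol2 \<Longrightarrow> U_closed G \<Longrightarrow> const_right U G \<or> const_right U (\<lambda>x y. G y x)"
    and F: "F \<in> pol2" "\<And>x y. x \<in> B \<Longrightarrow> y \<in> B \<Longrightarrow> F x y \<in> U"
  shows "const_right B F \<or> const_right B (\<lambda>x y. F y x)"
proof (cases "const_right B (\<lambda>x y. F y x)")
  case False
  then obtain y0 x1 x2 where y0: "y0 \<in> B" "x1 \<in> B" "x2 \<in> B" "F x1 y0 \<noteq> F x2 y0"
    unfolding const_right_def by blast
  then obtain q u v where q: "q \<in> pol1" "u \<in> U" "v \<in> U" "F (q u) y0 \<noteq> F (q v) y0"
    using differ_on_U[of x1 x2 "\<lambda>x. F x y0"] by metis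
  have alt: "const_right U (\<lambda>x y. F (g x) (h y)) \<or> const_right U (\<lambda>x y. F (g y) (h x))"
    if "g \<in> pol1" "h \<in> pol1" for g h
    using un[OF pol2_args[OF F(1) that]] that F(2) pol1_rng U_sub by (auto simp: U_closed_def)
  \<comment> \<open>The values on the image of U under q do not change along the chain, so q u and q
    v stay separated. This rules out that the pullback is independent of its first argument.\<close>
  have c1: "\<forall>x\<in>U. F (q x) y = F (q x) y0" if "y \<in> B" for y
    using y0(1) that
  proof (rule chain_induct)
    fix g z w
    assume g: "g \<in> pol1" "z \<in> U" "w \<in> U" and IH: "\<forall>x\<in>U. F (q x) (g z) = F (q x) y0"
    then have "F (q u) (g z) \<noteq> F (q v) (g z)" using q by simp
    then have "\<not> const_right U (\<lambda>x y. F (q y) (g x))"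
      using g q unfolding const_right_def by blast
    then have "const_right U (\<lambda>x y. F (q x) (g y))"
      using alt[OF q(1) g(1)] by blast
    then have "F (q x) (g w) = F (q x) (g z)" if "x \<in> U" for x
      using const_rightD[of U "\<lambda>x y. F (q x) (g y)" x w z] that g by blast
    then show "\<forall>x\<in>U. F (q x) (g w) = F (q x) y0" using IH by simp
  qed auto
  have "\<forall>y\<in>B. \<forall>y'\<in>B. F x y = F x y'" if "x \<in> B" for x
    using pol1_rng[OF q(1) U_sub[OF q(2)]] that
  proof (rule chain_induct)
    show "\<forall>y\<in>B. \<forall>y'\<in>B. F (q u) y = F (q u) y'" using c1 q by metis
  next
    fix g s t
    assume g: "g \<in> pol1" "s \<in> U" "t \<in> U" and IH: "\<forall>y\<in>B. \<forall>y'\<in>B. F (g s) y = F (g s) y'"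
    show "\<forall>y\<in>B. \<forall>y'\<in>B. F (g t) y = F (g t) y'"
    proof (intro ballI)
      fix y y' assume yy: "y \<in> B" "y' \<in> B"
      show "F (g t) y = F (g t) y'"
        using yy
      proof (rule chain_induct)
        fix h z w
        assume h: "h \<in> pol1" "z \<in> U" "w \<in> U" and eq: "F (g t) y = F (g t) (h z)"
        have hB: "h z \<in> B" "h w \<in> B" using h pol1_rng U_sub by auto
        from alt[OF g(1) h(1)] have "F (g t) (h z) = F (g t) (h w)"
        proof
          assume "const_right U (\<lambda>x y. F (g x) (h y))"
          from const_rightD[OF this g(3) h(2,3)] show ?thesis .
        next
          \<comment> \<open>Independence of the first argument lets row \<open>g t\<close> copy row
            \<open>g s\<close>, which is already constant.\<close>
          assume c: "const_right U (\<lambda>x y. F (g y) (h x))"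
          have "F (g t) (h z) = F (g s) (h z)" using const_rightD[OF c h(2) g(3,2)] .
          also have "\<dots> = F (g s) (h w)" using IH hB by blast
          also have "\<dots> = F (g t) (h w)" using const_rightD[OF c h(3) g(2,3)] .
          finally show ?thesis .
        qed
        with eq show "F (g t) y = F (g t) (h w)" by simp
      qed simp
    qed
  qed
  then show ?thesis unfolding const_right_def by blast
qed simp

end

text \<open>\<open>d\<close> plays the role of x - y + z on U. Only unary and binary polynomials
  have names here, so polynomiality of the ternary \<open>d\<close> is recorded as closure of
  \<open>pol2\<close>.\<close>

locale affine_type = simple_clone +
  fixes d :: "'a \<Rightarrow> 'a \<Rightarrow> 'a \<Rightarrow> 'a"
  assumes dU: "x \<in> U \<Longrightarrow> y \<in> U \<Longrightarrow> z \<in> U \<Longrightarrow> d x y z \<in> U"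
    and d1: "x \<in> U \<Longrightarrow> y \<in> U \<Longrightarrow> d x y y = x"
    and d2: "x \<in> U \<Longrightarrow> y \<in> U \<Longrightarrow> d y y x = x"
    and d_cancel: "x \<in> U \<Longrightarrow> y \<in> U \<Longrightarrow> z \<in> U \<Longrightarrow> d x y z = z \<Longrightarrow> x = y"
    and d_pol: "f \<in> pol2 \<Longrightarrow> g \<in> pol2 \<Longrightarrow> h \<in> pol2 \<Longrightarrow> (\<lambda>x y. d (f x y) (g x y) (h x y)) \<in> pol2"
begin

definition into_U :: "('a \<Rightarrow> 'a \<Rightarrow> 'a) \<Rightarrow> bool" where
  "into_U f \<longleftrightarrow> (\<forall>x\<in>B. \<forall>y\<in>B. f x y \<in> U)"

lemma into_UD: "into_U f \<Longrightarrow> x \<in> B \<Longrightarrow> y \<in> B \<Longrightarrow> f x y \<in> U"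
  unfolding into_U_def by blast

text \<open>Subtracting column c by means of \<open>d\<close> makes column c of h constantly z and
  also gives h a c' = z. Constancy of a column passes along chains from c to c' by
  \<open>const_transfer\<close>, so h b c' = z, and \<open>d_cancel\<close> returns the
  claim.\<close>

lemma term_condition2:
  assumes f: "f \<in> pol2" "into_U f"
    and B: "a \<in> B" "b \<in> B" "c \<in> B" "c' \<in> B" and eq: "f a c = f a c'"
  shows "f b c = f b c'"
proof (rule ccontr)
  assume neq: "f b c \<noteq> f b c'"
  obtain z where z: "z \<in> U" using U_nontriv by blast
  define h where "h = (\<lambda>x y. d (f x y) (f x c) z)"
  have h: "h \<in> pol2" unfolding h_def
    using d_pol[OF f(1) pol2_left[OF pol2_sec1[OF f(1) B(3)]] pol2_left[OF pol1_const[OF U_sub[OF z]]]] .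
  have hU: "h x y \<in> U" if "x \<in> B" "y \<in> B" for x y
    unfolding h_def using that B z into_UD[OF f(2)] dU by simp
  have hc: "h x c = z" if "x \<in> B" for x
    unfolding h_def using that B z into_UD[OF f(2)] d2 by simp
  have ha: "h a c' = z" unfolding h_def using eq B z into_UD[OF f(2)] d2 by simp
  have "h b c' \<noteq> z" unfolding h_def using neq d_cancel B z into_UD[OF f(2)] by metis
  with ha obtain q u v where q: "q \<in> pol1" "u \<in> U" "v \<in> U" "h (q u) c' \<noteq> h (q v) c'"
    using differ_on_U[of a b "\<lambda>x. h x c'"] B by metis
  have "\<forall>x\<in>U. \<forall>x'\<in>U. h (q x) c' = h (q x') c'"
    using B(3,4)
  proof (rule chain_induct)
    show "\<forall>x\<in>U. \<forall>x'\<in>U. h (q x) c = h (q x') c"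
      using hc pol1_rng[OF q(1)] U_sub by simp
  next
    fix g s t
    assume g: "g \<in> pol1" "s \<in> U" "t \<in> U" and IH: "\<forall>x\<in>U. \<forall>x'\<in>U. h (q x) (g s) = h (q x') (g s)"
    show "\<forall>x\<in>U. \<forall>x'\<in>U. h (q x) (g t) = h (q x') (g t)"
    proof (intro ballI, rule ccontr)
      fix x x' assume x: "x \<in> U" "x' \<in> U" "h (q x) (g t) \<noteq> h (q x') (g t)"
      have H: "(\<lambda>y x. h (q x) (g y)) \<in> pol2"
        using pol2_swap[OF pol2_args[OF h q(1) g(1)]] .
      have "h (q x) (g s) \<noteq> h (q x') (g s)"
      proof (rule const_transfer[OF H _ g(2,3) x(1,2) x(3) x(1,2)])
        show "h (q y) (g x) \<in> U" if "x \<in> U" "y \<in> U" for x y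
          using that hU pol1_rng q g U_sub by simp
        show "x \<noteq> x'" using x by metis
      qed
      then show False using IH x by blast
    qed
  qed
  then show False using q by blast
qed

text \<open>The difference d (f x y) (g x y) z equals z on the cross through (a, b), so by
  \<open>term_condition2\<close> it is z everywhere. The group laws below are thereby reduced to the
  cases where an argument is \<open>u0\<close>.\<close>

lemma agreement:
  assumes f: "f \<in> pol2" "into_U f" and g: "g \<in> pol2" "into_U g"
    and B: "a \<in> B" "b \<in> B"
    and 1: "\<And>y. y \<in> B \<Longrightarrow> f a y = g a y" and 2: "\<And>x. x \<in> B \<Longrightarrow> f x b = g x b"
    and xy: "x \<in> B" "y \<in> B"
  shows "f x y = g x y"
proof -
  obtain z where z: "z \<in> U" using U_nontriv by blast
  define D where "D = (\<lambda>x y. d (f x y) (g x y) z)"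
  have D: "D \<in> pol2" unfolding D_def
    using d_pol[OF f(1) g(1) pol2_left[OF pol1_const[OF U_sub[OF z]]]] .
  have DU: "into_U D"
    unfolding D_def using into_UD[OF f(2)] into_UD[OF g(2)] z dU by (simp add: into_U_def)
  have "D a b = z" "D a y = z" "D x b = z"
    unfolding D_def using 1 2 B xy into_UD[OF g(2)] z d2 by auto
  with term_condition2[OF D DU B(1) xy(1) B(2) xy(2)] have "D x y = z" by simp
  then show ?thesis
    unfolding D_def using d_cancel into_UD[OF f(2)] into_UD[OF g(2)] z xy by blast
qed

definition u0 where "u0 = (SOME z. z \<in> U)"

lemma u0_in: "u0 \<in> U"
  unfolding u0_def using U_nontriv by (metis someI)

definition add (infixl "\<oplus>\<^sub>d" 65) where "x \<oplus>\<^sub>d y = d x u0 y"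

lemma add_in: "x \<in> U \<Longrightarrow> y \<in> U \<Longrightarrow> x \<oplus>\<^sub>d y \<in> U"
  unfolding add_def using dU u0_in by simp

lemma o_add: "x \<in> U \<Longrightarrow> u0 \<oplus>\<^sub>d x = x"
  unfolding add_def using d2 u0_in by simp

lemma add_o: "x \<in> U \<Longrightarrow> x \<oplus>\<^sub>d u0 = x"
  unfolding add_def using d1 u0_in by simp

lemma add_pol: "f \<in> pol2 \<Longrightarrow> g \<in> pol2 \<Longrightarrow> (\<lambda>x y. f x y \<oplus>\<^sub>d g x y) \<in> pol2"
  unfolding add_def using d_pol[OF _ pol2_left[OF pol1_const[OF U_sub[OF u0_in]]]] by blast

lemma add_into: "into_U f \<Longrightarrow> into_U g \<Longrightarrow> into_U (\<lambda>x y. f x y \<oplus>\<^sub>d g x y)"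
  unfolding into_U_def using add_in by simp

lemma into_U_simple:
  "into_U (\<lambda>x y. e x)" "into_U (\<lambda>x y. e y)" "u \<in> U \<Longrightarrow> into_U (\<lambda>x y. u)"
  unfolding into_U_def using e_in by auto

lemma const_pol2: "u \<in> U \<Longrightarrow> (\<lambda>x y. u) \<in> pol2"
  using pol2_left[OF pol1_const[OF U_sub]] .

lemmas pol2_intros = add_pol pol2_left[OF e_pol] pol2_right[OF e_pol] const_pol2
lemmas into_intros = add_into into_U_simple

lemma add_comm:
  assumes "x \<in> U" "y \<in> U"
  shows "x \<oplus>\<^sub>d y = y \<oplus>\<^sub>d x"
proof -
  have "e x \<oplus>\<^sub>d e y = e y \<oplus>\<^sub>d e x"
    by (rule agreement[where a = u0 and b = u0 and f = "\<lambda>x y. e x \<oplus>\<^sub>d e y" and g = "\<lambda>x y. e y \<oplus>\<^sub>d e x"])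
      (use assms in \<open>simp_all add: pol2_intros into_intros U_sub u0_in e_U[OF u0_in] o_add add_o e_in\<close>)
  then show ?thesis using assms e_U by simp
qed

lemma add_assoc:
  assumes "x \<in> U" "y \<in> U" "z \<in> U"
  shows "(x \<oplus>\<^sub>d y) \<oplus>\<^sub>d z = x \<oplus>\<^sub>d (y \<oplus>\<^sub>d z)"
proof -
  have "(e x \<oplus>\<^sub>d e y) \<oplus>\<^sub>d z = e x \<oplus>\<^sub>d (e y \<oplus>\<^sub>d z)"
    by (rule agreement[where a = u0 and b = u0 and f = "\<lambda>x y. (e x \<oplus>\<^sub>d e y) \<oplus>\<^sub>d z"
          and g = "\<lambda>x y. e x \<oplus>\<^sub>d (e y \<oplus>\<^sub>d z)"])
      (use assms in \<open>simp_all add: pol2_intros into_intros U_sub u0_in e_U[OF u0_in] o_add add_o e_in add_in\<close>)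
  then show ?thesis using assms e_U by simp
qed

lemma add_cancel:
  assumes "x \<in> U" "y \<in> U" "z \<in> U" "x \<oplus>\<^sub>d y = x \<oplus>\<^sub>d z"
  shows "y = z"
proof -
  have "e u0 \<oplus>\<^sub>d e y = e u0 \<oplus>\<^sub>d e z"
    by (rule term_condition2[where a = x and f = "\<lambda>x y. e x \<oplus>\<^sub>d e y"])
      (use assms in \<open>simp_all add: pol2_intros into_intros U_sub u0_in e_U\<close>)
  then show ?thesis using assms by (simp add: e_U u0_in o_add)
qed

definition Ugroup :: "'a monoid" where
  "Ugroup = \<lparr>carrier = U, mult = (\<lambda>x y. x \<oplus>\<^sub>d y), one = u0\<rparr>"

lemma Ugroup_comm_group: "comm_group Ugroup"
proof (rule comm_groupI)
  fix x assume "x \<in> carrier Ugroup"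
  then have x: "x \<in> U" by (simp add: Ugroup_def)
  have "inj_on (\<lambda>y. x \<oplus>\<^sub>d y) U" using add_cancel[OF x] by (intro inj_onI)
  then have "(\<lambda>y. x \<oplus>\<^sub>d y) ` U = U"
    using add_in x by (intro endo_inj_surj U_fin) auto
  then obtain y where y: "y \<in> U" "x \<oplus>\<^sub>d y = u0" using u0_in by (metis imageE)
  then have "y \<oplus>\<^sub>d x = u0" using add_comm x by simp
  then show "\<exists>y\<in>carrier Ugroup. y \<otimes>\<^bsub>Ugroup\<^esub> x = \<one>\<^bsub>Ugroup\<^esub>"
    using y(1) by (auto simp: Ugroup_def)
qed (auto simp: Ugroup_def add_in add_assoc o_add u0_in intro: add_comm)

lemma separated:
  assumes f: "f \<in> pol2" "into_U f" and B: "x \<in> B" "y \<in> B" "x' \<in> B" "y' \<in> B"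
  shows "f x y \<oplus>\<^sub>d f x' y' = f x y' \<oplus>\<^sub>d f x' y"
proof (rule agreement[where a = x' and b = y' and f = "\<lambda>x y. f x y \<oplus>\<^sub>d f x' y'"
      and g = "\<lambda>x y. f x y' \<oplus>\<^sub>d f x' y"])
  note fU = into_UD[OF f(2)]
  show "(\<lambda>x y. f x y \<oplus>\<^sub>d f x' y') \<in> pol2"
    using add_pol[OF f(1) const_pol2[OF fU[OF B(3,4)]]] .
  show "(\<lambda>x y. f x y' \<oplus>\<^sub>d f x' y) \<in> pol2"
    using add_pol[OF pol2_left[OF pol2_sec1[OF f(1) B(4)]] pol2_right[OF pol2_sec2[OF f(1) B(3)]]] .
  show "into_U (\<lambda>x y. f x y \<oplus>\<^sub>d f x' y')" "into_U (\<lambda>x y. f x y' \<oplus>\<^sub>d f x' y)"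
    unfolding into_U_def using add_in fU B by simp_all
  show "f x' y \<oplus>\<^sub>d f x' y' = f x' y' \<oplus>\<^sub>d f x' y" if "y \<in> B" for y
    using that B fU add_comm by simp
qed (use B in auto)

end

section \<open>Quasigroup polynomials and separated maps\<close>

context simple_clone
begin

text \<open>By \<open>const_transfer\<close> all rows and columns of G permute U. So G is a
  quasigroup there, and its divisions L and R are polynomials because inverse permutations are
  iterates. The d below is the usual Maltsev term of a quasigroup.\<close>

lemma ex_affine_type:
  assumes G: "G \<in> pol2" "U_closed G" and nc: "\<not> const_right U G" "\<not> const_right U (\<lambda>x y. G y x)"
  shows "\<exists>d. affine_type B C d"
proof -
  have GU: "x \<in> U \<Longrightarrow> y \<in> U \<Longrightarrow> G x y \<in> U" for x y
    using G(2) unfolding U_closed_def by blast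
  have r: "inj_on (G x) U" if "x \<in> U" for x
  proof (rule inj_onI, rule ccontr)
    fix y z assume "y \<in> U" "z \<in> U" "G x y = G x z" "y \<noteq> z"
    moreover obtain a u v where "a \<in> U" "u \<in> U" "v \<in> U" "G a u \<noteq> G a v"
      using nc(1) unfolding const_right_def by blast
    ultimately show False using const_transfer[OF G(1) GU that, of a u v y z] by blast
  qed
  have l: "inj_on (\<lambda>z. G z x) U" if "x \<in> U" for x
  proof (rule inj_onI, rule ccontr)
    fix y z assume "y \<in> U" "z \<in> U" "G y x = G z x" "y \<noteq> z"
    moreover obtain a u v where "a \<in> U" "u \<in> U" "v \<in> U" "G u a \<noteq> G v a"
      using nc(2) unfolding const_right_def by blast
    ultimately show False using const_transfer[OF pol2_swap[OF G(1)] GU that, of a u v y z] by blast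
  qed
  define L where "L = (\<lambda>x y. (G x ^^ (NU - 1)) y)"
  define R where "R = (\<lambda>x y. ((\<lambda>z. G z y) ^^ (NU - 1)) x)"
  have L: "L \<in> pol2" unfolding L_def using pol2_iter2[OF G(1)] by simp
  have R: "R \<in> pol2" unfolding R_def using pol2_swap[OF pol2_iter2[OF pol2_swap[OF G(1)]]] .
  have LU: "L x y \<in> U" if "x \<in> U" "y \<in> U" for x y
    unfolding L_def using that GU by (intro funpow_in) auto
  have RU: "R x y \<in> U" if "x \<in> U" "y \<in> U" for x y
    unfolding R_def using that GU by (intro funpow_in) auto
  have GL: "G x (L x y) = y" "L x (G x y) = y" if "x \<in> U" "y \<in> U" for x y
    unfolding L_def using perm_NU1[of "G x" y] that GU r by auto
  have GR: "G (R x y) y = x" "R (G x y) y = x" if "x \<in> U" "y \<in> U" for x y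
    unfolding R_def using perm_NU1[of "\<lambda>z. G z y" x] that GU l by auto
  define d where "d = (\<lambda>x y z. G (R x (L y y)) (L y z))"
  have "affine_type B C d"
  proof unfold_locales
    fix x y z assume x: "x \<in> U" and y: "y \<in> U"
    show "d x y y = x" unfolding d_def using x y LU GR by simp
    have R1: "R y (L y y) = y" using GL(1)[OF y y] GR(2)[OF y LU[OF y y]] by simp
    then show "d y y x = x" unfolding d_def using GL(1)[OF y x] by simp
    assume z: "z \<in> U"
    show "d x y z \<in> U" unfolding d_def using x y z GU LU RU by simp
    assume eq: "d x y z = z"
    also have "z = d y y z" unfolding d_def R1 using GL(1)[OF y z] by simp
    finally have "R x (L y y) = R y (L y y)"
      unfolding d_def using inj_onD[OF l[OF LU[OF y z]]] RU LU x y by blast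
    then show "x = y" using GR(1)[OF x LU[OF y y]] GR(1)[OF y LU[OF y y]] by simp
  next
    fix f g h assume "f \<in> pol2" "g \<in> pol2" "h \<in> pol2"
    then show "(\<lambda>x y. d (f x y) (g x y) (h x y)) \<in> pol2"
      unfolding d_def
      using pol2_app2[OF G(1) pol2_app2[OF R _ pol2_app2[OF L]] pol2_app2[OF L]] by blast
  qed
  then show ?thesis by (rule exI[of _ d])
qed

text \<open>In the unary case an indicator function depends on at most one argument,
  so that it is separated for the group structure on any two-element set.\<close>

lemma two_element_comm_group:
  assumes "a \<noteq> b"
  shows "comm_group \<lparr>carrier = {a, b}, mult = (\<lambda>x y. if x = y then a else b), one = a\<rparr>"
  using assms by (intro comm_groupI) auto

text \<open>A translation followed by \<open>e\<close> moves the pair into U and keeps it apart.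
  There either every binary polynomial depends on one variable only, or a quasigroup polynomial
  yields the group \<open>Ugroup\<close>.\<close>

lemma ex_separated_map:
  assumes xy: "x \<in> B" "y \<in> B" "x \<noteq> y"
  shows "\<exists>\<G> h. separated_map \<G> h \<and> h x \<noteq> h y"
proof -
  obtain a b where "a \<in> B" "b \<in> B" "e a \<noteq> e b" using e_props by blast
  then obtain g where g: "g \<in> pol1" "e (g x) \<noteq> e (g y)"
    using separating_translation[OF xy, of a b e] by metis
  define h where "h = (\<lambda>x. e (g x))"
  have h: "h \<in> pol1" unfolding h_def using pol1_comp[OF e_pol g(1)] .
  have hU: "h x \<in> U" if "x \<in> B" for x
    unfolding h_def using that e_in pol1_rng[OF g(1)] by blast
  have hxy: "h x \<noteq> h y" unfolding h_def by fact
  show ?thesis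
  proof (cases "\<forall>G\<in>pol2. U_closed G \<longrightarrow> const_right U G \<or> const_right U (\<lambda>x y. G y x)")
    case True
    define k where "k = (\<lambda>z. if h z = h x then h x else h y)"
    define \<G> where "\<G> = \<lparr>carrier = {h x, h y}, mult = (\<lambda>s t. if s = t then h x else h y), one = h x\<rparr>"
    have "separated_map \<G> k"
      unfolding separated_map_def
    proof (intro conjI ballI)
      show "comm_group \<G>" unfolding \<G>_def using two_element_comm_group[OF hxy] .
      show "carrier \<G> \<subseteq> B" unfolding \<G>_def using hU U_sub xy by auto
      show "k ` B \<subseteq> carrier \<G>" unfolding \<G>_def k_def by auto
      fix F s t s' t' assume F: "F \<in> pol2" and B: "s \<in> B" "t \<in> B" "s' \<in> B" "t' \<in> B"
      have "const_right B (\<lambda>x y. h (F x y)) \<or> const_right B (\<lambda>x y. h (F y x))"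
        using True by (intro unary_type_dependence pol2_app1[OF h F] hU pol2_rng[OF F]) auto
      then have "h (F s t) = h (F s t') \<and> h (F s' t) = h (F s' t') \<or>
          h (F s t) = h (F s' t) \<and> h (F s t') = h (F s' t')"
        unfolding const_right_def using B by blast
      then show "k (F s t) \<otimes>\<^bsub>\<G>\<^esub> k (F s' t') = k (F s t') \<otimes>\<^bsub>\<G>\<^esub> k (F s' t)"
        unfolding k_def \<G>_def by auto
    qed
    moreover have "k x \<noteq> k y" unfolding k_def using hxy by simp
    ultimately show ?thesis by blast
  next
    case False
    then obtain d where "affine_type B C d" using ex_affine_type by blast
    then interpret affine_type B C d .
    have "separated_map Ugroup h"
      unfolding separated_map_def
    proof (intro conjI ballI Ugroup_comm_group)
      show "carrier Ugroup \<subseteq> B" "h ` B \<subseteq> carrier Ugroup"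
        unfolding Ugroup_def using hU U_sub by auto
      fix F s t s' t' assume F: "F \<in> pol2" and B: "s \<in> B" "t \<in> B" "s' \<in> B" "t' \<in> B"
      have "into_U (\<lambda>x y. h (F x y))" unfolding into_U_def using hU pol2_rng[OF F] by blast
      from separated[OF pol2_app1[OF h F] this B]
      show "h (F s t) \<otimes>\<^bsub>Ugroup\<^esub> h (F s' t') = h (F s t') \<otimes>\<^bsub>Ugroup\<^esub> h (F s' t)"
        by (simp add: Ugroup_def)
    qed
    then show ?thesis using hxy by blast
  qed
qed

end

section \<open>Polynomials and congruences of a finite algebra\<close>

inductive_set pol_funs :: "'a set \<Rightarrow> ('f \<Rightarrow> nat) \<Rightarrow> ('f \<Rightarrow> 'a list \<Rightarrow> 'a) \<Rightarrow> ((nat \<Rightarrow> 'a) \<Rightarrow> 'a) set"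
  for A ar F where
  var: "(\<lambda>\<rho>. \<rho> v) \<in> pol_funs A ar F"
| const: "a \<in> A \<Longrightarrow> (\<lambda>\<rho>. a) \<in> pol_funs A ar F"
| comp: "length ts = ar f \<Longrightarrow> \<forall>t\<in>set ts. t \<in> pol_funs A ar F \<Longrightarrow>
         (\<lambda>\<rho>. F f (map (\<lambda>t. t \<rho>) ts)) \<in> pol_funs A ar F"

text \<open>\<open>pol_funs\<close> is generated syntactically and need not be closed under changing
  values outside A; this completion is what \<open>ext\<close> of a clone demands.\<close>

definition pol_clone :: "'a set \<Rightarrow> ('f \<Rightarrow> nat) \<Rightarrow> ('f \<Rightarrow> 'a list \<Rightarrow> 'a) \<Rightarrow> ((nat \<Rightarrow> 'a) \<Rightarrow> 'a) set" where
  "pol_clone A ar F = {f. \<exists>p\<in>pol_funs A ar F. \<forall>\<rho>. range \<rho> \<subseteq> A \<longrightarrow> f \<rho> = p \<rho>}"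

lemma pol_cloneI: "p \<in> pol_funs A ar F \<Longrightarrow> p \<in> pol_clone A ar F"
  unfolding pol_clone_def by blast

lemma pol_cloneE:
  assumes "f \<in> pol_clone A ar F"
  obtains p where "p \<in> pol_funs A ar F" "\<And>\<rho>. range \<rho> \<subseteq> A \<Longrightarrow> f \<rho> = p \<rho>"
proof -
  obtain p where "p \<in> pol_funs A ar F" "\<forall>\<rho>. range \<rho> \<subseteq> A \<longrightarrow> f \<rho> = p \<rho>"
    using assms unfolding pol_clone_def mem_Collect_eq by (elim bexE)
  then show ?thesis by (intro that[of p]) simp_all
qed

lemma pol_funs_sub: "p \<in> pol_funs A ar F \<Longrightarrow> (\<And>v. \<sigma> v \<in> pol_funs A ar F) \<Longrightarrow> (\<lambda>\<rho>. p (\<lambda>v. \<sigma> v \<rho>)) \<in> pol_funs A ar F"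
proof (induction rule: pol_funs.induct)
  case (comp ts f)
  have "(\<lambda>\<rho>. F f (map (\<lambda>t. t \<rho>) (map (\<lambda>t \<rho>. t (\<lambda>v. \<sigma> v \<rho>)) ts))) \<in> pol_funs A ar F"
    using comp by (intro pol_funs.comp) auto
  then show ?case by (simp add: comp_def)
qed (simp_all add: pol_funs.const)

lemma pol_funs_rng:
  assumes "is_algebra A ar F"
  shows "p \<in> pol_funs A ar F \<Longrightarrow> range \<rho> \<subseteq> A \<Longrightarrow> p \<rho> \<in> A"
proof (induction rule: pol_funs.induct)
  case (comp ts f)
  then have "set (map (\<lambda>t. t \<rho>) ts) \<subseteq> A" by auto
  then show ?case using assms comp unfolding is_algebra_def by simp
qed auto

lemma pol_clone_clone:
  assumes alg: "is_algebra A ar F" and fin: "finite A"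
  shows "clone A (pol_clone A ar F)"
proof
  fix f and \<sigma> :: "nat \<Rightarrow> (nat \<Rightarrow> 'a) \<Rightarrow> 'a"
  assume f: "f \<in> pol_clone A ar F" and \<sigma>: "\<And>v. \<sigma> v \<in> pol_clone A ar F"
  obtain p where p: "p \<in> pol_funs A ar F" "\<And>\<rho>. range \<rho> \<subseteq> A \<Longrightarrow> f \<rho> = p \<rho>"
    using pol_cloneE[OF f] by metis
  have "\<forall>v. \<exists>q. q \<in> pol_funs A ar F \<and> (\<forall>\<rho>. range \<rho> \<subseteq> A \<longrightarrow> \<sigma> v \<rho> = q \<rho>)"
    using \<sigma> unfolding pol_clone_def mem_Collect_eq by metis
  then obtain q where q: "\<And>v. q v \<in> pol_funs A ar F" "\<And>v \<rho>. range \<rho> \<subseteq> A \<Longrightarrow> \<sigma> v \<rho> = q v \<rho>"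
    by metis
  have "f (\<lambda>v. \<sigma> v \<rho>) = p (\<lambda>v. q v \<rho>)" if "range \<rho> \<subseteq> A" for \<rho>
  proof -
    have "range (\<lambda>v. q v \<rho>) \<subseteq> A" using pol_funs_rng[OF alg q(1) that] by auto
    then show ?thesis using q(2)[OF that] p(2) by simp
  qed
  with pol_funs_sub[OF p(1) q(1)] show "(\<lambda>\<rho>. f (\<lambda>v. \<sigma> v \<rho>)) \<in> pol_clone A ar F"
    unfolding pol_clone_def mem_Collect_eq by (intro bexI allI impI)
next
  fix f :: "(nat \<Rightarrow> 'a) \<Rightarrow> 'a" and \<rho> :: "nat \<Rightarrow> 'a"
  assume "f \<in> pol_clone A ar F" "range \<rho> \<subseteq> A"
  then obtain p where "p \<in> pol_funs A ar F" "f \<rho> = p \<rho>" by (metis pol_cloneE)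
  then show "f \<rho> \<in> A" using pol_funs_rng[OF alg _ \<open>range \<rho> \<subseteq> A\<close>] by simp
next
  fix f g :: "(nat \<Rightarrow> 'a) \<Rightarrow> 'a"
  assume "f \<in> pol_clone A ar F" "\<And>\<rho>. range \<rho> \<subseteq> A \<Longrightarrow> f \<rho> = g \<rho>"
  then show "g \<in> pol_clone A ar F" unfolding pol_clone_def mem_Collect_eq by metis
next
  show "finite A" by (rule fin)
  show "(\<lambda>\<rho>. \<rho> v) \<in> pol_clone A ar F" for v by (rule pol_cloneI[OF pol_funs.var])
  show "(\<lambda>\<rho>. b) \<in> pol_clone A ar F" if "b \<in> A" for b by (rule pol_cloneI[OF pol_funs.const[OF that]])
qed

text \<open>Constants become variables: \<open>as\<close> lists all of A, and each constant is read
  off from one of the additional positions. The default \<open>a0\<close> for variables from k on is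
  treated in the same way.\<close>

lemma pol_funs_term:
  assumes a0: "a0 \<in> A" and as: "set as = A"
  shows "p \<in> pol_funs A ar F \<Longrightarrow> \<exists>t\<in>term_ops ar F (k + length as).
    \<forall>xs. length xs = k \<longrightarrow> p (\<lambda>v. if v < k then xs ! v else a0) = t (xs @ as)"
proof (induction rule: pol_funs.induct)
  case (var v)
  show ?case
  proof (cases "v < k")
    case True
    then show ?thesis
      by (intro bexI[OF _ term_ops.proj[of v]]) (auto simp: nth_append)
  next
    case False
    obtain i where "i < length as" "as ! i = a0" using a0 as by (metis in_set_conv_nth)
    then show ?thesis using False
      by (intro bexI[OF _ term_ops.proj[of "k + i"]]) (auto simp: nth_append)
  qed
next
  case (const a)
  obtain i where "i < length as" "as ! i = a" using const as by (metis in_set_conv_nth)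
  then show ?case
    by (intro bexI[OF _ term_ops.proj[of "k + i"]]) (auto simp: nth_append)
next
  case (comp ts f)
  then obtain S where S: "\<And>t. t \<in> set ts \<Longrightarrow> S t \<in> term_ops ar F (k + length as)"
    "\<And>t xs. t \<in> set ts \<Longrightarrow> length xs = k \<Longrightarrow> t (\<lambda>v. if v < k then xs ! v else a0) = S t (xs @ as)"
    by metis
  have "(\<lambda>ys. F f (map (\<lambda>t. t ys) (map S ts))) \<in> term_ops ar F (k + length as)"
    using comp(1) S by (intro term_ops.comp) auto
  then show ?case
    by (rule bexI[rotated]) (auto simp: S(2) comp_def cong: map_cong)
qed

lemma pol_funs_poly_ops:
  assumes a0: "a0 \<in> A"
  shows "p \<in> pol_funs A ar F \<Longrightarrow> \<exists>t\<in>poly_ops A ar F k. \<forall>xs. t xs = p (\<lambda>v. if v < k then xs ! v else a0)"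
proof (induction rule: pol_funs.induct)
  case (var v)
  show ?case
  proof (cases "v < k")
    case True
    then show ?thesis by (intro bexI[OF _ poly_ops.proj[of v]]) auto
  next
    case False
    then show ?thesis by (intro bexI[OF _ poly_ops.const[OF a0]]) auto
  qed
next
  case (const a)
  then show ?case by (intro bexI[OF _ poly_ops.const[of a]]) auto
next
  case (comp ts f)
  then obtain S where S: "\<And>t. t \<in> set ts \<Longrightarrow> S t \<in> poly_ops A ar F k"
    "\<And>t xs. t \<in> set ts \<Longrightarrow> S t xs = t (\<lambda>v. if v < k then xs ! v else a0)"
    by metis
  have "(\<lambda>ys. F f (map (\<lambda>t. t ys) (map S ts))) \<in> poly_ops A ar F k"
    using comp(1) S by (intro poly_ops.comp) auto
  then show ?case
    by (rule bexI[rotated]) (auto simp: S(2) comp_def cong: map_cong)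
qed

lemma term_ops_pol_funs: "t \<in> term_ops ar F k \<Longrightarrow> (\<lambda>\<rho>. t (map \<rho> [0..<k])) \<in> pol_funs A ar F"
proof (induction rule: term_ops.induct)
  case (proj i)
  then show ?case using pol_funs.var[of i A ar F] by simp
next
  case (comp ts f)
  have "(\<lambda>\<rho>. F f (map (\<lambda>t. t \<rho>) (map (\<lambda>t \<rho>. t (map \<rho> [0..<k])) ts))) \<in> pol_funs A ar F"
    using comp by (intro pol_funs.comp) auto
  then show ?case by (simp add: comp_def)
qed

lemma congD:
  assumes "is_congruence A ar F \<theta>"
  shows "\<theta> \<subseteq> A \<times> A" "x \<in> A \<Longrightarrow> (x, x) \<in> \<theta>" "(x, y) \<in> \<theta> \<Longrightarrow> (y, x) \<in> \<theta>"
    "(x, y) \<in> \<theta> \<Longrightarrow> (y, z) \<in> \<theta> \<Longrightarrow> (x, z) \<in> \<theta>"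
proof -
  have "equiv A \<theta>" using assms unfolding is_congruence_def by (rule conjunct1)
  then show "\<theta> \<subseteq> A \<times> A" "x \<in> A \<Longrightarrow> (x, x) \<in> \<theta>" "(x, y) \<in> \<theta> \<Longrightarrow> (y, x) \<in> \<theta>"
    "(x, y) \<in> \<theta> \<Longrightarrow> (y, z) \<in> \<theta> \<Longrightarrow> (x, z) \<in> \<theta>"
    unfolding equiv_def by (blast dest: refl_onD symD transD)+
qed

lemma cong_pol_funs:
  assumes "is_congruence A ar F \<theta>" and "\<And>v. (\<rho> v, \<rho>' v) \<in> \<theta>"
  shows "p \<in> pol_funs A ar F \<Longrightarrow> (p \<rho>, p \<rho>') \<in> \<theta>"
proof (induction rule: pol_funs.induct)
  case (comp ts f)
  then have *: "(t \<rho>, t \<rho>') \<in> \<theta>" if "t \<in> set ts" for t using that by blast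
  then have "set (map (\<lambda>t. t \<rho>) ts) \<subseteq> A" "set (map (\<lambda>t. t \<rho>') ts) \<subseteq> A"
    using congD(1)[OF assms(1)] by auto
  moreover have "list_all2 (\<lambda>x y. (x, y) \<in> \<theta>) (map (\<lambda>t. t \<rho>) ts) (map (\<lambda>t. t \<rho>') ts)"
    using * by (simp add: list_all2_conv_all_nth)
  ultimately show ?case using assms(1) comp(1) unfolding is_congruence_def by simp
qed (auto simp: assms(2) congD(2)[OF assms(1)])

locale fin_algebra =
  fixes A :: "'a set" and ar :: "'f \<Rightarrow> nat" and F :: "'f \<Rightarrow> 'a list \<Rightarrow> 'a"
  assumes alg: "is_algebra A ar F" and finite_A: "finite A"
begin

sublocale clone A "pol_clone A ar F"
  by (rule pol_clone_clone[OF alg finite_A])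

lemma cong_pol_clone:
  assumes "is_congruence A ar F \<theta>" "f \<in> pol_clone A ar F" and "\<And>v. (\<rho> v, \<rho>' v) \<in> \<theta>"
  shows "(f \<rho>, f \<rho>') \<in> \<theta>"
proof -
  have "range \<rho> \<subseteq> A" "range \<rho>' \<subseteq> A" using assms(3) congD(1)[OF assms(1)] by auto
  then show ?thesis using assms(2) cong_pol_funs[OF assms(1,3)] unfolding pol_clone_def by auto
qed

lemma cong_pol1: "is_congruence A ar F \<theta> \<Longrightarrow> g \<in> pol1 \<Longrightarrow> (x, y) \<in> \<theta> \<Longrightarrow> (g x, g y) \<in> \<theta>"
  using cong_pol_clone[of \<theta> "\<lambda>\<rho>. g (\<rho> 0)" "\<lambda>_. x" "\<lambda>_. y"] unfolding pol1_def by blast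

lemma cong_pol2:
  assumes "is_congruence A ar F \<theta>" "G \<in> pol2" "(x, x') \<in> \<theta>" "(y, y') \<in> \<theta>"
  shows "(G x y, G x' y') \<in> \<theta>"
proof -
  have "(\<lambda>\<rho>. G (\<rho> 0) (\<rho> 1)) \<in> pol_clone A ar F" using assms(2) unfolding pol2_def by blast
  moreover have "(if v = (0::nat) then x else y, if v = 0 then x' else y') \<in> \<theta>" for v
    using assms by simp
  ultimately have "(G (if (0::nat) = 0 then x else y) (if (1::nat) = 0 then x else y),
      G (if (0::nat) = 0 then x' else y') (if (1::nat) = 0 then x' else y')) \<in> \<theta>"
    by (rule cong_pol_clone[OF assms(1)])
  then show ?thesis by simp
qed

lemma op_translation:
  assumes "length xs = ar f" "set xs \<subseteq> A" "i < ar f"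
  shows "(\<lambda>x. F f (xs[i := x])) \<in> pol1"
proof -
  define ts where "ts = (map (\<lambda>a (\<rho>::nat \<Rightarrow> 'a). a) xs)[i := \<lambda>\<rho>. \<rho> 0]"
  have "(\<lambda>\<rho>. F f (map (\<lambda>t. t \<rho>) ts)) \<in> pol_funs A ar F"
    using assms set_update_subset_insert[of "map (\<lambda>a (\<rho>::nat \<Rightarrow> 'a). a) xs" i "\<lambda>\<rho>. \<rho> 0"]
    unfolding ts_def by (intro pol_funs.comp) (auto intro: pol_funs.intros)
  moreover have "map (\<lambda>t. t \<rho>) ts = xs[i := \<rho> 0]" for \<rho>
    unfolding ts_def by (simp add: map_update comp_def)
  ultimately show ?thesis by (intro pol1I pol_cloneI) simp
qed

text \<open>The arguments are exchanged one at a time, through the hybrid lists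
  \<open>take i ys @ drop i xs\<close>; each exchange is an instance of a unary polynomial.\<close>

lemma congruenceI:
  assumes eq: "equiv A \<psi>" and tr: "\<And>g x y. g \<in> pol1 \<Longrightarrow> (x, y) \<in> \<psi> \<Longrightarrow> (g x, g y) \<in> \<psi>"
  shows "is_congruence A ar F \<psi>"
  unfolding is_congruence_def
proof (intro conjI eq allI impI, elim conjE)
  fix f xs ys
  assume xs: "length xs = ar f" "length ys = ar f" "set xs \<subseteq> A" "set ys \<subseteq> A"
    and rel: "list_all2 (\<lambda>x y. (x, y) \<in> \<psi>) xs ys"
  have "(F f xs, F f (take i ys @ drop i xs)) \<in> \<psi>" if "i \<le> ar f" for i
    using that
  proof (induction i)
    case 0
    have "F f xs \<in> A" using alg xs unfolding is_algebra_def by blast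
    then show ?case using eq by (simp add: equiv_def refl_on_def)
  next
    case (Suc i)
    define zs where "zs = take i ys @ drop i xs"
    have zs: "length zs = ar f" "set zs \<subseteq> A" "i < ar f"
      unfolding zs_def using Suc.prems xs by (auto dest: in_set_takeD in_set_dropD)
    have "zs[i := xs ! i] = zs" "zs[i := ys ! i] = take (Suc i) ys @ drop (Suc i) xs"
      unfolding zs_def using Suc.prems xs
      by (auto intro!: nth_equalityI simp: nth_append nth_list_update)
    moreover have "(xs ! i, ys ! i) \<in> \<psi>" using rel Suc.prems xs by (simp add: list_all2_conv_all_nth)
    ultimately have "(F f zs, F f (take (Suc i) ys @ drop (Suc i) xs)) \<in> \<psi>"
      using tr[OF op_translation[OF zs], of "xs ! i" "ys ! i"] by simp
    then show ?case using Suc eq unfolding zs_def equiv_def by (meson Suc_leD transD)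
  qed
  from this[of "ar f"] show "(F f xs, F f ys) \<in> \<psi>" using xs by simp
qed

text \<open>The chains inside A form a congruence above \<theta> that contains (x, y), so by
  maximality it is the full relation.\<close>

lemma maximal_generated:
  assumes max: "maximal_congruence A ar F \<theta>" and xy: "x \<in> A" "y \<in> A" "(x, y) \<notin> \<theta>"
    and ab: "a \<in> A" "b \<in> A"
  shows "(a, b) \<in> (\<theta> \<union> trans_step x y)\<^sup>*"
proof -
  have \<theta>: "is_congruence A ar F \<theta>" using max unfolding maximal_congruence_def by blast
  define S where "S = \<theta> \<union> trans_step x y"
  define \<psi> where "\<psi> = S\<^sup>* \<inter> A \<times> A"
  have "sym S" unfolding S_def using congD(3)[OF \<theta>] by (auto simp: sym_def trans_step_def)
  then have symS: "sym (S\<^sup>*)" by (rule sym_rtrancl)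
  have S_tr: "(g u, g v) \<in> S" if g: "g \<in> pol1" and uv: "(u, v) \<in> S" for g u v
  proof (cases "(u, v) \<in> \<theta>")
    case True
    then show ?thesis using cong_pol1[OF \<theta> g] unfolding S_def by blast
  next
    case False
    then obtain h where h: "h \<in> pol1" "(u, v) = (h x, h y) \<or> (u, v) = (h y, h x)"
      using uv unfolding S_def trans_step_def by blast
    show ?thesis using trans_stepI[OF pol1_comp[OF g h(1)]] h(2) unfolding S_def by auto
  qed
  have "equiv A \<psi>"
  proof (rule equivI)
    show "\<psi> \<subseteq> A \<times> A" "refl_on A \<psi>" unfolding \<psi>_def refl_on_def by auto
    show "sym \<psi>" using symD[OF symS] unfolding \<psi>_def by (auto intro: symI)
    show "trans \<psi>" unfolding \<psi>_def by (intro trans_Int trans_rtrancl) (simp add: trans_def)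
  qed
  moreover have "(g u, g v) \<in> \<psi>" if g: "g \<in> pol1" and uv: "(u, v) \<in> \<psi>" for g u v
  proof -
    have "(g u, g v) \<in> S\<^sup>*" if "(u, v) \<in> S\<^sup>*" for u v
      using that by (induction rule: rtrancl_induct) (auto intro: rtrancl_into_rtrancl S_tr[OF g])
    then show ?thesis using uv pol1_rng[OF g] unfolding \<psi>_def by auto
  qed
  ultimately have "is_congruence A ar F \<psi>" by (rule congruenceI)
  moreover have "\<theta> \<subseteq> \<psi>" unfolding \<psi>_def S_def using congD(1)[OF \<theta>] by auto
  moreover have "(x, y) \<in> \<psi>"
    unfolding \<psi>_def S_def using trans_stepI(1)[OF pol1_id] xy by auto
  ultimately have "\<psi> = A \<times> A"
    using max xy unfolding maximal_congruence_def by blast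
  then show ?thesis using ab unfolding \<psi>_def S_def by blast
qed

text \<open>G is a term with parameters. These join c and d in the \<beta>-block of the term
  condition, where they stay fixed; this is where reflexivity of \<beta> enters.\<close>

lemma commutator_pol2:
  assumes G: "G \<in> pol2" and ab: "(a, b) \<in> \<alpha>" "(c, d) \<in> \<beta>" and sub: "\<alpha> \<subseteq> A \<times> A" "\<beta> \<subseteq> A \<times> A"
    and refl: "\<And>x. x \<in> A \<Longrightarrow> (x, x) \<in> \<beta>" and eq: "G a c = G a d"
  shows "(G b c, G b d) \<in> commutator A ar F \<alpha> \<beta>"
proof -
  have B: "a \<in> A" "b \<in> A" "c \<in> A" "d \<in> A" using ab sub by auto
  obtain as where as: "set as = A" using finite_A finite_list by blast
  obtain p where p: "p \<in> pol_funs A ar F" "\<And>\<rho>. range \<rho> \<subseteq> A \<Longrightarrow> G (\<rho> 0) (\<rho> 1) = p \<rho>"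
    using G pol_cloneE[of "\<lambda>\<rho>. G (\<rho> 0) (\<rho> 1)" A ar F] unfolding pol2_def by blast
  obtain t where t: "t \<in> term_ops ar F (2 + length as)"
    "\<And>xs. length xs = 2 \<Longrightarrow> p (\<lambda>v. if v < 2 then xs ! v else a) = t (xs @ as)"
    using pol_funs_term[OF B(1) as p(1), of 2] by metis
  have tG: "t ([x] @ y # as) = G x y" if "x \<in> A" "y \<in> A" for x y
  proof -
    have "t ([x, y] @ as) = p (\<lambda>v. if v < 2 then [x, y] ! v else a)" using t(2)[of "[x, y]"] by simp
    also have "\<dots> = G x y"
      using p(2)[of "\<lambda>v. if v < 2 then [x, y] ! v else a"] that B
      by (auto simp: less_2_cases_iff image_subset_iff)
    finally show ?thesis by simp
  qed
  have "(G b c, G b d) \<in> \<delta>" if \<delta>: "is_congruence A ar F \<delta>" "term_condition A ar F \<alpha> \<beta> \<delta>" for \<delta>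
  proof -
    have "t \<in> term_ops ar F (1 + (1 + length as))" using t(1) by (simp add: numeral_2_eq_2)
    moreover have "[a] \<in> pow_carrier A 1" "[b] \<in> pow_carrier A 1"
      "c # as \<in> pow_carrier A (1 + length as)" "d # as \<in> pow_carrier A (1 + length as)"
      unfolding pow_carrier_def using B as by auto
    moreover have "list_all2 (\<lambda>x y. (x, y) \<in> \<alpha>) [a] [b]" "list_all2 (\<lambda>x y. (x, y) \<in> \<beta>) (c # as) (d # as)"
      using ab refl as by (auto simp: list_all2_same)
    moreover have "(t ([a] @ c # as), t ([a] @ d # as)) \<in> \<delta>"
      using tG B eq congD(2)[OF \<delta>(1)] pol2_rng[OF G] by simp
    ultimately have "(t ([b] @ c # as), t ([b] @ d # as)) \<in> \<delta>"
      using \<delta>(2) unfolding term_condition_def by blast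
    then show ?thesis using tG B by simp
  qed
  then show ?thesis unfolding commutator_def by blast
qed

lemma congruence_commutator: "is_congruence A ar F (commutator A ar F \<alpha> \<beta>)"
proof -
  define \<Delta> where "\<Delta> = {\<delta>. is_congruence A ar F \<delta> \<and> term_condition A ar F \<alpha> \<beta> \<delta>}"
  have top: "is_congruence A ar F (A \<times> A)"
    by (rule congruenceI) (auto simp: equiv_def refl_on_def sym_def trans_def pol1_rng)
  have "t xs \<in> A" if "t \<in> term_ops ar F k" "xs \<in> pow_carrier A k" for t k xs
    using that
  proof (induction rule: term_ops.induct)
    case (comp ts f)
    then have "set (map (\<lambda>t. t xs) ts) \<subseteq> A" by auto
    then show ?case using alg comp(1) unfolding is_algebra_def by simp
  qed (auto simp: pow_carrier_def)
  then have "term_condition A ar F \<alpha> \<beta> (A \<times> A)"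
    unfolding term_condition_def by (auto simp: pow_carrier_def)
  with top have ne: "A \<times> A \<in> \<Delta>" unfolding \<Delta>_def by blast
  have c: "is_congruence A ar F \<delta>" if "\<delta> \<in> \<Delta>" for \<delta> using that unfolding \<Delta>_def by blast
  have "is_congruence A ar F (\<Inter>\<Delta>)"
  proof (rule congruenceI)
    show "equiv A (\<Inter>\<Delta>)"
    proof (intro equivI)
      show "\<Inter>\<Delta> \<subseteq> A \<times> A" using ne by blast
      show "refl_on A (\<Inter>\<Delta>)" unfolding refl_on_def using congD(2)[OF c] by auto
      show "sym (\<Inter>\<Delta>)" using congD(3)[OF c] by (auto intro: symI)
      show "trans (\<Inter>\<Delta>)" using congD(4)[OF c] by (blast intro: transI)
    qed
    show "(g x, g y) \<in> \<Inter>\<Delta>" if "g \<in> pol1" "(x, y) \<in> \<Inter>\<Delta>" for g x y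
      using that cong_pol1[OF c] by blast
  qed
  then show ?thesis unfolding commutator_def \<Delta>_def .
qed

lemma congruence_derived: "is_congruence A ar F (derived A ar F k)"
proof (cases k)
  case 0
  have "is_congruence A ar F (A \<times> A)"
    by (rule congruenceI) (auto simp: equiv_def refl_on_def sym_def trans_def pol1_rng)
  then show ?thesis using 0 by simp
next
  case (Suc l)
  then show ?thesis using congruence_commutator by simp
qed

text \<open>Iterating in the second argument makes the equality \<open>p z (p z y) = p z y\<close> exact, so
  that the term condition applies although the semilattice table holds only modulo a congruence.\<close>

lemma solvable_no_semilattice:
  assumes sol: "solvable A ar F" and \<theta>: "is_congruence A ar F \<theta>" and G: "G \<in> pol2"
    and A: "z \<in> A" "i \<in> A" and tab: "(G i i, i) \<in> \<theta>" "(G i z, z) \<in> \<theta>" "(G z i, z) \<in> \<theta>" "(G z z, z) \<in> \<theta>"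
  shows "(z, i) \<in> \<theta>"
proof -
  define n where "n = (fact (card A) :: nat)"
  obtain l where n: "n = Suc l" unfolding n_def by (metis fact_nonzero not0_implies_Suc)
  define p where "p = (\<lambda>x y. (G x ^^ n) y)"
  have p: "p \<in> pol2" unfolding p_def using pol2_iter2[OF G] by simp
  have idem: "p x (p x y) = p x y" if "x \<in> A" "y \<in> A" for x y
    unfolding p_def n_def using that pol2_rng[OF G] by (intro funpow_fact_idem[OF finite_A]) auto
  note tr = congD(4)[OF \<theta>] and refl = congD(2)[OF \<theta>] and sym = congD(3)[OF \<theta>]
  have it: "((G x ^^ m) y, (G x ^^ m) y') \<in> \<theta>" if "x \<in> A" "(y, y') \<in> \<theta>" for x y y' m
    using that by (induction m) (auto intro: cong_pol2[OF \<theta> G] refl)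
  have stable: "((G x ^^ m) y, y) \<in> \<theta>" if "x \<in> A" "(G x y, y) \<in> \<theta>" for x y m
    using that
  proof (induction m)
    case 0
    then show ?case using congD(1)[OF \<theta>] refl by auto
  next
    case (Suc m)
    then show ?case using tr[OF cong_pol2[OF \<theta> G refl Suc.IH]] by simp
  qed
  have ptab: "(p i i, i) \<in> \<theta>" "(p i z, z) \<in> \<theta>"
    unfolding p_def using stable[OF A(2) tab(1)] stable[OF A(2) tab(2)] by blast+
  have "((G z ^^ l) (G z i), z) \<in> \<theta>"
    using tr[OF it[OF A(1) tab(3)] stable[OF A(1) tab(4)]] .
  then have ptab3: "(p z i, z) \<in> \<theta>"
    unfolding p_def n by (simp add: funpow_Suc_right del: funpow.simps)
  \<comment> \<open>The pair (z, i) is pushed down the derived series inside its \<theta>-classes.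
    At the bottom the two representatives coincide.\<close>
  have "\<exists>z' i'. (z', z) \<in> \<theta> \<and> (i', i) \<in> \<theta> \<and> (z', i') \<in> derived A ar F k" for k
  proof (induction k)
    case 0
    then show ?case using A refl by auto
  next
    case (Suc k)
    define D where "D = derived A ar F k"
    have D: "is_congruence A ar F D" unfolding D_def by (rule congruence_derived)
    obtain z' i' where z': "(z', z) \<in> \<theta>" "(i', i) \<in> \<theta>" "(z', i') \<in> D" using Suc unfolding D_def by blast
    have A': "z' \<in> A" "i' \<in> A" using z' congD(1)[OF \<theta>] by auto
    define y1 where "y1 = p i' i'"
    define y0 where "y0 = p z' y1"
    have yA: "y1 \<in> A" "y0 \<in> A" unfolding y0_def y1_def using A' pol2_rng[OF p] by auto
    have y1: "(y1, i) \<in> \<theta>"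
      unfolding y1_def using tr[OF cong_pol2[OF \<theta> p z'(2,2)] ptab(1)] .
    have y0: "(y0, z) \<in> \<theta>"
      unfolding y0_def using tr[OF cong_pol2[OF \<theta> p z'(1) y1] ptab3] .
    have y1': "p i' y1 = y1" unfolding y1_def using idem A' by simp
    have "(p z' y1, p i' y1) \<in> D"
      using cong_pol2[OF D p z'(3) congD(2)[OF D yA(1)]] .
    then have "(y0, y1) \<in> D" unfolding y0_def[symmetric] y1' .
    \<comment> \<open>Exchanging z' for i' on both sides leads to the pair (p i' y0, y1), one step
      lower in the derived series and still in the classes of z and i.\<close>
    moreover have "p z' y0 = p z' y1" unfolding y0_def using idem A' yA by simp
    ultimately have "(p i' y0, p i' y1) \<in> commutator A ar F D D"
      using commutator_pol2[OF p z'(3) _ congD(1)[OF D] congD(1)[OF D] congD(2)[OF D]] by blast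
    then have "(p i' y0, y1) \<in> derived A ar F (Suc k)" unfolding y1' D_def by simp
    moreover have "(p i' y0, z) \<in> \<theta>"
      using tr[OF cong_pol2[OF \<theta> p z'(2) y0] ptab(2)] .
    ultimately show ?case using y1 by blast
  qed
  moreover obtain k where "derived A ar F k = Id_on A" using sol unfolding solvable_def by blast
  ultimately obtain z' where "(z', z) \<in> \<theta>" "(z', i) \<in> \<theta>" by (metis Id_onE Pair_inject)
  then show ?thesis using tr sym by blast
qed

end

section \<open>Separated maps from simple quotients\<close>

context fin_algebra
begin

text \<open>The quotient modulo \<open>\<theta>\<close> is realized on a system of representatives.\<close>

lemma ex_separated_map:
  assumes sol: "solvable A ar F" and ss: "semisimple A ar F" and ab: "a \<in> A" "b \<in> A" "a \<noteq> b"
  shows "\<exists>\<G> h. separated_map \<G> h \<and> h a \<noteq> h b"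
proof -
  obtain \<theta> where max: "maximal_congruence A ar F \<theta>" and ab\<theta>: "(a, b) \<notin> \<theta>"
  proof -
    have "(a, b) \<notin> Id_on A" using ab(3) by (simp add: Id_on_iff)
    then have "(a, b) \<notin> (A \<times> A) \<inter> \<Inter> {\<theta>. maximal_congruence A ar F \<theta>}"
      using ss by (simp only: semisimple_def simp_thms)
    then have "(a, b) \<notin> \<Inter> {\<theta>. maximal_congruence A ar F \<theta>}" using ab(1,2) by simp
    then obtain \<theta> where "maximal_congruence A ar F \<theta>" "(a, b) \<notin> \<theta>"
      unfolding Inter_iff ball_simps mem_Collect_eq not_all not_imp by (elim exE conjE)
    then show ?thesis by (rule that)
  qed
  have \<theta>: "is_congruence A ar F \<theta>" using max unfolding maximal_congruence_def by blast
  note tr = congD(4)[OF \<theta>] and refl = congD(2)[OF \<theta>] and sym = congD(3)[OF \<theta>]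
  define r where "r = (\<lambda>x. SOME y. (x, y) \<in> \<theta>)"
  have r: "(x, r x) \<in> \<theta>" if "x \<in> A" for x
    unfolding r_def using refl[OF that] by (rule someI)
  have r_A: "r x \<in> A" if "x \<in> A" for x using r[OF that] congD(1)[OF \<theta>] by blast
  have r_eq: "r x = r y" if "(x, y) \<in> \<theta>" for x y
  proof -
    have "(x, z) \<in> \<theta> \<longleftrightarrow> (y, z) \<in> \<theta>" for z using that tr sym by blast
    then show ?thesis unfolding r_def by simp
  qed
  have r_eqD: "(x, y) \<in> \<theta>" if "x \<in> A" "y \<in> A" "r x = r y" for x y
    using r[OF that(1)] r[OF that(2)] that(3) tr sym by metis
  define B where "B = r ` A"
  define C where "C = {f. \<exists>p\<in>pol_clone A ar F. \<forall>\<rho>. range \<rho> \<subseteq> B \<longrightarrow> f \<rho> = r (p \<rho>)}"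
  have CI: "f \<in> C" if "p \<in> pol_clone A ar F" "\<And>\<rho>. range \<rho> \<subseteq> B \<Longrightarrow> f \<rho> = r (p \<rho>)" for f p
    unfolding C_def mem_Collect_eq using that by (intro bexI[of _ p] allI impI)
  have CE: "\<exists>p. p \<in> pol_clone A ar F \<and> (\<forall>\<rho>. range \<rho> \<subseteq> B \<longrightarrow> f \<rho> = r (p \<rho>))" if "f \<in> C" for f
    using that unfolding C_def mem_Collect_eq by metis
  have BA: "B \<subseteq> A" unfolding B_def using r_A by blast
  have r_B: "r x = x" if "x \<in> B" for x
    using that r_eq[OF sym[OF r]] unfolding B_def by auto
  have r_env: "\<rho> v = r (\<rho> v)" if "range \<rho> \<subseteq> B" for \<rho> :: "nat \<Rightarrow> 'a" and v
  proof -
    have "\<rho> v \<in> B" using that by blast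
    then show ?thesis using r_B by simp
  qed
  have "clone B C"
  proof
    show "finite B" unfolding B_def using finite_A by simp
    show "(\<lambda>\<rho>. \<rho> v) \<in> C" for v
      by (rule CI[OF var[of v]]) (rule r_env)
    show "(\<lambda>\<rho>. c) \<in> C" if "c \<in> B" for c
      using r_B[OF that] that BA by (intro CI[OF const[of c]]) auto
    show "g \<in> C" if f: "f \<in> C" and fg: "\<And>\<rho>. range \<rho> \<subseteq> B \<Longrightarrow> f \<rho> = g \<rho>" for f g
    proof -
      obtain p where "p \<in> pol_clone A ar F" "\<forall>\<rho>. range \<rho> \<subseteq> B \<longrightarrow> f \<rho> = r (p \<rho>)" using CE[OF f] by blast
      then show ?thesis using fg by (intro CI[of p]) auto
    qed
    show "f \<rho> \<in> B" if f: "f \<in> C" and \<rho>: "range \<rho> \<subseteq> B" for f \<rho>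
    proof -
      obtain p where "p \<in> pol_clone A ar F" "f \<rho> = r (p \<rho>)" using CE[OF f] \<rho> by blast
      then show ?thesis using rng[of p \<rho>] \<rho> BA unfolding B_def by auto
    qed
    show "(\<lambda>\<rho>. f (\<lambda>v. \<sigma> v \<rho>)) \<in> C" if f: "f \<in> C" and \<sigma>: "\<And>v. \<sigma> v \<in> C" for f \<sigma>
    proof -
      obtain p where p: "p \<in> pol_clone A ar F" "\<And>\<rho>. range \<rho> \<subseteq> B \<Longrightarrow> f \<rho> = r (p \<rho>)"
        using CE[OF f] by metis
      obtain q where q: "\<And>v. q v \<in> pol_clone A ar F"
        "\<And>v \<rho>. range \<rho> \<subseteq> B \<Longrightarrow> \<sigma> v \<rho> = r (q v \<rho>)"
        using CE[OF \<sigma>] by metis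
      show ?thesis
      proof (rule CI[OF sub[OF p(1) q(1)]])
        fix \<rho> :: "nat \<Rightarrow> 'a" assume \<rho>: "range \<rho> \<subseteq> B"
        have qA: "q v \<rho> \<in> A" for v using rng[OF q(1)] \<rho> BA by auto
        have "range (\<lambda>v. \<sigma> v \<rho>) \<subseteq> B" using q(2)[OF \<rho>] qA unfolding B_def by auto
        then have "f (\<lambda>v. \<sigma> v \<rho>) = r (p (\<lambda>v. \<sigma> v \<rho>))" by (rule p(2))
        also have "\<dots> = r (p (\<lambda>v. q v \<rho>))"
          using r_eq[OF cong_pol_clone[OF \<theta> p(1)]] q(2)[OF \<rho>] sym[OF r[OF qA]] by simp
        finally show "f (\<lambda>v. \<sigma> v \<rho>) = r (p (\<lambda>v. q v \<rho>))" .
      qed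
    qed
  qed
  then interpret Q: clone B C .
  have pol1_Q: "(\<lambda>x. r (g x)) \<in> Q.pol1" if "g \<in> pol1" for g
    using that unfolding pol1_def by (intro Q.pol1I CI[of "\<lambda>\<rho>. g (\<rho> 0)"]) auto
  have pol2_Q: "(\<lambda>x y. r (G x y)) \<in> Q.pol2" if "G \<in> pol2" for G
    using that unfolding pol2_def by (intro Q.pol2I CI[of "\<lambda>\<rho>. G (\<rho> 0) (\<rho> 1)"]) auto
  have "simple_clone B C"
  proof (intro simple_clone.intro simple_clone_axioms.intro Q.clone_axioms)
    fix x y u v assume xy: "x \<in> B" "y \<in> B" "x \<noteq> y" and uv: "u \<in> B" "v \<in> B"
    have "(x, y) \<notin> \<theta>" using xy r_eq r_B by metis
    then have "(u, v) \<in> (\<theta> \<union> trans_step x y)\<^sup>*"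
      using maximal_generated[OF max] xy uv BA by blast
    then have "(r u, r v) \<in> (Q.trans_step x y)\<^sup>*"
    proof (induction rule: rtrancl_induct)
      case (step v w)
      show ?case
      proof (cases "(v, w) \<in> \<theta>")
        case True
        then show ?thesis using step r_eq by metis
      next
        case False
        then obtain g where "g \<in> pol1" "(v, w) = (g x, g y) \<or> (v, w) = (g y, g x)"
          using step.hyps unfolding trans_step_def by blast
        then have "(r v, r w) \<in> Q.trans_step x y"
          using Q.trans_stepI[OF pol1_Q, of g] by auto
        then show ?thesis using step.IH by (rule rtrancl_into_rtrancl[rotated])
      qed
    qed simp
    then show "(u, v) \<in> (Q.trans_step x y)\<^sup>*" using uv r_B by simp
  next
    show "\<exists>a\<in>B. \<exists>b\<in>B. a \<noteq> b"
      using ab r_eqD[OF ab(1,2)] ab\<theta> unfolding B_def by blast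
    fix z i
    show "\<not> Q.semilattice_pair z i"
    proof
      assume "Q.semilattice_pair z i"
      then obtain G where zi: "z \<in> B" "i \<in> B" "z \<noteq> i" and G: "G \<in> Q.pol2"
        "G i i = i" "G i z = z" "G z i = z" "G z z = z"
        unfolding Q.semilattice_pair_def by blast
      have "(\<lambda>\<rho>. G (\<rho> 0) (\<rho> 1)) \<in> C" using G(1) unfolding Q.pol2_def by (rule CollectD)
      from CE[OF this]
      obtain p where p: "p \<in> pol_clone A ar F" "\<And>\<rho>. range \<rho> \<subseteq> B \<Longrightarrow> G (\<rho> 0) (\<rho> 1) = r (p \<rho>)"
        by (elim exE conjE) simp
      define H where "H = (\<lambda>x y. p (\<lambda>v. if v = 0 then x else y))"
      define \<sigma> where "\<sigma> = (\<lambda>(v::nat) (\<rho>::nat \<Rightarrow> 'a). if v = 0 then \<rho> 0 else \<rho> 1)"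
      have "\<sigma> v \<in> pol_clone A ar F" for v
        unfolding \<sigma>_def using var[of 0] var[of 1] by (cases "v = 0") simp_all
      then have "(\<lambda>\<rho>. p (\<lambda>v. \<sigma> v \<rho>)) \<in> pol_clone A ar F" by (rule sub[OF p(1)])
      then have H: "H \<in> pol2" unfolding H_def \<sigma>_def by (rule pol2I)
      have GH: "(H x y, G x y) \<in> \<theta>" if "x \<in> B" "y \<in> B" for x y
      proof -
        have "G x y = r (H x y)"
          using p(2)[of "\<lambda>v. if v = 0 then x else y"] that unfolding H_def by auto
        moreover have "H x y \<in> A" using pol2_rng[OF H] that BA by blast
        ultimately show ?thesis using r by simp
      qed
      have "(z, i) \<in> \<theta>"
        using solvable_no_semilattice[OF sol \<theta> H, of z i] GH G zi BA by (metis subsetD)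
      then show False using r_eq r_B zi by metis
    qed
  qed
  then interpret Q: simple_clone B C .
  have "r a \<noteq> r b" using ab r_eqD ab\<theta> by blast
  then obtain \<G> h where h: "Q.separated_map \<G> h" "h (r a) \<noteq> h (r b)"
    using Q.ex_separated_map ab unfolding B_def by blast
  note sep = h(1)[unfolded Q.separated_map_def]
  have rB: "r x \<in> B" if "x \<in> A" for x using that unfolding B_def by blast
  have "separated_map \<G> (\<lambda>x. h (r x))"
    unfolding separated_map_def
  proof (intro conjI ballI)
    show "comm_group \<G>" "carrier \<G> \<subseteq> A" "(\<lambda>x. h (r x)) ` A \<subseteq> carrier \<G>"
      using sep BA rB by auto
    fix G x y x' y' assume G: "G \<in> pol2" and A: "x \<in> A" "y \<in> A" "x' \<in> A" "y' \<in> A"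
    have rr: "r (G x y) = r (G (r x) (r y))" if "x \<in> A" "y \<in> A" for x y
      using r_eq[OF cong_pol2[OF \<theta> G r r]] that by blast
    show "h (r (G x y)) \<otimes>\<^bsub>\<G>\<^esub> h (r (G x' y')) = h (r (G x y')) \<otimes>\<^bsub>\<G>\<^esub> h (r (G x' y))"
      unfolding rr[OF A(1,2)] rr[OF A(3,4)] rr[OF A(1,4)] rr[OF A(3,2)]
      by (rule sep[THEN conjunct2, THEN conjunct2, THEN conjunct2, rule_format,
            OF pol2_Q[OF G] rB[OF A(1)] rB[OF A(2)] rB[OF A(3)] rB[OF A(4)]])
  qed
  then show ?thesis using h(2) by blast
qed

end

section \<open>Quasi-affine algebras\<close>

definition add_subgroup :: "'g::comm_ring_1 set \<Rightarrow> bool" where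
  "add_subgroup V \<longleftrightarrow> 0 \<in> V \<and> (\<forall>x\<in>V. \<forall>y\<in>V. x - y \<in> V)"

lemma add_subgroupD:
  assumes "add_subgroup V"
  shows "0 \<in> V" "x \<in> V \<Longrightarrow> y \<in> V \<Longrightarrow> x - y \<in> V" "x \<in> V \<Longrightarrow> - x \<in> V"
    "x \<in> V \<Longrightarrow> y \<in> V \<Longrightarrow> x + y \<in> V"
proof -
  show 0: "0 \<in> V" and diff: "x \<in> V \<Longrightarrow> y \<in> V \<Longrightarrow> x - y \<in> V" for x y
    using assms unfolding add_subgroup_def by auto
  show neg: "x \<in> V \<Longrightarrow> - x \<in> V" for x using diff[OF 0, of x] by simp
  show "x \<in> V \<Longrightarrow> y \<in> V \<Longrightarrow> x + y \<in> V" using diff[OF _ neg, of x y] by simp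
qed

lemma add_subgroup_sum:
  assumes "add_subgroup V" "\<And>i. i \<in> I \<Longrightarrow> f i \<in> V"
  shows "sum f I \<in> V"
  using assms(2)
  by (induction I rule: infinite_finite_induct) (auto intro: add_subgroupD(1,4)[OF assms(1)])

lemma add_subgroup_int:
  assumes "add_subgroup V" "v \<in> V"
  shows "of_int n * v \<in> V"
proof (induction n rule: int_induct[where k = 0])
  case base
  then show ?case using add_subgroupD[OF assms(1)] by simp
next
  case (step1 i)
  then show ?case using add_subgroupD(4)[OF assms(1) _ assms(2)] by (simp add: distrib_right)
next
  case (step2 i)
  then show ?case using add_subgroupD(2)[OF assms(1) _ assms(2)] by (simp add: left_diff_distrib)
qed

lemma sum_option_count:
  fixes w :: "'k \<Rightarrow> 'g::comm_ring_1"
  assumes "finite J" "finite K" "\<And>j. j \<in> J \<Longrightarrow> s j \<in> insert None (Some ` K)"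
  shows "(\<Sum>j\<in>J. case s j of None \<Rightarrow> 0 | Some k \<Rightarrow> w k) = (\<Sum>k\<in>K. of_nat (card {j \<in> J. s j = Some k}) * w k)"
proof -
  have "(\<Sum>j\<in>J. case s j of None \<Rightarrow> 0 | Some k \<Rightarrow> w k) = (\<Sum>j\<in>J. \<Sum>k\<in>K. if s j = Some k then w k else 0)"
  proof (rule sum.cong[OF refl])
    fix j assume "j \<in> J"
    from assms(3)[OF this] show "(case s j of None \<Rightarrow> 0 | Some k \<Rightarrow> w k) = (\<Sum>k\<in>K. if s j = Some k then w k else 0)"
      using assms(2) by auto
  qed
  also have "\<dots> = (\<Sum>k\<in>K. \<Sum>j\<in>J. if s j = Some k then w k else 0)" by (rule sum.swap)
  also have "\<dots> = (\<Sum>k\<in>K. of_nat (card {j \<in> J. s j = Some k}) * w k)"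
    using assms(1) by (intro sum.cong refl) (simp add: sum.If_cases Int_def)
  finally show ?thesis .
qed

text \<open>Disjoint sets of prescribed sizes are given as a labelling, with \<open>None\<close> for
  elements left over. It will distribute the variables of one type among the polynomials to be
  substituted.\<close>

lemma ex_assignment:
  fixes n :: "'i \<Rightarrow> nat"
  assumes "finite I" "finite J" "sum n I \<le> card J"
  shows "\<exists>s. (\<forall>j. s j \<in> insert None (Some ` I)) \<and> (\<forall>i\<in>I. card {j \<in> J. s j = Some i} = n i)"
  using assms
proof (induction I arbitrary: J rule: finite_induct)
  case empty
  show ?case by (intro exI[of _ "\<lambda>_. None"]) simp
next
  case (insert i I)
  have "n i \<le> card J" using insert by simp
  then obtain J1 where J1: "J1 \<subseteq> J" "card J1 = n i" by (metis obtain_subset_with_card_n)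
  have "sum n I \<le> card (J - J1)"
    using insert J1 by (subst card_Diff_subset) (auto intro: finite_subset)
  then obtain s where s: "\<And>j. s j \<in> insert None (Some ` I)"
    "\<And>k. k \<in> I \<Longrightarrow> card {j \<in> J - J1. s j = Some k} = n k"
    using insert.IH[of "J - J1"] insert.prems by auto
  define s' where "s' = (\<lambda>j. if j \<in> J1 then Some i else s j)"
  have si: "s j \<noteq> Some i" for j using s(1)[of j] insert.hyps by auto
  have "{j \<in> J. s' j = Some i} = J1" unfolding s'_def using J1 si by auto
  moreover have "{j \<in> J. s' j = Some k} = {j \<in> J - J1. s j = Some k}" if "k \<in> I" for k
    unfolding s'_def using J1 that insert.hyps by auto
  moreover have "s' j \<in> insert None (Some ` insert i I)" for j
    unfolding s'_def using s(1)[of j] by auto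
  ultimately show ?case using s(2) J1 by (intro exI[of _ s']) auto
qed

text \<open>The abelian group is 'g modulo N, handled by congruence modulo N instead of a quotient
  type; the ring structure supplies integer multiples. \<open>N_E\<close> says that the exponent of
  the quotient divides E, and \<open>sep\<close> that mixed second differences of binary polynomials
  vanish.\<close>

locale quasi_affine = clone A C for A :: "'a set" and C +
  fixes \<phi> :: "'a \<Rightarrow> 'g::comm_ring_1" and N :: "'g set" and E :: nat
  assumes A_ne: "A \<noteq> {}"
    and N: "add_subgroup N"
    and \<phi>_inj: "x \<in> A \<Longrightarrow> y \<in> A \<Longrightarrow> \<phi> x - \<phi> y \<in> N \<Longrightarrow> x = y"
    and E_pos: "E > 0"
    and N_E: "of_nat E * v \<in> N"
    and sep: "G \<in> pol2 \<Longrightarrow> x \<in> A \<Longrightarrow> y \<in> A \<Longrightarrow> x' \<in> A \<Longrightarrow> y' \<in> A \<Longrightarrow>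
      \<phi> (G x y) + \<phi> (G x' y') - \<phi> (G x y') - \<phi> (G x' y) \<in> N"
begin

lemmas N_simps = add_subgroupD[OF N]

lemma N_lin1: "u \<in> N \<Longrightarrow> v = u \<Longrightarrow> v \<in> N"
  by simp

lemma N_lin2: "u \<in> N \<Longrightarrow> u' \<in> N \<Longrightarrow> v = u + u' \<Longrightarrow> v \<in> N"
  using N_simps by simp

lemma N_lin2': "u \<in> N \<Longrightarrow> u' \<in> N \<Longrightarrow> v = u - u' \<Longrightarrow> v \<in> N"
  using N_simps by simp

definition a0 where "a0 = (SOME a. a \<in> A)"

lemma a0_in: "a0 \<in> A"
  unfolding a0_def using A_ne by (metis some_in_eq)

text \<open>Resetting all variables from m on to \<open>a0\<close> leaves finitely many active ones,
  so that sums over variables are finite and can be built up by induction on m.\<close>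

definition trunc :: "nat \<Rightarrow> (nat \<Rightarrow> 'a) \<Rightarrow> nat \<Rightarrow> 'a" where
  "trunc m \<rho> v = (if v < m then \<rho> v else a0)"

definition single :: "nat \<Rightarrow> 'a \<Rightarrow> nat \<Rightarrow> 'a" where
  "single j x = (\<lambda>_. a0)(j := x)"

lemma trunc_rng: "range \<rho> \<subseteq> A \<Longrightarrow> range (trunc m \<rho>) \<subseteq> A"
  unfolding trunc_def using a0_in by auto

lemma single_rng: "x \<in> A \<Longrightarrow> range (single j x) \<subseteq> A"
  unfolding single_def using a0_in by auto

lemma trunc_0: "trunc 0 \<rho> = (\<lambda>_. a0)"
  unfolding trunc_def by simp

lemma trunc_Suc: "trunc (Suc m) \<rho> = (trunc m \<rho>)(m := \<rho> m)"
  unfolding trunc_def by auto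

lemma trunc_fresh: "(trunc m \<rho>)(m := a0) = trunc m \<rho>"
  unfolding trunc_def by auto

lemma two_slots:
  assumes f: "f \<in> C" and \<rho>: "range \<rho> \<subseteq> A"
  shows "(\<lambda>x y. f (\<rho>(i := x, j := y))) \<in> pol2"
proof -
  define \<sigma> where "\<sigma> = (\<lambda>v (\<eta>::nat \<Rightarrow> 'a). if v = j then \<eta> 1 else if v = i then \<eta> 0 else \<rho> v)"
  have "\<sigma> v \<in> C" for v
  proof -
    have "\<rho> v \<in> A" using \<rho> by blast
    then show ?thesis unfolding \<sigma>_def
      using var[of 0] var[of 1] const[of "\<rho> v"] by (cases "v = i"; cases "v = j") simp_all
  qed
  then have "(\<lambda>\<eta>. f (\<lambda>v. \<sigma> v \<eta>)) \<in> C" by (rule sub[OF f])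
  moreover have "(\<lambda>v. \<sigma> v \<eta>) = \<rho>(i := \<eta> 0, j := \<eta> 1)" for \<eta>
    unfolding \<sigma>_def by auto
  ultimately show ?thesis by (intro pol2I) simp
qed

lemma one_slot:
  assumes f: "f \<in> C" and \<rho>: "range \<rho> \<subseteq> A"
  shows "(\<lambda>x. f (\<rho>(i := x))) \<in> pol1"
proof -
  from pol2_sec2[OF two_slots[OF f \<rho>, of "Suc i" i], of "\<rho> (Suc i)"] show ?thesis using \<rho> by auto
qed

text \<open>Switching on variable k changes the contribution of variable m by a mixed second
  difference in the slots k and m, which lies in N by \<open>sep\<close>.\<close>

lemma slot_independent:
  assumes f: "f \<in> C" and \<rho>: "range \<rho> \<subseteq> A" and x: "x \<in> A" and k: "k \<le> m"
  shows "(\<phi> (f ((trunc k \<rho>)(m := x))) - \<phi> (f (trunc k \<rho>))) - (\<phi> (f (single m x)) - \<phi> (f (\<lambda>_. a0))) \<in> N"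
  using k
proof (induction k)
  case 0
  then show ?case using N_simps by (simp add: trunc_0 single_def)
next
  case (Suc k)
  define G where "G = (\<lambda>u v. f ((trunc k \<rho>)(k := u, m := v)))"
  have G: "G \<in> pol2" unfolding G_def using two_slots[OF f trunc_rng[OF \<rho>]] .
  have km: "k \<noteq> m" using Suc.prems by simp
  have "trunc k \<rho> m = a0" "trunc (Suc k) \<rho> m = a0" using Suc.prems unfolding trunc_def by auto
  then have "G (\<rho> k) x = f ((trunc (Suc k) \<rho>)(m := x))" "G a0 x = f ((trunc k \<rho>)(m := x))"
    "G (\<rho> k) a0 = f (trunc (Suc k) \<rho>)" "G a0 a0 = f (trunc k \<rho>)"
    unfolding G_def trunc_Suc trunc_fresh by (simp_all add: fun_upd_idem km)
  moreover have "\<rho> k \<in> A" using \<rho> by blast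
  ultimately have "\<phi> (f ((trunc (Suc k) \<rho>)(m := x))) + \<phi> (f (trunc k \<rho>)) - \<phi> (f (trunc (Suc k) \<rho>)) - \<phi> (f ((trunc k \<rho>)(m := x))) \<in> N"
    using sep[OF G _ x a0_in a0_in, of "\<rho> k"] by simp
  moreover have "\<phi> (f ((trunc k \<rho>)(m := x))) - \<phi> (f (trunc k \<rho>)) - (\<phi> (f (single m x)) - \<phi> (f (\<lambda>_. a0))) \<in> N"
    using Suc.IH[OF Suc_leD[OF Suc.prems]] .
  ultimately show ?case
    by (rule N_lin2) (simp add: algebra_simps del: fun_upd_apply)
qed

text \<open>Variables are switched on one after the other; by \<open>slot_independent\<close> each
  adds its isolated contribution.\<close>

lemma decomposition:
  assumes f: "f \<in> C" and \<rho>: "range \<rho> \<subseteq> A"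
  shows "\<phi> (f (trunc m \<rho>)) - \<phi> (f (\<lambda>_. a0)) - (\<Sum>j<m. \<phi> (f (single j (\<rho> j))) - \<phi> (f (\<lambda>_. a0))) \<in> N"
proof (induction m)
  case 0
  then show ?case using N_simps by (simp add: trunc_0)
next
  case (Suc m)
  have "\<rho> m \<in> A" using \<rho> by blast
  from slot_independent[OF f \<rho> this order_refl[of m]] Suc show ?case
    by (rule N_lin2) (simp add: trunc_Suc algebra_simps del: fun_upd_apply)
qed

text \<open>This is the term condition for many variables split into two blocks: in the
  decomposition the summands cancel variable by variable.\<close>

lemma sep_blocks:
  assumes f: "f \<in> C" and rng: "range \<rho>1 \<subseteq> A" "range \<rho>2 \<subseteq> A" "range \<rho>3 \<subseteq> A" "range \<rho>4 \<subseteq> A"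
    and blocks: "\<And>j. j < m \<Longrightarrow> (\<rho>1 j = \<rho>2 j \<and> \<rho>3 j = \<rho>4 j) \<or> (\<rho>1 j = \<rho>3 j \<and> \<rho>2 j = \<rho>4 j)"
  shows "\<phi> (f (trunc m \<rho>1)) - \<phi> (f (trunc m \<rho>2)) - (\<phi> (f (trunc m \<rho>3)) - \<phi> (f (trunc m \<rho>4))) \<in> N"
proof -
  define S where "S = (\<lambda>\<rho>. \<Sum>j<m. \<phi> (f (single j (\<rho> j))) - \<phi> (f (\<lambda>_. a0)))"
  have "S \<rho>1 - S \<rho>2 - (S \<rho>3 - S \<rho>4) = (\<Sum>j<m. 0)"
    unfolding S_def sum_subtractf[symmetric]
  proof (rule sum.cong[OF refl])
    fix j assume "j \<in> {..<m}"
    then show "\<phi> (f (single j (\<rho>1 j))) - \<phi> (f (\<lambda>_. a0)) - (\<phi> (f (single j (\<rho>2 j))) - \<phi> (f (\<lambda>_. a0))) -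
         (\<phi> (f (single j (\<rho>3 j))) - \<phi> (f (\<lambda>_. a0)) - (\<phi> (f (single j (\<rho>4 j))) - \<phi> (f (\<lambda>_. a0)))) = 0"
      using blocks[of j] by auto
  qed
  then have S: "S \<rho>1 = S \<rho>2 + S \<rho>3 - S \<rho>4" by (simp add: algebra_simps)
  have "\<phi> (f (trunc m \<rho>)) - \<phi> (f (\<lambda>_. a0)) - S \<rho> \<in> N" if "range \<rho> \<subseteq> A" for \<rho>
    unfolding S_def using decomposition[OF f that] .
  note d = this[OF rng(1)] this[OF rng(2)] this[OF rng(3)] this[OF rng(4)]
  from N_simps(2)[OF d(1,2)] N_simps(2)[OF d(3,4)] show ?thesis
    by (rule N_lin2') (simp add: S algebra_simps)
qed

text \<open>The summand contributed by variable j depends on j only through this function. For f in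
  C, restriction to A leaves at most \<open>card A ^ card A\<close> possibilities.\<close>

definition var_type :: "((nat \<Rightarrow> 'a) \<Rightarrow> 'a) \<Rightarrow> nat \<Rightarrow> 'a \<Rightarrow> 'a" where
  "var_type f j = restrict (\<lambda>x. f (single j x)) A"

lemma var_type_simp: "x \<in> A \<Longrightarrow> var_type f j x = f (single j x)"
  unfolding var_type_def by simp

lemma var_type_a0: "var_type f j a0 = f (\<lambda>_. a0)"
  unfolding var_type_def single_def using a0_in by (simp add: fun_upd_idem)

lemma var_type_pol1: "f \<in> C \<Longrightarrow> var_type f j \<in> pol1"
  using pol1_ext[OF one_slot[of f "\<lambda>_. a0" j]] a0_in unfolding var_type_def single_def by simp

text \<open>The subgroup generated by N and the differences \<phi> (p x) - \<phi> c. The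
  coefficients are explicit because they will become numbers of variables.\<close>

definition span :: "('a \<Rightarrow> 'a) set \<Rightarrow> 'a \<Rightarrow> 'g set" where
  "span P c = {v. \<exists>n. v - (\<Sum>p\<in>P. \<Sum>x\<in>A. of_int (n p x) * (\<phi> (p x) - \<phi> c)) \<in> N}"

lemma span_add_subgroup: "add_subgroup (span P c)"
  unfolding add_subgroup_def
proof (intro conjI ballI)
  show "0 \<in> span P c"
    unfolding span_def mem_Collect_eq by (rule exI[of _ "\<lambda>p x. 0"]) (simp add: N_simps)
  fix v w assume "v \<in> span P c" "w \<in> span P c"
  then obtain n n' where "v - (\<Sum>p\<in>P. \<Sum>x\<in>A. of_int (n p x) * (\<phi> (p x) - \<phi> c)) \<in> N"
    "w - (\<Sum>p\<in>P. \<Sum>x\<in>A. of_int (n' p x) * (\<phi> (p x) - \<phi> c)) \<in> N"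
    unfolding span_def by blast
  then have "v - w - (\<Sum>p\<in>P. \<Sum>x\<in>A. of_int (n p x - n' p x) * (\<phi> (p x) - \<phi> c)) \<in> N"
    by (rule N_lin2') (simp add: left_diff_distrib sum_subtractf)
  then show "v - w \<in> span P c"
    unfolding span_def mem_Collect_eq by (rule exI[of _ "\<lambda>p x. n p x - n' p x"])
qed

lemma span_gen:
  assumes P: "finite P" "p \<in> P" "x \<in> A"
  shows "\<phi> (p x) - \<phi> c \<in> span P c"
proof -
  have "(\<Sum>q\<in>P. \<Sum>y\<in>A. of_int (if q = p \<and> y = x then 1 else 0) * (\<phi> (q y) - \<phi> c)) =
      (\<Sum>q\<in>P. if q = p then (\<Sum>y\<in>A. if y = x then \<phi> (q y) - \<phi> c else 0) else 0)"
    by (auto intro!: sum.cong)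
  also have "\<dots> = \<phi> (p x) - \<phi> c" using P fin by (simp add: sum.delta)
  finally show ?thesis
    unfolding span_def mem_Collect_eq
    by (intro exI[of _ "\<lambda>q y. if q = p \<and> y = x then 1 else 0"]) (simp add: N_simps)
qed

lemma span_N: "v \<in> N \<Longrightarrow> v \<in> span P c"
  unfolding span_def mem_Collect_eq by (rule exI[of _ "\<lambda>p x. 0"]) simp

text \<open>Putting \<open>r i\<close> into a variable of type p contributes \<phi> (p (r i \<rho>))
  - \<phi> (f (\<lambda>_. a0)) modulo N, and a variable left at \<open>a0\<close> contributes 0. So
  a coefficient is realized as the number of variables of type p that receive
  \<open>r i\<close>.\<close>

lemma realize_combination:
  fixes n :: "('a \<Rightarrow> 'a) \<Rightarrow> 'i \<Rightarrow> int"
  assumes f: "f \<in> C" and P: "finite P" "\<And>p. p \<in> P \<Longrightarrow> T \<le> card {j. j < m \<and> var_type f j = p}"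
    and I: "finite I" "\<And>i. i \<in> I \<Longrightarrow> r i \<in> C" "E * card I \<le> T"
  shows "\<exists>g\<in>C. \<forall>\<rho>. range \<rho> \<subseteq> A \<longrightarrow> \<phi> (g \<rho>) - \<phi> (f (\<lambda>_. a0)) -
    (\<Sum>p\<in>P. \<Sum>i\<in>I. of_int (n p i) * (\<phi> (p (r i \<rho>)) - \<phi> (f (\<lambda>_. a0)))) \<in> N"
proof -
  define c where "c = f (\<lambda>_. a0)"
  \<comment> \<open>Coefficients matter only modulo E, and the residue is an admissible count even
    for negative ones. Each type must therefore supply at most E * card I variables.\<close>
  define k where "k = (\<lambda>p i. nat (n p i mod int E))"
  have kE: "k p i \<le> E" for p i
    unfolding k_def using less_imp_le[OF pos_mod_bound[of "int E" "n p i"]] E_pos by (simp add: nat_le_iff)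
  have "\<exists>s. (\<forall>j. s j \<in> insert None (Some ` I)) \<and>
      (\<forall>i\<in>I. card {j \<in> {j. j < m \<and> var_type f j = p}. s j = Some i} = k p i)" if p: "p \<in> P" for p
  proof (rule ex_assignment[OF I(1)])
    have "sum (k p) I \<le> card I * E" using sum_bounded_above[of I "k p" E] kE by simp
    also have "\<dots> \<le> T" using I(3) by (simp add: mult.commute)
    also have "\<dots> \<le> card {j. j < m \<and> var_type f j = p}" using P(2)[OF p] .
    finally show "sum (k p) I \<le> card {j. j < m \<and> var_type f j = p}" .
  qed simp
  then have "\<exists>s. \<forall>p\<in>P. (\<forall>j. s p j \<in> insert None (Some ` I)) \<and>
      (\<forall>i\<in>I. card {j \<in> {j. j < m \<and> var_type f j = p}. s p j = Some i} = k p i)"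
    by (intro bchoice ballI)
  then obtain s where s0: "\<forall>p\<in>P. (\<forall>j. s p j \<in> insert None (Some ` I)) \<and>
      (\<forall>i\<in>I. card {j \<in> {j. j < m \<and> var_type f j = p}. s p j = Some i} = k p i)"
    by (elim exE)
  have s: "s p j \<in> insert None (Some ` I)"
    "i \<in> I \<Longrightarrow> card {j \<in> {j. j < m \<and> var_type f j = p}. s p j = Some i} = k p i" if "p \<in> P" for p j i
    using s0 that by blast+
  define t where "t = (\<lambda>j. if j < m \<and> var_type f j \<in> P then
      map_option (\<lambda>i. (var_type f j, i)) (s (var_type f j) j) else None)"
  have t_in: "t j \<in> insert None (Some ` (P \<times> I))" for j
    unfolding t_def using s(1)[of "var_type f j" j] by auto
  have t_card: "card {j \<in> {..<m}. t j = Some (p, i)} = k p i" if "p \<in> P" "i \<in> I" for p i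
  proof -
    have "{j \<in> {..<m}. t j = Some (p, i)} = {j \<in> {j. j < m \<and> var_type f j = p}. s p j = Some i}"
      unfolding t_def using that by auto
    then show ?thesis using s(2)[OF that] by simp
  qed
  define \<sigma> where "\<sigma> = (\<lambda>j. case t j of None \<Rightarrow> (\<lambda>_. a0) | Some (p, i) \<Rightarrow> r i)"
  have \<sigma>C: "\<sigma> j \<in> C" for j
    unfolding \<sigma>_def using t_in[of j] const[OF a0_in] I(2) by auto
  define g where "g = (\<lambda>\<rho>. f (\<lambda>j. \<sigma> j \<rho>))"
  have gC: "g \<in> C" unfolding g_def by (rule sub[OF f \<sigma>C])
  have "\<phi> (g \<rho>) - \<phi> c - (\<Sum>p\<in>P. \<Sum>i\<in>I. of_int (n p i) * (\<phi> (p (r i \<rho>)) - \<phi> c)) \<in> N"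
    if \<rho>: "range \<rho> \<subseteq> A" for \<rho>
  proof -
    define w where "w = (\<lambda>(p, i). \<phi> (p (r i \<rho>)) - \<phi> c)"
    have rng: "\<sigma> j \<rho> \<in> A" for j using rng[OF \<sigma>C \<rho>] .
    have tr: "trunc m (\<lambda>j. \<sigma> j \<rho>) = (\<lambda>j. \<sigma> j \<rho>)"
      unfolding trunc_def \<sigma>_def t_def by auto
    have "\<phi> (f (single j (\<sigma> j \<rho>))) - \<phi> c = (case t j of None \<Rightarrow> 0 | Some q \<Rightarrow> w q)" for j
    proof (cases "t j")
      case None
      then have "\<sigma> j \<rho> = a0" unfolding \<sigma>_def by simp
      then show ?thesis using None var_type_a0[of f j] var_type_simp[OF a0_in, of f j] unfolding c_def by simp
    next
      case (Some q)
      then obtain i where i: "q = (var_type f j, i)" unfolding t_def by (auto split: if_splits)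
      then have "\<sigma> j \<rho> = r i \<rho>" unfolding \<sigma>_def using Some by simp
      then show ?thesis using Some i rng[of j] unfolding w_def by (simp add: var_type_simp)
    qed
    then have "(\<Sum>j<m. \<phi> (f (single j (\<sigma> j \<rho>))) - \<phi> c) = (\<Sum>j<m. case t j of None \<Rightarrow> 0 | Some q \<Rightarrow> w q)"
      by simp
    also have "\<dots> = (\<Sum>q\<in>P \<times> I. of_nat (card {j \<in> {..<m}. t j = Some q}) * w q)"
      using P I t_in by (intro sum_option_count) auto
    also have "\<dots> = (\<Sum>q\<in>P \<times> I. of_nat (k (fst q) (snd q)) * w q)"
      using t_card by (intro sum.cong refl) auto
    finally have sum1: "(\<Sum>j<m. \<phi> (f (single j (\<sigma> j \<rho>))) - \<phi> c) = (\<Sum>q\<in>P \<times> I. of_nat (k (fst q) (snd q)) * w q)" .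
    have "\<phi> (g \<rho>) - \<phi> c - (\<Sum>q\<in>P \<times> I. of_nat (k (fst q) (snd q)) * w q) \<in> N"
      using decomposition[OF f, of "\<lambda>j. \<sigma> j \<rho>" m] rng unfolding tr g_def[symmetric] c_def[symmetric] sum1
      by (simp add: g_def image_subset_iff)
    moreover have "(\<Sum>q\<in>P \<times> I. of_nat (k (fst q) (snd q)) * w q) - (\<Sum>q\<in>P \<times> I. of_int (n (fst q) (snd q)) * w q) \<in> N"
      unfolding sum_subtractf[symmetric]
    proof (rule add_subgroup_sum[OF N])
      fix q
      have "int (k (fst q) (snd q)) = n (fst q) (snd q) - int E * (n (fst q) (snd q) div int E)"
        unfolding k_def using E_pos by (simp add: minus_mult_div_eq_mod)
      then have "(of_nat (k (fst q) (snd q)) :: 'g) = of_int (n (fst q) (snd q)) - of_nat E * of_int (n (fst q) (snd q) div int E)"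
        by (metis of_int_diff of_int_mult of_int_of_nat_eq)
      then have "of_nat (k (fst q) (snd q)) * w q - of_int (n (fst q) (snd q)) * w q =
          - (of_nat E * (of_int (n (fst q) (snd q) div int E) * w q))"
        by (simp only: left_diff_distrib) (simp add: mult.assoc)
      then show "of_nat (k (fst q) (snd q)) * w q - of_int (n (fst q) (snd q)) * w q \<in> N"
        using N_simps(3)[OF N_E] by simp
    qed
    ultimately have "\<phi> (g \<rho>) - \<phi> c - (\<Sum>q\<in>P \<times> I. of_int (n (fst q) (snd q)) * w q) \<in> N"
      by (rule N_lin2) simp
    moreover have "(\<Sum>q\<in>P \<times> I. of_int (n (fst q) (snd q)) * w q) =
        (\<Sum>p\<in>P. \<Sum>i\<in>I. of_int (n p i) * (\<phi> (p (r i \<rho>)) - \<phi> c))"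
      unfolding sum.cartesian_product w_def by (intro sum.cong refl) auto
    ultimately show ?thesis by simp
  qed
  then show ?thesis using gC unfolding c_def by blast
qed

end

section \<open>The affine structure obtained from a full span\<close>

context clone
begin

text \<open>A maximal congruence in terms of the clone alone, with maximality in the chain form of
  \<open>maximal_generated\<close>.\<close>

definition maximal_relation :: "'a rel \<Rightarrow> bool" where
  "maximal_relation \<theta> \<longleftrightarrow> equiv B \<theta> \<and> (\<forall>g\<in>pol1. \<forall>x y. (x, y) \<in> \<theta> \<longrightarrow> (g x, g y) \<in> \<theta>) \<and>
     (\<forall>x\<in>B. \<forall>y\<in>B. (x, y) \<notin> \<theta> \<longrightarrow> (\<forall>a\<in>B. \<forall>b\<in>B. (a, b) \<in> (\<theta> \<union> trans_step x y)\<^sup>*))"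

lemma maximal_relationD:
  assumes "maximal_relation \<theta>"
  shows "equiv B \<theta>" "g \<in> pol1 \<Longrightarrow> (x, y) \<in> \<theta> \<Longrightarrow> (g x, g y) \<in> \<theta>"
    "x \<in> B \<Longrightarrow> y \<in> B \<Longrightarrow> (x, y) \<notin> \<theta> \<Longrightarrow> a \<in> B \<Longrightarrow> b \<in> B \<Longrightarrow> (a, b) \<in> (\<theta> \<union> trans_step x y)\<^sup>*"
  using assms unfolding maximal_relation_def by simp_all

end

text \<open>The types occurring at least T times supply the additive structure. The bound on T
  allows coefficients up to E on 3 * card A ^ card A substituted polynomials: three arguments, each
  with at most \<open>card A ^ card A\<close> unary polynomial maps.\<close>

locale rich = quasi_affine +
  fixes f :: "(nat \<Rightarrow> 'a) \<Rightarrow> 'a" and m T :: nat and P :: "('a \<Rightarrow> 'a) set"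
  assumes f: "f \<in> C"
    and P_eq: "P = {p \<in> var_type f ` {..<m}. T \<le> card {j. j < m \<and> var_type f j = p}}"
    and T: "3 * E * card A ^ card A \<le> T"
    and full: "x \<in> A \<Longrightarrow> y \<in> A \<Longrightarrow> \<phi> x - \<phi> y \<in> span P (f (\<lambda>_. a0))"
begin

definition c where "c = f (\<lambda>_. a0)"

lemma c_in: "c \<in> A"
  unfolding c_def using rng[OF f] a0_in by auto

lemma P_fin: "finite P"
  unfolding P_eq by simp

lemma P_pol1: "p \<in> P \<Longrightarrow> p \<in> pol1"
  unfolding P_eq using var_type_pol1[OF f] by auto

lemma P_a0: "p \<in> P \<Longrightarrow> p a0 = c"
  unfolding P_eq c_def using var_type_a0 by auto

lemma realize:
  fixes n :: "('a \<Rightarrow> 'a) \<Rightarrow> 'i \<Rightarrow> int"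
  assumes "finite I" "\<And>i. i \<in> I \<Longrightarrow> r i \<in> C" "card I \<le> 3 * card A ^ card A"
  obtains g where "g \<in> C" "\<And>\<rho>. range \<rho> \<subseteq> A \<Longrightarrow> \<phi> (g \<rho>) - \<phi> c -
    (\<Sum>p\<in>P. \<Sum>i\<in>I. of_int (n p i) * (\<phi> (p (r i \<rho>)) - \<phi> c)) \<in> N"
proof -
  have "E * card I \<le> E * (3 * card A ^ card A)" using assms(3) by (rule mult_le_mono2)
  also have "\<dots> \<le> T" using T by (simp add: mult.assoc mult.left_commute)
  finally have I: "E * card I \<le> T" .
  have "\<exists>g\<in>C. \<forall>\<rho>. range \<rho> \<subseteq> A \<longrightarrow> \<phi> (g \<rho>) - \<phi> (f (\<lambda>_. a0)) -
    (\<Sum>p\<in>P. \<Sum>i\<in>I. of_int (n p i) * (\<phi> (p (r i \<rho>)) - \<phi> (f (\<lambda>_. a0)))) \<in> N"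
  proof (rule realize_combination[OF f P_fin _ assms(1) _ I])
    show "T \<le> card {j. j < m \<and> var_type f j = p}" if "p \<in> P" for p
      using that unfolding P_eq by blast
  qed (rule assms(2))
  then obtain g where g: "g \<in> C" "\<forall>\<rho>. range \<rho> \<subseteq> A \<longrightarrow> \<phi> (g \<rho>) - \<phi> c -
    (\<Sum>p\<in>P. \<Sum>i\<in>I. of_int (n p i) * (\<phi> (p (r i \<rho>)) - \<phi> c)) \<in> N"
    unfolding c_def[symmetric] by (elim bexE)
  show ?thesis by (rule that[OF g(1)]) (use g(2) in simp)
qed

lemma card_A_le: "card A \<le> card A ^ card A"
  using A_ne fin by (intro self_le_power) (auto simp: Suc_le_eq card_gt_0_iff)

lemma \<phi>_eq: "x \<in> A \<Longrightarrow> y \<in> A \<Longrightarrow> \<phi> x - v \<in> N \<Longrightarrow> \<phi> y - v \<in> N \<Longrightarrow> x = y"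
  using \<phi>_inj[of x y] N_simps(2)[of "\<phi> x - v" "\<phi> y - v"] by simp

text \<open>Since differences lie in the span, x - y + z - c is a combination of frequent summands
  at constants from A. Substituting these constants into f yields an element of A with the required
  value.\<close>

lemma ex_d:
  assumes "x \<in> A" "y \<in> A" "z \<in> A"
  shows "\<exists>w. w \<in> A \<and> \<phi> w - (\<phi> x - \<phi> y + \<phi> z) \<in> N"
proof -
  have "(\<phi> x - \<phi> y) + (\<phi> z - \<phi> c) \<in> span P c"
    using full[OF assms(1,2)] full[OF assms(3) c_in] add_subgroupD(4)[OF span_add_subgroup]
    unfolding c_def by blast
  then obtain n where n: "(\<phi> x - \<phi> y) + (\<phi> z - \<phi> c) - (\<Sum>p\<in>P. \<Sum>u\<in>A. of_int (n p u) * (\<phi> (p u) - \<phi> c)) \<in> N"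
    unfolding span_def by blast
  obtain g where g: "g \<in> C" "\<And>\<rho>. range \<rho> \<subseteq> A \<Longrightarrow> \<phi> (g \<rho>) - \<phi> c -
    (\<Sum>p\<in>P. \<Sum>u\<in>A. of_int (n p u) * (\<phi> (p u) - \<phi> c)) \<in> N"
    using realize[OF fin, of "\<lambda>u _. u" n] const card_A_le by auto
  have r: "range (\<lambda>_::nat. a0) \<subseteq> A" using a0_in by auto
  from g(2)[OF r] n have "\<phi> (g (\<lambda>_. a0)) - (\<phi> x - \<phi> y + \<phi> z) \<in> N"
    by (rule N_lin2') (simp add: algebra_simps)
  then show ?thesis using rng[OF g(1) r] by blast
qed

text \<open>Chosen pointwise by its \<phi>-value; that it is a polynomial is shown only in
  \<open>d_in_C\<close>.\<close>

definition d where "d x y z = (SOME w. w \<in> A \<and> \<phi> w - (\<phi> x - \<phi> y + \<phi> z) \<in> N)"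

lemma d_props:
  assumes "x \<in> A" "y \<in> A" "z \<in> A"
  shows "d x y z \<in> A \<and> \<phi> (d x y z) - (\<phi> x - \<phi> y + \<phi> z) \<in> N"
  unfolding d_def by (rule someI_ex[OF ex_d[OF assms]])

lemmas d_in = d_props[THEN conjunct1]
lemmas d_\<phi> = d_props[THEN conjunct2]

lemma d_eqI: "x \<in> A \<Longrightarrow> y \<in> A \<Longrightarrow> z \<in> A \<Longrightarrow> w \<in> A \<Longrightarrow> \<phi> w - (\<phi> x - \<phi> y + \<phi> z) \<in> N \<Longrightarrow> d x y z = w"
  using \<phi>_eq[OF d_in _ d_\<phi>] by blast

lemma d_right: "x \<in> A \<Longrightarrow> y \<in> A \<Longrightarrow> d x y y = x"
  by (rule d_eqI) (simp_all add: N_simps)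

lemma d_left: "x \<in> A \<Longrightarrow> y \<in> A \<Longrightarrow> d y y x = x"
  by (rule d_eqI) (simp_all add: N_simps)

lemma d_cancel:
  assumes "x \<in> A" "y \<in> A" "z \<in> A" "d x y z = z"
  shows "x = y"
proof (rule \<phi>_inj[OF assms(1,2)])
  show "\<phi> x - \<phi> y \<in> N"
    using N_simps(3)[OF d_\<phi>[OF assms(1-3)]] unfolding assms(4) by simp
qed

lemma d_comp1:
  assumes "x \<in> A" "y \<in> A" "z \<in> A" "w \<in> A"
  shows "d x y (d y z w) = d x z w"
proof (rule d_eqI)
  show "\<phi> (d x z w) - (\<phi> x - \<phi> y + \<phi> (d y z w)) \<in> N"
    using d_\<phi>[OF assms(1,3,4)] d_\<phi>[OF assms(2,3,4)]
    by (rule N_lin2') simp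
qed (use assms d_in in auto)

lemma d_comp2:
  assumes "x \<in> A" "y \<in> A" "z \<in> A" "w \<in> A"
  shows "d z (d y x z) w = d x y w"
proof (rule d_eqI)
  show "\<phi> (d x y w) - (\<phi> z - \<phi> (d y x z) + \<phi> w) \<in> N"
    using d_\<phi>[OF assms(1,2,4)] d_\<phi>[OF assms(2,1,3)]
    by (rule N_lin2) simp
qed (use assms d_in in auto)

lemma d_comp3:
  assumes "x \<in> A" "y \<in> A" "z \<in> A"
  shows "d (d x y z) (d z y z) z = x"
proof (rule d_eqI)
  show "\<phi> x - (\<phi> (d x y z) - \<phi> (d z y z) + \<phi> z) \<in> N"
    using d_\<phi>[OF assms(3,2,3)] d_\<phi>[OF assms(1,2,3)]
    by (rule N_lin2') simp
qed (use assms d_in in auto)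

text \<open>Elements of the span are realized on two disjoint blocks of variables
  (even and odd), which makes every unary polynomial additive.\<close>

lemma pol1_additive:
  assumes q: "q \<in> pol1" and v: "v1 \<in> span P c" "v2 \<in> span P c"
    and w: "w12 \<in> A" "w1 \<in> A" "w2 \<in> A"
      "\<phi> w12 - (\<phi> c + v1 + v2) \<in> N" "\<phi> w1 - (\<phi> c + v1) \<in> N" "\<phi> w2 - (\<phi> c + v2) \<in> N"
  shows "\<phi> (q w12) - \<phi> (q w1) - (\<phi> (q w2) - \<phi> (q c)) \<in> N"
proof -
  obtain n1 where n1: "v1 - (\<Sum>p\<in>P. \<Sum>u\<in>A. of_int (n1 p u) * (\<phi> (p u) - \<phi> c)) \<in> N"
    using v(1) unfolding span_def by blast
  obtain n2 where n2: "v2 - (\<Sum>p\<in>P. \<Sum>u\<in>A. of_int (n2 p u) * (\<phi> (p u) - \<phi> c)) \<in> N"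
    using v(2) unfolding span_def by blast
  define k where "k = card A"
  obtain h where h: "bij_betw h {..<k} A"
    using ex_bij_betw_nat_finite[OF fin] unfolding k_def atLeast0LessThan by blast
  have hA: "h i \<in> A" if "i < k" for i using h that unfolding bij_betw_def by auto
  define n where "n = (\<lambda>p (i, b). if b then n2 p (h i) else n1 p (h i))"
  have "card ({..<k} \<times> (UNIV :: bool set)) \<le> 3 * card A ^ card A"
    using card_A_le unfolding k_def by (simp add: card_UNIV_bool)
  then obtain g where g: "g \<in> C" "\<And>\<rho>. range \<rho> \<subseteq> A \<Longrightarrow> \<phi> (g \<rho>) - \<phi> c -
    (\<Sum>p\<in>P. \<Sum>i\<in>{..<k} \<times> UNIV. of_int (n p i) * (\<phi> (p (\<rho> (2 * fst i + of_bool (snd i)))) - \<phi> c)) \<in> N"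
    using realize[of "{..<k} \<times> UNIV" "\<lambda>i \<rho>. \<rho> (2 * fst i + of_bool (snd i))" n] var by auto
  \<comment> \<open>b1 and b2 switch the even and the odd block on or off. A variable switched off
    has value \<open>a0\<close>, where every p in P takes the value c and so contributes
    nothing.\<close>
  define \<rho> where "\<rho> = (\<lambda>(b1::bool) (b2::bool) v. if v < 2 * k \<and> (if even v then b1 else b2) then h (v div 2) else a0)"
  have \<rho>_rng: "range (\<rho> b1 b2) \<subseteq> A" for b1 b2
    unfolding \<rho>_def using a0_in hA by auto
  have \<rho>_simp: "\<rho> b1 b2 (2 * i) = (if b1 then h i else a0)" "\<rho> b1 b2 (Suc (2 * i)) = (if b2 then h i else a0)"
    if "i < k" for b1 b2 i
    unfolding \<rho>_def using that by auto
  have tr: "trunc (2 * k) (\<rho> b1 b2) = \<rho> b1 b2" for b1 b2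
    unfolding trunc_def \<rho>_def by auto
  define s1 where "s1 = (\<Sum>p\<in>P. \<Sum>u\<in>A. of_int (n1 p u) * (\<phi> (p u) - \<phi> c))"
  define s2 where "s2 = (\<Sum>p\<in>P. \<Sum>u\<in>A. of_int (n2 p u) * (\<phi> (p u) - \<phi> c))"
  have val: "\<phi> (g (\<rho> b1 b2)) - (\<phi> c + (if b1 then s1 else 0) + (if b2 then s2 else 0)) \<in> N" for b1 b2
  proof -
    have inner: "(\<Sum>i\<in>{..<k} \<times> UNIV. of_int (n p i) * (\<phi> (p (\<rho> b1 b2 (2 * fst i + of_bool (snd i)))) - \<phi> c)) =
        (if b1 then \<Sum>u\<in>A. of_int (n1 p u) * (\<phi> (p u) - \<phi> c) else 0) +
        (if b2 then \<Sum>u\<in>A. of_int (n2 p u) * (\<phi> (p u) - \<phi> c) else 0)" if p: "p \<in> P" for p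
    proof -
      have "(\<Sum>i\<in>{..<k} \<times> UNIV. of_int (n p i) * (\<phi> (p (\<rho> b1 b2 (2 * fst i + of_bool (snd i)))) - \<phi> c)) =
          (\<Sum>i<k. \<Sum>b\<in>UNIV. of_int (n p (i, b)) * (\<phi> (p (\<rho> b1 b2 (2 * i + of_bool b))) - \<phi> c))"
        unfolding sum.cartesian_product by (intro sum.cong refl) auto
      also have "\<dots> = (\<Sum>i<k. (if b1 then of_int (n1 p (h i)) * (\<phi> (p (h i)) - \<phi> c) else 0) +
          (if b2 then of_int (n2 p (h i)) * (\<phi> (p (h i)) - \<phi> c) else 0))"
        by (intro sum.cong refl) (simp add: UNIV_bool n_def \<rho>_simp P_a0[OF p])
      also have "\<dots> = (if b1 then \<Sum>i<k. of_int (n1 p (h i)) * (\<phi> (p (h i)) - \<phi> c) else 0) +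
          (if b2 then \<Sum>i<k. of_int (n2 p (h i)) * (\<phi> (p (h i)) - \<phi> c) else 0)"
        by (simp add: sum.distrib)
      finally show ?thesis
        unfolding sum.reindex_bij_betw[OF h, of "\<lambda>u. of_int (n1 p u) * (\<phi> (p u) - \<phi> c)"]
          sum.reindex_bij_betw[OF h, of "\<lambda>u. of_int (n2 p u) * (\<phi> (p u) - \<phi> c)"] .
    qed
    have "(\<Sum>p\<in>P. \<Sum>i\<in>{..<k} \<times> UNIV. of_int (n p i) * (\<phi> (p (\<rho> b1 b2 (2 * fst i + of_bool (snd i)))) - \<phi> c)) =
        (if b1 then s1 else 0) + (if b2 then s2 else 0)"
      using inner unfolding s1_def s2_def by (simp add: sum.distrib)
    with g(2)[OF \<rho>_rng[of b1 b2]] show ?thesis by (simp add: algebra_simps)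
  qed
  have gA: "g (\<rho> b1 b2) \<in> A" for b1 b2 using rng[OF g(1) \<rho>_rng] .
  have n1': "v1 - s1 \<in> N" and n2': "v2 - s2 \<in> N" unfolding s1_def s2_def by (fact n1, fact n2)
  have e0: "g (\<rho> False False) = c"
    using val[of False False] by (intro \<phi>_inj[OF gA c_in]) simp
  have e1: "g (\<rho> True False) = w1"
  proof (rule \<phi>_eq[OF gA w(2) _ w(5)])
    show "\<phi> (g (\<rho> True False)) - (\<phi> c + v1) \<in> N"
      using val[of True False] n1' by (rule N_lin2') simp
  qed
  have e2: "g (\<rho> False True) = w2"
  proof (rule \<phi>_eq[OF gA w(3) _ w(6)])
    show "\<phi> (g (\<rho> False True)) - (\<phi> c + v2) \<in> N"
      using val[of False True] n2' by (rule N_lin2') simp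
  qed
  have e12: "g (\<rho> True True) = w12"
  proof (rule \<phi>_eq[OF gA w(1) _ w(4)])
    show "\<phi> (g (\<rho> True True)) - (\<phi> c + v1 + v2) \<in> N"
      using val[of True True] N_simps(4)[OF n1' n2'] by (rule N_lin2') simp
  qed
  have qg: "(\<lambda>\<rho>. q (g \<rho>)) \<in> C" using app1[OF q g(1)] .
  have "\<phi> (q (g (trunc (2*k) (\<rho> True True)))) - \<phi> (q (g (trunc (2*k) (\<rho> True False)))) -
     (\<phi> (q (g (trunc (2*k) (\<rho> False True)))) - \<phi> (q (g (trunc (2*k) (\<rho> False False))))) \<in> N"
    by (rule sep_blocks[OF qg \<rho>_rng \<rho>_rng \<rho>_rng \<rho>_rng]) (simp add: \<rho>_def)
  then show ?thesis unfolding tr e0 e1 e2 e12 .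
qed

text \<open>By additivity with v1 = \<phi> x - \<phi> y, passing from u to d x y u changes \<phi> (q
  u) by an amount independent of u; compare u = z with u = y.\<close>

lemma pol1_d:
  assumes q: "q \<in> pol1" and A: "x \<in> A" "y \<in> A" "z \<in> A"
  shows "q (d x y z) = d (q x) (q y) (q z)"
proof -
  have qA: "q u \<in> A" if "u \<in> A" for u using pol1_rng[OF q that] .
  have key: "\<phi> (q (d x y u)) - \<phi> (q (d x y c)) - (\<phi> (q u) - \<phi> (q c)) \<in> N" if u: "u \<in> A" for u
  proof (rule pol1_additive[OF q, of "\<phi> x - \<phi> y" "\<phi> u - \<phi> c"])
    show "\<phi> x - \<phi> y \<in> span P c" "\<phi> u - \<phi> c \<in> span P c"
      using full A u c_in unfolding c_def by auto
    show "d x y u \<in> A" "d x y c \<in> A" "u \<in> A" using d_in A u c_in by auto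
    show "\<phi> (d x y u) - (\<phi> c + (\<phi> x - \<phi> y) + (\<phi> u - \<phi> c)) \<in> N"
      using d_\<phi>[OF A(1,2) u] by (rule N_lin1) simp
    show "\<phi> (d x y c) - (\<phi> c + (\<phi> x - \<phi> y)) \<in> N"
      using d_\<phi>[OF A(1,2) c_in] by (rule N_lin1) simp
    show "\<phi> u - (\<phi> c + (\<phi> u - \<phi> c)) \<in> N" using N_simps by simp
  qed
  from key[OF A(3)] key[OF A(2)]
  have "\<phi> (q (d x y z)) - (\<phi> (q x) - \<phi> (q y) + \<phi> (q z)) \<in> N"
    unfolding d_right[OF A(1,2)] by (rule N_lin2') simp
  then show ?thesis using d_eqI[OF qA qA qA qA] A d_in by metis
qed

text \<open>Modulo N the displacements of W from c form a subgroup that contains the generators of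
  the span, hence all differences. This serves as an induction principle on A.\<close>

lemma d_closed_span:
  assumes W: "W \<subseteq> A" "c \<in> W" "\<And>x y z. x \<in> W \<Longrightarrow> y \<in> W \<Longrightarrow> z \<in> W \<Longrightarrow> d x y z \<in> W"
    and gen: "\<And>p x. p \<in> P \<Longrightarrow> x \<in> A \<Longrightarrow> p x \<in> W"
  shows "W = A"
proof -
  define V where "V = {v. \<exists>w\<in>W. \<phi> w - \<phi> c - v \<in> N}"
  have V: "add_subgroup V"
    unfolding add_subgroup_def
  proof (intro conjI ballI)
    show "0 \<in> V" unfolding V_def using W(2) N_simps(1) by (intro CollectI bexI[of _ c]) simp_all
    fix v v' assume "v \<in> V" "v' \<in> V"
    then obtain w w' where w: "w \<in> W" "\<phi> w - \<phi> c - v \<in> N" and w': "w' \<in> W" "\<phi> w' - \<phi> c - v' \<in> N"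
      unfolding V_def by blast
    have A: "w \<in> A" "w' \<in> A" using w w' W(1) by auto
    have "\<phi> (d w w' c) - \<phi> c - (v - v') \<in> N"
      using d_\<phi>[OF A c_in] N_simps(2)[OF w(2) w'(2)] by (rule N_lin2) simp
    then show "v - v' \<in> V" unfolding V_def using W(3)[OF w(1) w'(1) W(2)] by blast
  qed
  have gen': "\<phi> (p x) - \<phi> c \<in> V" if "p \<in> P" "x \<in> A" for p x
    unfolding V_def using gen[OF that] N_simps by (intro CollectI bexI[of _ "p x"]) auto
  have "z \<in> W" if z: "z \<in> A" for z
  proof -
    have "\<phi> z - \<phi> c \<in> span P c" using full[OF z c_in] unfolding c_def .
    then obtain n where n: "\<phi> z - \<phi> c - (\<Sum>p\<in>P. \<Sum>u\<in>A. of_int (n p u) * (\<phi> (p u) - \<phi> c)) \<in> N"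
      unfolding span_def by blast
    have "(\<Sum>p\<in>P. \<Sum>u\<in>A. of_int (n p u) * (\<phi> (p u) - \<phi> c)) \<in> V"
      by (intro add_subgroup_sum[OF V] add_subgroup_int[OF V] gen')
    then obtain w where w: "w \<in> W" "\<phi> w - \<phi> c - (\<Sum>p\<in>P. \<Sum>u\<in>A. of_int (n p u) * (\<phi> (p u) - \<phi> c)) \<in> N"
      unfolding V_def by blast
    from n w(2) have "\<phi> z - \<phi> w \<in> N" by (rule N_lin2') simp
    then show ?thesis using \<phi>_inj z w W(1) by blast
  qed
  then show ?thesis using W(1) by blast
qed

text \<open>With c in the role of zero and d as j1 - j2 + j3, these are the integer combinations of
  the maps p o r. They become polynomials in \<open>J_pol1\<close>.\<close>

inductive_set J :: "('a \<Rightarrow> 'a) set" where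
  base: "p \<in> P \<Longrightarrow> r \<in> pol1 \<Longrightarrow> (\<lambda>x. p (r x)) \<in> J"
| cst: "(\<lambda>x. c) \<in> J"
| dif: "j1 \<in> J \<Longrightarrow> j2 \<in> J \<Longrightarrow> j3 \<in> J \<Longrightarrow> (\<lambda>x. d (j1 x) (j2 x) (j3 x)) \<in> J"

lemma J_in: "j \<in> J \<Longrightarrow> x \<in> A \<Longrightarrow> j x \<in> A"
  by (induction rule: J.induct) (auto simp: d_in c_in pol1_rng[OF P_pol1] pol1_rng)

lemma J_comp: "j \<in> J \<Longrightarrow> q \<in> pol1 \<Longrightarrow> (\<lambda>x. j (q x)) \<in> J"
proof (induction rule: J.induct)
  case (base p r)
  then show ?case using J.base[OF base(1) pol1_comp[OF base(2,3)]] by simp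
next
  case (dif j1 j2 j3)
  then show ?case using J.dif[of "\<lambda>x. j1 (q x)" "\<lambda>x. j2 (q x)" "\<lambda>x. j3 (q x)"] by simp
qed (rule J.cst)

definition Y where "Y = pol1 \<inter> (A \<rightarrow>\<^sub>E A)"

lemma Y_fin: "finite Y"
  unfolding Y_def using fin by (simp add: finite_PiE)

lemma Y_card: "card Y \<le> card A ^ card A"
proof -
  have "card Y \<le> card (A \<rightarrow>\<^sub>E A)"
    unfolding Y_def using fin by (intro card_mono finite_PiE) auto
  then show ?thesis using fin by (simp add: card_funcsetE)
qed

lemma restrict_Y: "r \<in> pol1 \<Longrightarrow> restrict r A \<in> Y"
  unfolding Y_def using pol1_ext[of r "restrict r A"] pol1_rng by auto

text \<open>Collecting the maps r by their restrictions to A leaves coefficients on P x Y, so the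
  cost of an element of J is bounded independently of its construction.\<close>

lemma J_coefficients:
  "j \<in> J \<Longrightarrow> \<exists>n. \<forall>x\<in>A. \<phi> (j x) - \<phi> c - (\<Sum>p\<in>P. \<Sum>r\<in>Y. of_int (n p r) * (\<phi> (p (r x)) - \<phi> c)) \<in> N"
proof (induction rule: J.induct)
  case (base q s)
  have "(\<Sum>p\<in>P. \<Sum>r\<in>Y. of_int (if p = q \<and> r = restrict s A then 1 else 0) * (\<phi> (p (r x)) - \<phi> c)) =
      \<phi> (q (s x)) - \<phi> c" if "x \<in> A" for x
  proof -
    have "(\<Sum>p\<in>P. \<Sum>r\<in>Y. of_int (if p = q \<and> r = restrict s A then 1 else 0) * (\<phi> (p (r x)) - \<phi> c)) =
        (\<Sum>p\<in>P. if p = q then \<Sum>r\<in>Y. if r = restrict s A then \<phi> (p (r x)) - \<phi> c else 0 else 0)"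
      by (auto intro!: sum.cong)
    also have "\<dots> = \<phi> (q (s x)) - \<phi> c"
      using base P_fin Y_fin restrict_Y that by (simp add: sum.delta)
    finally show ?thesis .
  qed
  then show ?case
    by (intro exI[of _ "\<lambda>p r. if p = q \<and> r = restrict s A then 1 else 0"]) (simp add: N_simps)
next
  case cst
  show ?case by (intro exI[of _ "\<lambda>p r. 0"]) (simp add: N_simps)
next
  case (dif j1 j2 j3)
  define S where "S = (\<lambda>n x. \<Sum>p\<in>P. \<Sum>r\<in>Y. of_int (n p r) * (\<phi> (p (r x)) - \<phi> c))"
  obtain n1 n2 n3 where n: "\<forall>x\<in>A. \<phi> (j1 x) - \<phi> c - S n1 x \<in> N" "\<forall>x\<in>A. \<phi> (j2 x) - \<phi> c - S n2 x \<in> N"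
    "\<forall>x\<in>A. \<phi> (j3 x) - \<phi> c - S n3 x \<in> N"
    using dif.IH unfolding S_def by blast
  have "\<phi> (d (j1 x) (j2 x) (j3 x)) - \<phi> c - S (\<lambda>p r. n1 p r - n2 p r + n3 p r) x \<in> N" if x: "x \<in> A" for x
  proof -
    have 1: "S (\<lambda>p r. n1 p r - n2 p r + n3 p r) x = S n1 x - S n2 x + S n3 x"
      unfolding S_def by (simp add: distrib_right left_diff_distrib sum_subtractf sum.distrib)
    have 2: "(\<phi> (j1 x) - \<phi> c - S n1 x) - (\<phi> (j2 x) - \<phi> c - S n2 x) + (\<phi> (j3 x) - \<phi> c - S n3 x) \<in> N"
      using n x N_simps by blast
    show ?thesis
      by (rule N_lin2[OF d_\<phi>[OF J_in[OF dif(1) x] J_in[OF dif(2) x] J_in[OF dif(3) x]] 2]) (simp add: 1)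
  qed
  then have "\<forall>x\<in>A. \<phi> (d (j1 x) (j2 x) (j3 x)) - \<phi> c - S (\<lambda>p r. n1 p r - n2 p r + n3 p r) x \<in> N" by simp
  then show ?case
    unfolding S_def by (rule exI[of _ "\<lambda>p r. n1 p r - n2 p r + n3 p r"])
qed

text \<open>All three arguments are realized at once over the index set Y x {0, 1, 2}, with negated
  coefficients for the middle one. To obtain d itself it remains to find a member of J that is the
  identity on A.\<close>

lemma J_combination:
  assumes j: "j1 \<in> J" "j2 \<in> J" "j3 \<in> J"
  shows "(\<lambda>\<rho>. d (j1 (\<rho> 0)) (j2 (\<rho> 1)) (j3 (\<rho> 2))) \<in> C"
proof -
  define S where "S = (\<lambda>n x. \<Sum>p\<in>P. \<Sum>r\<in>Y. of_int (n p r) * (\<phi> (p (r x)) - \<phi> c))"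
  obtain n1 n2 n3 where n: "\<And>x. x \<in> A \<Longrightarrow> \<phi> (j1 x) - \<phi> c - S n1 x \<in> N"
    "\<And>x. x \<in> A \<Longrightarrow> \<phi> (j2 x) - \<phi> c - S n2 x \<in> N" "\<And>x. x \<in> A \<Longrightarrow> \<phi> (j3 x) - \<phi> c - S n3 x \<in> N"
    using J_coefficients[OF j(1)] J_coefficients[OF j(2)] J_coefficients[OF j(3)] unfolding S_def by blast
  define n where "n = (\<lambda>p (r, i::nat). if i = 0 then n1 p r else if i = 1 then - n2 p r else n3 p r)"
  have "card (Y \<times> {..<3::nat}) \<le> 3 * card A ^ card A" using Y_card by (simp add: card_cartesian_product)
  moreover have "(\<lambda>\<rho>. fst i (\<rho> (snd i))) \<in> C" if "i \<in> Y \<times> {..<3}" for i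
    using that app1[OF _ var[of "snd i"], of "fst i"] unfolding Y_def by auto
  moreover have "finite (Y \<times> {..<3::nat})" using Y_fin by simp
  ultimately obtain g where g: "g \<in> C" "\<And>\<rho>. range \<rho> \<subseteq> A \<Longrightarrow> \<phi> (g \<rho>) - \<phi> c -
    (\<Sum>p\<in>P. \<Sum>i\<in>Y \<times> {..<3}. of_int (n p i) * (\<phi> (p (fst i (\<rho> (snd i)))) - \<phi> c)) \<in> N"
    using realize[of "Y \<times> {..<3::nat}" "\<lambda>i \<rho>. fst i (\<rho> (snd i))" n] by blast
  show ?thesis
  proof (rule ext[OF g(1)])
    fix \<rho> :: "nat \<Rightarrow> 'a" assume \<rho>: "range \<rho> \<subseteq> A"
    then have \<rho>A: "\<rho> i \<in> A" for i by auto
    have "(\<Sum>i\<in>Y \<times> {..<3}. of_int (n p i) * (\<phi> (p (fst i (\<rho> (snd i)))) - \<phi> c)) =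
        (\<Sum>r\<in>Y. of_int (n1 p r) * (\<phi> (p (r (\<rho> 0))) - \<phi> c)) - (\<Sum>r\<in>Y. of_int (n2 p r) * (\<phi> (p (r (\<rho> 1))) - \<phi> c))
        + (\<Sum>r\<in>Y. of_int (n3 p r) * (\<phi> (p (r (\<rho> 2))) - \<phi> c))" for p
    proof -
      have "(\<Sum>i\<in>Y \<times> {..<3}. of_int (n p i) * (\<phi> (p (fst i (\<rho> (snd i)))) - \<phi> c)) =
          (\<Sum>r\<in>Y. \<Sum>i<3. of_int (n p (r, i)) * (\<phi> (p (r (\<rho> i))) - \<phi> c))"
        unfolding sum.cartesian_product by (intro sum.cong refl) auto
      also have "\<dots> = (\<Sum>r\<in>Y. of_int (n1 p r) * (\<phi> (p (r (\<rho> 0))) - \<phi> c) -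
          of_int (n2 p r) * (\<phi> (p (r (\<rho> 1))) - \<phi> c) + of_int (n3 p r) * (\<phi> (p (r (\<rho> 2))) - \<phi> c))"
        by (intro sum.cong refl) (simp add: n_def numeral_3_eq_3 numeral_2_eq_2)
      finally show ?thesis by (simp add: sum_subtractf sum.distrib)
    qed
    then have "(\<Sum>p\<in>P. \<Sum>i\<in>Y \<times> {..<3}. of_int (n p i) * (\<phi> (p (fst i (\<rho> (snd i)))) - \<phi> c)) =
        S n1 (\<rho> 0) - S n2 (\<rho> 1) + S n3 (\<rho> 2)"
      unfolding S_def by (simp add: sum_subtractf sum.distrib)
    with g(2)[OF \<rho>] have 1: "\<phi> (g \<rho>) - \<phi> c - (S n1 (\<rho> 0) - S n2 (\<rho> 1) + S n3 (\<rho> 2)) \<in> N" by simp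
    have 2: "(\<phi> (j1 (\<rho> 0)) - \<phi> c - S n1 (\<rho> 0)) - (\<phi> (j2 (\<rho> 1)) - \<phi> c - S n2 (\<rho> 1)) + (\<phi> (j3 (\<rho> 2)) - \<phi> c - S n3 (\<rho> 2)) \<in> N"
      using n \<rho>A N_simps by blast
    from 1 2 have "\<phi> (g \<rho>) - (\<phi> (j1 (\<rho> 0)) - \<phi> (j2 (\<rho> 1)) + \<phi> (j3 (\<rho> 2))) \<in> N"
      by (rule N_lin2') simp
    then show "g \<rho> = d (j1 (\<rho> 0)) (j2 (\<rho> 1)) (j3 (\<rho> 2))"
      using d_eqI[OF J_in[OF j(1) \<rho>A] J_in[OF j(2) \<rho>A] J_in[OF j(3) \<rho>A] rng[OF g(1) \<rho>]] by simp
  qed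
qed

lemma J_pol1:
  assumes j: "j \<in> J"
  shows "j \<in> pol1"
proof -
  have "(\<lambda>\<rho>. d (j (\<rho> 0)) c c) \<in> C" using J_combination[OF j J.cst J.cst] .
  then have "(\<lambda>x. d (j x) c c) \<in> pol1" by (rule pol1I)
  then show ?thesis by (rule pol1_ext) (use d_right J_in[OF j] c_in in blast)
qed

text \<open>The constants obtained in this way are closed under d and include every value p x,
  because the inner map r may be constant.\<close>

lemma J_const:
  assumes "z \<in> A"
  shows "\<exists>j\<in>J. \<forall>x\<in>A. j x = z"
proof -
  define W where "W = {z \<in> A. \<exists>j\<in>J. \<forall>x\<in>A. j x = z}"
  have "W = A"
  proof (rule d_closed_span)
    show "W \<subseteq> A" unfolding W_def by blast
    show "c \<in> W" unfolding W_def using c_in by (intro CollectI conjI bexI[OF _ J.cst]) simp_all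
    show "d x y z \<in> W" if xyz: "x \<in> W" "y \<in> W" "z \<in> W" for x y z
    proof -
      have *: "\<exists>j. j \<in> J \<and> (\<forall>u\<in>A. j u = w)" if "w \<in> W" for w
        using that unfolding W_def mem_Collect_eq Bex_def by (rule conjunct2)
      obtain j1 where j1: "j1 \<in> J" "\<forall>u\<in>A. j1 u = x" using *[OF xyz(1)] by (elim exE conjE)
      obtain j2 where j2: "j2 \<in> J" "\<forall>u\<in>A. j2 u = y" using *[OF xyz(2)] by (elim exE conjE)
      obtain j3 where j3: "j3 \<in> J" "\<forall>u\<in>A. j3 u = z" using *[OF xyz(3)] by (elim exE conjE)
      note j = j1(1) j2(1) j3(1) j1(2) j2(2) j3(2)
      have "\<forall>u\<in>A. d (j1 u) (j2 u) (j3 u) = d x y z" using j by simp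
      then have "\<exists>j\<in>J. \<forall>u\<in>A. j u = d x y z" by (rule bexI[OF _ J.dif[OF j(1-3)]])
      moreover have "d x y z \<in> A" using xyz d_in unfolding W_def by blast
      ultimately show ?thesis unfolding W_def by (intro CollectI conjI)
    qed
    show "p x \<in> W" if p: "p \<in> P" and x: "x \<in> A" for p x
    proof -
      have "(\<lambda>u. p x) \<in> J" using J.base[OF p pol1_const[OF x]] .
      then have "\<exists>j\<in>J. \<forall>u\<in>A. j u = p x" by (rule bexI[rotated]) simp
      with pol1_rng[OF P_pol1[OF p] x] show ?thesis unfolding W_def by (intro CollectI conjI)
    qed
  qed
  then show ?thesis using assms unfolding W_def by blast
qed

lemma J_funpow: "j \<in> J \<Longrightarrow> (j ^^ Suc n) \<in> J"
  using J_comp[OF _ pol1_funpow[OF J_pol1], of j j n] by (simp add: comp_def)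

lemma J_shift:
  assumes j: "j \<in> J" and A: "z \<in> A" "w \<in> A"
  obtains j' where "j' \<in> J" "\<And>x. x \<in> A \<Longrightarrow> j' x = d (j x) z w"
proof -
  obtain jz where jz: "jz \<in> J" "\<forall>x\<in>A. jz x = z" using J_const[OF A(1)] by blast
  obtain jw where jw: "jw \<in> J" "\<forall>x\<in>A. jw x = w" using J_const[OF A(2)] by blast
  show ?thesis by (rule that[OF J.dif[OF j jz(1) jw(1)]]) (use jz(2) jw(2) in simp)
qed

end

section \<open>A unit among the representable polynomials\<close>

context rich
begin

definition J_idempotent :: "('a \<Rightarrow> 'a) \<Rightarrow> bool" where
  "J_idempotent \<epsilon> \<longleftrightarrow> \<epsilon> \<in> J \<and> \<epsilon> c = c \<and> (\<forall>x\<in>A. \<epsilon> (\<epsilon> x) = \<epsilon> x)"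

text \<open>If (1 - \<epsilon>) J vanished, \<epsilon> would fix all values of members of J shifted
  so as to fix c, and by \<open>d_closed_span\<close> all of A. The witness k is j0 - \<epsilon> j0
  for such a shifted j0.\<close>

lemma ex_annihilated:
  assumes \<epsilon>: "J_idempotent \<epsilon>" and ne: "\<epsilon> ` A \<noteq> A"
  obtains k g where "k \<in> J" "k c = c" "\<And>x. x \<in> A \<Longrightarrow> \<epsilon> (k x) = c" "g \<in> A" "k g \<noteq> c"
proof -
  have \<epsilon>J: "\<epsilon> \<in> J" and \<epsilon>c: "\<epsilon> c = c" and idem: "\<And>x. x \<in> A \<Longrightarrow> \<epsilon> (\<epsilon> x) = \<epsilon> x"
    using \<epsilon> unfolding J_idempotent_def by auto
  note \<epsilon>pol = J_pol1[OF \<epsilon>J] and \<epsilon>A = J_in[OF \<epsilon>J]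
  have "\<exists>k g. k \<in> J \<and> k c = c \<and> (\<forall>x\<in>A. \<epsilon> (k x) = c) \<and> g \<in> A \<and> k g \<noteq> c"
  proof (rule ccontr)
    assume neg: "\<not> ?thesis"
    have fixed: "\<epsilon> (d (j g) (j c) c) = d (j g) (j c) c" if j: "j \<in> J" and g: "g \<in> A" for j g
    proof -
      obtain j0 where j0: "j0 \<in> J" "\<And>x. x \<in> A \<Longrightarrow> j0 x = d (j x) (j c) c"
        using J_shift[OF j J_in[OF j c_in] c_in] by blast
      note j0A = J_in[OF j0(1)]
      have j0c: "j0 c = c" using j0(2)[OF c_in] d_left[OF c_in J_in[OF j c_in]] by simp
      define k where "k = (\<lambda>x. d (j0 x) (\<epsilon> (j0 x)) c)"
      have kJ: "k \<in> J" unfolding k_def using J.dif[OF j0(1) J_comp[OF \<epsilon>J J_pol1[OF j0(1)]] J.cst] .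
      have kc: "k c = c" unfolding k_def j0c \<epsilon>c using d_left c_in by simp
      have "\<epsilon> (k x) = c" if x: "x \<in> A" for x
        unfolding k_def pol1_d[OF \<epsilon>pol j0A[OF x] \<epsilon>A[OF j0A[OF x]] c_in] idem[OF j0A[OF x]] \<epsilon>c
        using d_left[OF c_in \<epsilon>A[OF j0A[OF x]]] .
      then have "k g = c" using neg kJ kc g by blast
      then have "j0 g = \<epsilon> (j0 g)"
        unfolding k_def using d_cancel[OF j0A[OF g] \<epsilon>A[OF j0A[OF g]] c_in] by blast
      then show ?thesis using j0(2)[OF g] by simp
    qed
    define W where "W = {x \<in> A. \<epsilon> x = x}"
    have "W = A"
    proof (rule d_closed_span)
      show "W \<subseteq> A" "c \<in> W" unfolding W_def using c_in \<epsilon>c by auto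
      show Wd: "d x y z \<in> W" if "x \<in> W" "y \<in> W" "z \<in> W" for x y z
        using that pol1_d[OF \<epsilon>pol, of x y z] d_in[of x y z] unfolding W_def by simp
      show "p x \<in> W" if p: "p \<in> P" and x: "x \<in> A" for p x
      proof -
        have pJ: "p \<in> J" using J.base[OF p pol1_id] .
        note pA = J_in[OF pJ]
        have 1: "d (p x) (p c) c \<in> W"
          using fixed[OF pJ x] d_in[OF pA[OF x] pA[OF c_in] c_in] unfolding W_def by simp
        have 2: "d c (p c) c \<in> W"
          using fixed[OF pJ a0_in] d_in[OF c_in pA[OF c_in] c_in] unfolding W_def P_a0[OF p] by simp
        \<comment> \<open>The value p x is recovered from two values of the shifted p; the second is
          taken at \<open>a0\<close>, where p itself has value c.\<close>
        have "d (d (p x) (p c) c) (d c (p c) c) c \<in> W"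
          using Wd[OF 1 2] c_in \<epsilon>c unfolding W_def by simp
        then show ?thesis using d_comp3[OF pA[OF x] pA[OF c_in] c_in] by simp
      qed
    qed
    then have "\<epsilon> x = x" if "x \<in> A" for x using that unfolding W_def by blast
    then have "\<epsilon> ` A = A" by simp
    then show False using ne by blast
  qed
  then show ?thesis using that by blast
qed

text \<open>The pair (k g, c) and \<theta> generate the full relation, so a chain leads from c to g.
  Applying k to it and adding up the differences of k (r (k g)) and k (r c) over its translation
  steps yields \<kappa>, which fixes k g modulo \<theta>; so no power of \<kappa> vanishes
  there.\<close>

lemma ex_nonnilpotent:
  assumes \<epsilon>: "J_idempotent \<epsilon>"
    and k: "k \<in> J" "k c = c" "\<And>x. x \<in> A \<Longrightarrow> \<epsilon> (k x) = c" and g: "g \<in> A"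
    and \<theta>: "maximal_relation \<theta>" "(k g, c) \<notin> \<theta>"
  obtains \<kappa> where "\<kappa> \<in> J" "\<kappa> c = c" "\<And>x. x \<in> A \<Longrightarrow> \<epsilon> (\<kappa> x) = c" "(k g, \<kappa> (k g)) \<in> \<theta>"
proof -
  have \<epsilon>J: "\<epsilon> \<in> J" and \<epsilon>c: "\<epsilon> c = c"
    using \<epsilon> unfolding J_idempotent_def by auto
  note \<epsilon>pol = J_pol1[OF \<epsilon>J]
  have eq: "equiv A \<theta>" using maximal_relationD(1)[OF \<theta>(1)] .
  have \<theta>A: "\<theta> \<subseteq> A \<times> A" and sym: "sym \<theta>" and tr: "trans \<theta>" and rf: "refl_on A \<theta>"
    using eq unfolding equiv_def by simp_all
  note kA = J_in[OF k(1)]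
  \<comment> \<open>Q z says that \<kappa> (k g) agrees with k z up to a difference belonging to
    \<theta>. The quantifier over w makes this a statement on differences, independent of a base
    point, so that it survives the addition of further steps.\<close>
  define Q where "Q = (\<lambda>z. \<exists>\<kappa>. \<kappa> \<in> J \<and> \<kappa> c = c \<and> (\<forall>x\<in>A. \<epsilon> (\<kappa> x) = c) \<and>
    (\<forall>w\<in>A. (d (k z) (\<kappa> (k g)) w, w) \<in> \<theta>))"
  have "(c, g) \<in> (\<theta> \<union> trans_step (k g) c)\<^sup>*"
    using maximal_relationD(3)[OF \<theta>(1) kA[OF g] c_in \<theta>(2) c_in g] .
  then have "g \<in> A \<and> Q g"
  proof (induction rule: rtrancl_induct)
    case base
    have "(d (k c) c w, w) \<in> \<theta>" if "w \<in> A" for w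
      unfolding k(2) using d_left[OF that c_in] refl_onD[OF rf that] by simp
    then show ?case
      unfolding Q_def using c_in J.cst \<epsilon>c by (intro conjI exI[of _ "\<lambda>x. c"]) simp_all
  next
    case (step z z')
    then have zA: "z \<in> A" by blast
    obtain \<kappa> where \<kappa>: "\<kappa> \<in> J" "\<kappa> c = c" "\<And>x. x \<in> A \<Longrightarrow> \<epsilon> (\<kappa> x) = c"
      and rel: "\<And>w. w \<in> A \<Longrightarrow> (d (k z) (\<kappa> (k g)) w, w) \<in> \<theta>"
      using step.IH unfolding Q_def by blast
    note \<kappa>A = J_in[OF \<kappa>(1)]
    have kgA: "k g \<in> A" "\<kappa> (k g) \<in> A" using kA g \<kappa>A by auto
    show ?case
    proof (cases "(z, z') \<in> \<theta>")
      case True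
      then have z'A: "z' \<in> A" using \<theta>A by blast
      have "(d (k z') (\<kappa> (k g)) w, w) \<in> \<theta>" if w: "w \<in> A" for w
      proof -
        define w' where "w' = d (k z) (\<kappa> (k g)) w"
        have w'A: "w' \<in> A" unfolding w'_def using d_in kA[OF zA] kgA w by simp
        obtain s where s: "s \<in> J" "\<And>x. x \<in> A \<Longrightarrow> s x = d (k x) (k z) w'"
          using J_shift[OF k(1) kA[OF zA] w'A] by blast
        have "s z = w'" using s(2)[OF zA] d_left[OF w'A kA[OF zA]] by simp
        moreover have "s z' = d (k z') (\<kappa> (k g)) w"
          unfolding s(2)[OF z'A] w'_def using d_comp1[OF kA[OF z'A] kA[OF zA] kgA(2) w] .
        ultimately have "(w', d (k z') (\<kappa> (k g)) w) \<in> \<theta>"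
          using maximal_relationD(2)[OF \<theta>(1) J_pol1[OF s(1)] True] by simp
        then show ?thesis using rel[OF w] unfolding w'_def by (meson symD[OF sym] transD[OF tr])
      qed
      then show ?thesis unfolding Q_def using z'A \<kappa> by blast
    next
      case False
      then obtain r where r: "r \<in> pol1" "(z, z') = (r (k g), r c) \<or> (z, z') = (r c, r (k g))"
        using step.hyps(2) unfolding trans_step_def by blast
      have z'A: "z' \<in> A" using r pol1_rng[OF r(1)] kgA c_in by auto
      define kr where "kr = (\<lambda>x. k (r x))"
      have krJ: "kr \<in> J" unfolding kr_def using J_comp[OF k(1) r(1)] .
      note krA = J_in[OF krJ]
      have \<epsilon>kr: "\<epsilon> (kr x) = c" if "x \<in> A" for x
        unfolding kr_def using k(3) pol1_rng[OF r(1) that] by blast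
      obtain kc where kc: "kc \<in> J" "\<And>x. x \<in> A \<Longrightarrow> kc x = kr c"
        using J_const[OF krA[OF c_in]] by blast
      \<comment> \<open>A step may be traversed in either direction. In both cases \<kappa> - j1 +
        j2 adds k z' - k z at the point k g and nothing at c.\<close>
      define j1 j2 where "j1 = (if z = r (k g) \<and> z' = r c then kr else kc)"
        and "j2 = (if z = r (k g) \<and> z' = r c then kc else kr)"
      define \<kappa>' where "\<kappa>' = (\<lambda>x. d (\<kappa> x) (j1 x) (j2 x))"
      have j12: "j1 \<in> J" "j2 \<in> J" unfolding j1_def j2_def using krJ kc by auto
      have \<kappa>'J: "\<kappa>' \<in> J" unfolding \<kappa>'_def using J.dif[OF \<kappa>(1) j12] .
      have jc: "j1 c = kr c" "j2 c = kr c" unfolding j1_def j2_def using kc(2)[OF c_in] by auto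
      have \<epsilon>j: "\<epsilon> (j1 x) = c" "\<epsilon> (j2 x) = c" if "x \<in> A" for x
        unfolding j1_def j2_def using \<epsilon>kr that kc(2)[OF that] c_in by auto
      have jz: "j1 (k g) = k z" "j2 (k g) = k z'"
        unfolding j1_def j2_def using r(2) kc(2)[OF kgA(1)] unfolding kr_def by auto
      have "\<kappa>' c = c" unfolding \<kappa>'_def \<kappa>(2) jc using d_right[OF c_in krA[OF c_in]] .
      moreover have "\<epsilon> (\<kappa>' x) = c" if x: "x \<in> A" for x
        unfolding \<kappa>'_def pol1_d[OF \<epsilon>pol \<kappa>A[OF x] J_in[OF j12(1) x] J_in[OF j12(2) x]]
          \<kappa>(3)[OF x] \<epsilon>j[OF x] using d_left[OF c_in c_in] .
      moreover have "(d (k z') (\<kappa>' (k g)) w, w) \<in> \<theta>" if w: "w \<in> A" for w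
        unfolding \<kappa>'_def jz d_comp2[OF kA[OF zA] kgA(2) kA[OF z'A] w] using rel[OF w] .
      ultimately show ?thesis unfolding Q_def using z'A \<kappa>'J by blast
    qed
  qed
  then obtain \<kappa> where \<kappa>: "\<kappa> \<in> J" "\<kappa> c = c" "\<And>x. x \<in> A \<Longrightarrow> \<epsilon> (\<kappa> x) = c"
    and rel: "\<And>w. w \<in> A \<Longrightarrow> (d (k g) (\<kappa> (k g)) w, w) \<in> \<theta>"
    unfolding Q_def by blast
  have "(k g, \<kappa> (k g)) \<in> \<theta>"
    using rel[OF J_in[OF \<kappa>(1) kA[OF g]]] d_right[OF kA[OF g] J_in[OF \<kappa>(1) kA[OF g]]] by simp
  then show ?thesis using that \<kappa> by blast
qed

text \<open>A power \<eta> of \<kappa> is idempotent, satisfies \<epsilon> \<eta> = 0, and does not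
  vanish at y because \<kappa> fixes y modulo \<theta>. Then \<epsilon> - \<eta> \<epsilon> + \<eta>
  is an idempotent whose range contains that of \<epsilon> and the new point \<eta> y.\<close>

lemma larger_idempotent:
  assumes \<epsilon>: "J_idempotent \<epsilon>"
    and \<kappa>: "\<kappa> \<in> J" "\<kappa> c = c" "\<And>x. x \<in> A \<Longrightarrow> \<epsilon> (\<kappa> x) = c"
    and y: "y \<in> A" "(y, \<kappa> y) \<in> \<theta>" "(y, c) \<notin> \<theta>" and \<theta>: "maximal_relation \<theta>"
  shows "\<exists>\<epsilon>'. J_idempotent \<epsilon>' \<and> \<epsilon> ` A \<subset> \<epsilon>' ` A"
proof -
  have \<epsilon>J: "\<epsilon> \<in> J" and \<epsilon>c: "\<epsilon> c = c" and idem: "\<And>x. x \<in> A \<Longrightarrow> \<epsilon> (\<epsilon> x) = \<epsilon> x"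
    using \<epsilon> unfolding J_idempotent_def by auto
  note \<epsilon>pol = J_pol1[OF \<epsilon>J] and \<epsilon>A = J_in[OF \<epsilon>J] and \<kappa>A = J_in[OF \<kappa>(1)]
  define n where "n = (fact (card A) :: nat)"
  obtain l where n: "n = Suc l" unfolding n_def by (metis fact_nonzero not0_implies_Suc)
  define \<eta> where "\<eta> = \<kappa> ^^ n"
  have \<eta>J: "\<eta> \<in> J" unfolding \<eta>_def n by (rule J_funpow[OF \<kappa>(1)])
  note \<eta>pol = J_pol1[OF \<eta>J] and \<eta>A = J_in[OF \<eta>J]
  have \<eta>idem: "\<eta> (\<eta> x) = \<eta> x" if "x \<in> A" for x
    unfolding \<eta>_def n_def using \<kappa>A that by (intro funpow_fact_idem[OF fin]) auto
  have "(\<kappa> ^^ i) c = c" for i by (induction i) (auto simp: \<kappa>(2))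
  then have \<eta>c: "\<eta> c = c" unfolding \<eta>_def by simp
  have \<epsilon>\<eta>: "\<epsilon> (\<eta> x) = c" if "x \<in> A" for x
  proof -
    have "(\<kappa> ^^ l) x \<in> A" using that \<kappa>A by (intro funpow_in) auto
    then show ?thesis unfolding \<eta>_def n using \<kappa>(3) by simp
  qed
  have tr: "trans \<theta>" and rf: "refl_on A \<theta>" using maximal_relationD(1)[OF \<theta>] unfolding equiv_def by auto
  have "(y, (\<kappa> ^^ i) y) \<in> \<theta>" for i
  proof (induction i)
    case 0
    then show ?case using refl_onD[OF rf y(1)] by simp
  next
    case (Suc i)
    show ?case using transD[OF tr y(2) maximal_relationD(2)[OF \<theta> J_pol1[OF \<kappa>(1)] Suc]] by simp
  qed
  then have y\<eta>: "\<eta> y \<noteq> c" using y(3) unfolding \<eta>_def by metis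
  define \<epsilon>' where "\<epsilon>' = (\<lambda>x. d (\<epsilon> x) (\<eta> (\<epsilon> x)) (\<eta> x))"
  have \<epsilon>'J: "\<epsilon>' \<in> J" unfolding \<epsilon>'_def using J.dif[OF \<epsilon>J J_comp[OF \<eta>J \<epsilon>pol] \<eta>J] .
  have c1: "\<epsilon> (\<epsilon>' x) = \<epsilon> x" if x: "x \<in> A" for x
    unfolding \<epsilon>'_def pol1_d[OF \<epsilon>pol \<epsilon>A[OF x] \<eta>A[OF \<epsilon>A[OF x]] \<eta>A[OF x]] \<epsilon>\<eta>[OF \<epsilon>A[OF x]] \<epsilon>\<eta>[OF x] idem[OF x]
    using d_right[OF \<epsilon>A[OF x] c_in] .
  have c2: "\<eta> (\<epsilon>' x) = \<eta> x" if x: "x \<in> A" for x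
    unfolding \<epsilon>'_def pol1_d[OF \<eta>pol \<epsilon>A[OF x] \<eta>A[OF \<epsilon>A[OF x]] \<eta>A[OF x]] \<eta>idem[OF \<epsilon>A[OF x]] \<eta>idem[OF x]
    using d_left[OF \<eta>A[OF x] \<eta>A[OF \<epsilon>A[OF x]]] .
  have c3: "\<epsilon>' (\<epsilon>' x) = \<epsilon>' x" if x: "x \<in> A" for x
    unfolding \<epsilon>'_def[THEN fun_cong, of "\<epsilon>' x"] c1[OF x] c2[OF x] by (simp add: \<epsilon>'_def)
  have c4: "\<epsilon>' c = c" unfolding \<epsilon>'_def \<epsilon>c \<eta>c using d_left[OF c_in c_in] .
  have 1: "J_idempotent \<epsilon>'" unfolding J_idempotent_def using \<epsilon>'J c3 c4 by blast
  have "\<epsilon>' (\<epsilon> x) = \<epsilon> x" if x: "x \<in> A" for x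
    unfolding \<epsilon>'_def idem[OF x] using d_right[OF \<epsilon>A[OF x] \<eta>A[OF \<epsilon>A[OF x]]] .
  then have 2: "\<epsilon> ` A \<subseteq> \<epsilon>' ` A" using \<epsilon>A by (metis image_eqI image_subsetI)
  have "\<epsilon>' (\<eta> y) = \<eta> y"
    unfolding \<epsilon>'_def \<epsilon>\<eta>[OF y(1)] \<eta>c \<eta>idem[OF y(1)] using d_left[OF \<eta>A[OF y(1)] c_in] .
  then have 3: "\<eta> y \<in> \<epsilon>' ` A" using \<eta>A[OF y(1)] by (metis image_eqI)
  have "\<eta> y \<notin> \<epsilon> ` A"
  proof
    assume "\<eta> y \<in> \<epsilon> ` A"
    then obtain x where x: "x \<in> A" "\<eta> y = \<epsilon> x" by blast
    then have "\<epsilon> (\<eta> y) = \<eta> y" using idem by simp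
    then show False using \<epsilon>\<eta>[OF y(1)] y\<eta> by simp
  qed
  with 1 2 3 show ?thesis by blast
qed

text \<open>The hypothesis is the form in which semisimplicity enters. By the three preceding lemmas
  an idempotent of J with the largest range is onto, hence the identity on A, and then
  \<open>J_combination\<close> yields d itself.\<close>

lemma d_in_C:
  assumes max: "\<And>x y. x \<in> A \<Longrightarrow> y \<in> A \<Longrightarrow> x \<noteq> y \<Longrightarrow> \<exists>\<theta>. maximal_relation \<theta> \<and> (x, y) \<notin> \<theta>"
  shows "(\<lambda>\<rho>. d (\<rho> 0) (\<rho> 1) (\<rho> 2)) \<in> C"
proof -
  have "J_idempotent (\<lambda>x. c)" unfolding J_idempotent_def using J.cst by simp
  moreover have "\<forall>\<epsilon>. J_idempotent \<epsilon> \<longrightarrow> card (\<epsilon> ` A) < Suc (card A)"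
    by (intro allI impI le_imp_less_Suc card_image_le fin)
  ultimately obtain \<epsilon> where \<epsilon>: "J_idempotent \<epsilon>" and mx: "\<And>\<epsilon>'. J_idempotent \<epsilon>' \<Longrightarrow> card (\<epsilon>' ` A) \<le> card (\<epsilon> ` A)"
    using ex_has_greatest_nat[of J_idempotent "\<lambda>x. c" "\<lambda>\<epsilon>. card (\<epsilon> ` A)" "Suc (card A)"] by blast
  have \<epsilon>J: "\<epsilon> \<in> J" and idem: "\<And>x. x \<in> A \<Longrightarrow> \<epsilon> (\<epsilon> x) = \<epsilon> x"
    using \<epsilon> unfolding J_idempotent_def by auto
  have "\<epsilon> ` A = A"
  proof (rule ccontr)
    assume "\<epsilon> ` A \<noteq> A"
    then obtain k g where k: "k \<in> J" "k c = c" "\<And>x. x \<in> A \<Longrightarrow> \<epsilon> (k x) = c" and g: "g \<in> A" "k g \<noteq> c"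
      using ex_annihilated[OF \<epsilon>] by blast
    obtain \<theta> where \<theta>: "maximal_relation \<theta>" "(k g, c) \<notin> \<theta>"
      using max[OF J_in[OF k(1) g(1)] c_in g(2)] by blast
    obtain \<kappa> where \<kappa>: "\<kappa> \<in> J" "\<kappa> c = c" "\<And>x. x \<in> A \<Longrightarrow> \<epsilon> (\<kappa> x) = c" "(k g, \<kappa> (k g)) \<in> \<theta>"
      using ex_nonnilpotent[OF \<epsilon> k g(1) \<theta>] by blast
    obtain \<epsilon>' where \<epsilon>': "J_idempotent \<epsilon>'" "\<epsilon> ` A \<subset> \<epsilon>' ` A"
      using larger_idempotent[OF \<epsilon> \<kappa>(1-3) J_in[OF k(1) g(1)] \<kappa>(4) \<theta>(2,1)] by blast
    have "card (\<epsilon> ` A) < card (\<epsilon>' ` A)" using \<epsilon>'(2) fin by (intro psubset_card_mono) auto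
    then show False using mx[OF \<epsilon>'(1)] by simp
  qed
  then have id: "\<epsilon> x = x" if "x \<in> A" for x using that idem by (metis imageE)
  show ?thesis
  proof (rule ext[OF J_combination[OF \<epsilon>J \<epsilon>J \<epsilon>J]])
    fix \<rho> :: "nat \<Rightarrow> 'a" assume "range \<rho> \<subseteq> A"
    then have "\<rho> i \<in> A" for i by auto
    then show "d (\<epsilon> (\<rho> 0)) (\<epsilon> (\<rho> 1)) (\<epsilon> (\<rho> 2)) = d (\<rho> 0) (\<rho> 1) (\<rho> 2)" using id by simp
  qed
qed

end

section \<open>Counting tuples by patterns of variable types\<close>

lemma card_bounded_subsets_le:
  assumes "finite X"
  shows "card {S. S \<subseteq> X \<and> card S \<le> K} \<le> (card X + 1) ^ K"
proof -
  define Y where "Y = insert None (Some ` X)"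
  have finY: "finite Y" unfolding Y_def using assms by simp
  have cY: "card Y = card X + 1"
    unfolding Y_def using assms by (subst card_insert_disjoint) (auto simp: card_image)
  \<comment> \<open>Sets with at most K elements are coded by lists of length exactly K, padded with
    \<open>None\<close>.\<close>
  have "{S. S \<subseteq> X \<and> card S \<le> K} \<subseteq> (\<lambda>l. {x. Some x \<in> set l}) ` {l. set l \<subseteq> Y \<and> length l = K}"
  proof
    fix S assume "S \<in> {S. S \<subseteq> X \<and> card S \<le> K}"
    then have S: "S \<subseteq> X" "card S \<le> K" by auto
    then obtain xs where xs: "set xs = S" "distinct xs"
      using assms finite_distinct_list finite_subset by metis
    then have len: "length xs \<le> K" using S distinct_card by fastforce
    define l where "l = map Some xs @ replicate (K - length xs) None"
    have "length l = K" "set l \<subseteq> Y" "{x. Some x \<in> set l} = S"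
      unfolding l_def Y_def using len xs S by auto
    then show "S \<in> (\<lambda>l. {x. Some x \<in> set l}) ` {l. set l \<subseteq> Y \<and> length l = K}" by blast
  qed
  then have "card {S. S \<subseteq> X \<and> card S \<le> K} \<le> card ((\<lambda>l. {x. Some x \<in> set l}) ` {l. set l \<subseteq> Y \<and> length l = K})"
    using finite_lists_length_eq[OF finY] by (intro card_mono) auto
  also have "\<dots> \<le> card {l. set l \<subseteq> Y \<and> length l = K}"
    using finite_lists_length_eq[OF finY] by (rule card_image_le)
  also have "\<dots> = (card X + 1) ^ K" using card_lists_length_eq[OF finY] cY by simp
  finally show ?thesis .
qed

lemma card_constrained_lists_le:
  assumes "finite A" and D: "\<And>k. k < n \<Longrightarrow> D k \<subseteq> A \<and> card (D k) \<le> q"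
  shows "card {w \<in> pow_carrier A n. \<forall>k<n. w ! k \<in> D k} \<le> q ^ n"
proof -
  have fin: "finite (D k)" if "k < n" for k using D[OF that] assms(1) finite_subset by blast
  have "card {w \<in> pow_carrier A n. \<forall>k<n. w ! k \<in> D k} \<le> card (PiE {..<n} D)"
  proof (rule card_inj_on_le)
    show "inj_on (\<lambda>w. restrict (\<lambda>k. w ! k) {..<n}) {w \<in> pow_carrier A n. \<forall>k<n. w ! k \<in> D k}"
    proof (rule inj_onI)
      fix v w assume v: "v \<in> {w \<in> pow_carrier A n. \<forall>k<n. w ! k \<in> D k}"
        and w: "w \<in> {w \<in> pow_carrier A n. \<forall>k<n. w ! k \<in> D k}"
        and eq: "restrict (\<lambda>k. v ! k) {..<n} = restrict (\<lambda>k. w ! k) {..<n}"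
      have "v ! k = w ! k" if "k < n" for k using fun_cong[OF eq, of k] that by simp
      then show "v = w" using v w unfolding pow_carrier_def by (intro nth_equalityI) auto
    qed
    show "finite (PiE {..<n} D)" using fin by (intro finite_PiE) auto
    show "(\<lambda>w. restrict (\<lambda>k. w ! k) {..<n}) ` {w \<in> pow_carrier A n. \<forall>k<n. w ! k \<in> D k} \<subseteq> PiE {..<n} D"
      by (simp add: image_subset_iff restrict_PiE_iff)
  qed
  also have "\<dots> = (\<Prod>k<n. card (D k))" by (simp add: card_PiE)
  also have "\<dots> \<le> (\<Prod>k<n. q)" using D by (intro prod_mono) auto
  finally show ?thesis by simp
qed

context quasi_affine
begin

definition frequent_types :: "nat \<Rightarrow> nat \<Rightarrow> ((nat \<Rightarrow> 'a) \<Rightarrow> 'a) \<Rightarrow> ('a \<Rightarrow> 'a) set" where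
  "frequent_types T m f = {p \<in> var_type f ` {..<m}. T \<le> card {j. j < m \<and> var_type f j = p}}"

text \<open>Contributions of the rare types are determined by boundedly many variables, while the
  frequent ones only move inside their span. If this span were never the full difference
  group, too few tuples would be reached.\<close>

lemma ex_full_span:
  assumes gen: "\<And>w. w \<in> pow_carrier A n \<Longrightarrow>
      \<exists>p\<in>C. \<forall>k<n. w ! k = p (\<lambda>j. if j < m then g j k else a0)"
    and g: "\<And>j k. j < m \<Longrightarrow> k < n \<Longrightarrow> g j k \<in> A"
    and L: "L = card A ^ card A"
    and small: "card A * 2 ^ L * (m * L + 1) ^ (T * L) * (card A - 1) ^ n < card A ^ n"
  shows "\<exists>f\<in>C. \<forall>x\<in>A. \<forall>y\<in>A. \<phi> x - \<phi> y \<in> span (frequent_types T m f) (f (\<lambda>_. a0))"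
proof (rule ccontr)
  assume neg: "\<not> ?thesis"
  define \<Lambda> where "\<Lambda> = A \<rightarrow>\<^sub>E A"
  have fin\<Lambda>: "finite \<Lambda>" unfolding \<Lambda>_def using fin by (simp add: finite_PiE)
  have card\<Lambda>: "card \<Lambda> = L" unfolding \<Lambda>_def L using fin by (simp add: card_funcsetE)
  \<comment> \<open>A rare type occurs fewer than T times and there are at most L types, so the rare
    variables with their types form a set of at most T * L pairs.\<close>
  define S\<^sub>0 where "S\<^sub>0 = {S. S \<subseteq> {..<m} \<times> \<Lambda> \<and> card S \<le> T * L}"
  define \<D> where "\<D> = A \<times> Pow \<Lambda> \<times> S\<^sub>0"
  define full where "full = (\<lambda>(c, P, S :: (nat \<times> ('a \<Rightarrow> 'a)) set). \<forall>x\<in>A. \<forall>y\<in>A. \<phi> x - \<phi> y \<in> span P c)"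
  \<comment> \<open>For a pattern of base value, frequent types and rare variables, y is the
    determined part of coordinate k. The frequent variables move this coordinate only within the
    span, so \<open>D\<close> collects the elements of A compatible with the pattern.\<close>
  define y where "y = (\<lambda>(c, P :: ('a \<Rightarrow> 'a) set, S) k. \<phi> c + (\<Sum>(j, p)\<in>S. \<phi> (p (g j k)) - \<phi> c))"
  define D where "D = (\<lambda>\<delta> k. {a \<in> A. \<phi> a - y \<delta> k \<in> span (fst (snd \<delta>)) (fst \<delta>)})"
  define W where "W = (\<lambda>\<delta>. {w \<in> pow_carrier A n. \<forall>k<n. w ! k \<in> D \<delta> k})"
  have finS0: "finite S\<^sub>0"
    unfolding S\<^sub>0_def by (rule finite_subset[of _ "Pow ({..<m} \<times> \<Lambda>)"]) (use fin\<Lambda> in auto)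
  have fin\<D>: "finite \<D>" unfolding \<D>_def using fin fin\<Lambda> finS0 by simp
  have card\<D>: "card \<D> \<le> card A * 2 ^ L * (m * L + 1) ^ (T * L)"
  proof -
    have "card S\<^sub>0 \<le> (card ({..<m} \<times> \<Lambda>) + 1) ^ (T * L)"
      unfolding S\<^sub>0_def using fin\<Lambda> by (intro card_bounded_subsets_le) simp
    then have "card S\<^sub>0 \<le> (m * L + 1) ^ (T * L)" by (simp add: card_cartesian_product card\<Lambda>)
    then show ?thesis
      unfolding \<D>_def by (simp add: card_cartesian_product card_Pow[OF fin\<Lambda>] card\<Lambda> mult.assoc)
  qed
  have cover: "pow_carrier A n \<subseteq> (\<Union>\<delta>\<in>{\<delta> \<in> \<D>. \<not> full \<delta>}. W \<delta>)"
  proof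
    fix w assume w: "w \<in> pow_carrier A n"
    obtain f where f: "f \<in> C" "\<And>k. k < n \<Longrightarrow> w ! k = f (\<lambda>j. if j < m then g j k else a0)"
      using gen[OF w] by blast
    define c where "c = f (\<lambda>_. a0)"
    define P where "P = frequent_types T m f"
    define R where "R = {j. j < m \<and> var_type f j \<notin> P}"
    define S where "S = (\<lambda>j. (j, var_type f j)) ` R"
    have type\<Lambda>: "var_type f j \<in> \<Lambda>" for j
      unfolding \<Lambda>_def var_type_def restrict_PiE_iff using rng[OF f(1) single_rng] by blast
    have P\<Lambda>: "P \<subseteq> \<Lambda>" and Pfin: "finite P" unfolding P_def frequent_types_def using type\<Lambda> by auto
    have finR: "finite R" unfolding R_def by simp
    have "R \<subseteq> (\<Union>p\<in>\<Lambda> - P. {j. j < m \<and> var_type f j = p})" unfolding R_def using type\<Lambda> by auto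
    then have "card R \<le> card (\<Union>p\<in>\<Lambda> - P. {j. j < m \<and> var_type f j = p})"
      using fin\<Lambda> by (intro card_mono) auto
    also have "\<dots> \<le> (\<Sum>p\<in>\<Lambda> - P. card {j. j < m \<and> var_type f j = p})"
      using fin\<Lambda> by (intro card_UN_le) auto
    also have "\<dots> \<le> (\<Sum>p\<in>\<Lambda> - P. T)"
    proof (rule sum_mono)
      fix p assume p: "p \<in> \<Lambda> - P"
      show "card {j. j < m \<and> var_type f j = p} \<le> T"
      proof (cases "p \<in> var_type f ` {..<m}")
        case True
        then show ?thesis using p unfolding P_def frequent_types_def by simp
      next
        case False
        then have "{j. j < m \<and> var_type f j = p} = {}" by auto
        then show ?thesis by (simp only: card.empty)
      qed
    qed
    also have "\<dots> \<le> L * T" using card_mono[OF fin\<Lambda>, of "\<Lambda> - P"] card\<Lambda> by simp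
    finally have "card R \<le> T * L" by (simp add: mult.commute)
    then have "card S \<le> T * L" unfolding S_def using card_image_le[OF finR] le_trans by blast
    then have \<delta>: "(c, P, S) \<in> \<D>"
      unfolding \<D>_def S\<^sub>0_def S_def R_def c_def using rng[OF f(1), of "\<lambda>_. a0"] a0_in P\<Lambda> type\<Lambda> by auto
    have "w ! k \<in> D (c, P, S) k" if k: "k < n" for k
    proof -
      define \<rho> where "\<rho> = (\<lambda>j. if j < m then g j k else a0)"
      have \<rho>: "range \<rho> \<subseteq> A" unfolding \<rho>_def using g k a0_in by auto
      have tr: "trunc m \<rho> = \<rho>" unfolding trunc_def \<rho>_def by auto
      have wk: "w ! k = f \<rho>" unfolding \<rho>_def using f(2)[OF k] .
      define h where "h = (\<lambda>j. \<phi> (var_type f j (\<rho> j)) - \<phi> c)"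
      have \<rho>A: "\<rho> j \<in> A" for j using \<rho> by auto
      have "\<phi> (f \<rho>) - \<phi> c - (\<Sum>j<m. h j) \<in> N"
        using decomposition[OF f(1) \<rho>, of m] unfolding tr h_def c_def var_type_simp[OF \<rho>A] .
      then have d1: "\<phi> (f \<rho>) - \<phi> c - (\<Sum>j<m. h j) \<in> span P c" by (rule span_N)
      have "{..<m} = R \<union> {j. j < m \<and> var_type f j \<in> P}" unfolding R_def by auto
      then have split: "(\<Sum>j<m. h j) = (\<Sum>j\<in>R. h j) + (\<Sum>j | j < m \<and> var_type f j \<in> P. h j)"
        by (simp only:) (rule sum.union_disjoint, auto simp: R_def)
      have d2: "(\<Sum>j | j < m \<and> var_type f j \<in> P. h j) \<in> span P c"
        unfolding h_def using span_gen[OF Pfin _ \<rho>A] by (intro add_subgroup_sum[OF span_add_subgroup]) auto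
      have "(\<Sum>j\<in>R. h j) = (\<Sum>(j, p)\<in>S. \<phi> (p (g j k)) - \<phi> c)"
        unfolding S_def by (subst sum.reindex) (auto simp: inj_on_def h_def \<rho>_def R_def intro!: sum.cong)
      then have "\<phi> (f \<rho>) - y (c, P, S) k = (\<phi> (f \<rho>) - \<phi> c - (\<Sum>j<m. h j)) + (\<Sum>j | j < m \<and> var_type f j \<in> P. h j)"
        unfolding y_def split by simp
      then have "\<phi> (f \<rho>) - y (c, P, S) k \<in> span P c"
        using add_subgroupD(4)[OF span_add_subgroup d1 d2] by (simp only:)
      then show ?thesis unfolding D_def wk using rng[OF f(1) \<rho>] by simp
    qed
    then have "w \<in> W (c, P, S)" unfolding W_def using w by blast
    moreover have "\<not> full (c, P, S)"
      using neg f(1) unfolding full_def P_def c_def by auto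
    ultimately show "w \<in> (\<Union>\<delta>\<in>{\<delta> \<in> \<D>. \<not> full \<delta>}. W \<delta>)" using \<delta> by blast
  qed
  have card_W: "card (W \<delta>) \<le> (card A - 1) ^ n" if \<delta>: "\<not> full \<delta>" for \<delta>
    unfolding W_def
  proof (rule card_constrained_lists_le[OF fin])
    fix k assume "k < n"
    have DA: "D \<delta> k \<subseteq> A" unfolding D_def by blast
    \<comment> \<open>If all of A were compatible at a single coordinate, subtraction would put all
      differences into the span. So a pattern that is not full loses an element in every
      coordinate.\<close>
    have "D \<delta> k \<noteq> A"
    proof
      assume eq: "D \<delta> k = A"
      have "\<phi> x - \<phi> x' \<in> span (fst (snd \<delta>)) (fst \<delta>)" if "x \<in> A" "x' \<in> A" for x x'
      proof -
        have "\<phi> x - y \<delta> k \<in> span (fst (snd \<delta>)) (fst \<delta>)" "\<phi> x' - y \<delta> k \<in> span (fst (snd \<delta>)) (fst \<delta>)"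
          using that eq unfolding D_def by auto
        from add_subgroupD(2)[OF span_add_subgroup this] show ?thesis by simp
      qed
      then show False using \<delta> unfolding full_def by (auto split: prod.splits)
    qed
    then have "card (D \<delta> k) < card A" using DA fin by (intro psubset_card_mono) auto
    then show "D \<delta> k \<subseteq> A \<and> card (D \<delta> k) \<le> card A - 1" using DA by simp
  qed
  have finpow: "finite (pow_carrier A n)"
    using finite_lists_length_eq[OF fin] unfolding pow_carrier_def by (simp add: conj_commute)
  have finW: "finite (W \<delta>)" for \<delta> unfolding W_def using finpow by simp
  have "card A ^ n = card (pow_carrier A n)"
    using card_lists_length_eq[OF fin] unfolding pow_carrier_def by (simp add: conj_commute)
  also have "\<dots> \<le> card (\<Union>\<delta>\<in>{\<delta> \<in> \<D>. \<not> full \<delta>}. W \<delta>)"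
    using cover fin\<D> finW by (intro card_mono) auto
  also have "\<dots> \<le> (\<Sum>\<delta>\<in>{\<delta> \<in> \<D>. \<not> full \<delta>}. card (W \<delta>))"
    using fin\<D> by (intro card_UN_le) auto
  also have "\<dots> \<le> (\<Sum>\<delta>\<in>{\<delta> \<in> \<D>. \<not> full \<delta>}. (card A - 1) ^ n)"
    using card_W by (intro sum_mono) auto
  also have "\<dots> = card {\<delta> \<in> \<D>. \<not> full \<delta>} * (card A - 1) ^ n" by simp
  also have "\<dots> \<le> card A * 2 ^ L * (m * L + 1) ^ (T * L) * (card A - 1) ^ n"
    using card_mono[OF fin\<D>, of "{\<delta> \<in> \<D>. \<not> full \<delta>}"] card\<D> by (intro mult_le_mono1) auto
  also have "\<dots> < card A ^ n" by (rule small)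
  finally show False by simp
qed

end

section \<open>The quasi-affine representation of a solvable semisimple algebra\<close>

lemma power_times_power_limit_0:
  fixes x :: real
  assumes x: "0 \<le> x" "x < 1"
  shows "(\<lambda>n. real n ^ K * x ^ n) \<longlonglongrightarrow> 0"
proof (cases "K = 0")
  case True
  then show ?thesis using LIMSEQ_realpow_zero[OF x] by simp
next
  case False
  \<comment> \<open>The root turns n^K x^n into (n y^n)^K and reduces the claim to the linear
    case.\<close>
  define y where "y = root K x"
  have y: "0 \<le> y" "y < 1" "y ^ K = x"
    unfolding y_def using x False by (auto simp: real_root_lt_1_iff)
  have "(\<lambda>n. (of_nat n * y ^ n) ^ K) \<longlonglongrightarrow> 0 ^ K"
    using y by (intro tendsto_power powser_times_n_limit_0) auto
  moreover have "(of_nat n * y ^ n) ^ K = real n ^ K * x ^ n" for n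
    unfolding y(3)[symmetric] by (simp add: power_mult_distrib power_mult[symmetric] mult.commute)
  ultimately show ?thesis using False by (simp add: power_0_left)
qed

lemma exponential_beats_polynomial:
  fixes q K1 K2 L :: nat and C :: real
  assumes L: "L > 0"
  shows "\<exists>n0. \<forall>n\<ge>n0. \<forall>m. real m \<le> C * real n \<longrightarrow> K1 * (m * L + 1) ^ K2 * q ^ n < (q + 1) ^ n"
proof -
  define c where "c = (\<bar>C\<bar> + 1) * real L + 1"
  define x where "x = real q / real (q + 1)"
  have c: "c \<ge> 1" unfolding c_def by simp
  have x: "\<bar>x\<bar> < 1" unfolding x_def by simp
  have "(\<lambda>n. real K1 * c ^ K2 * (real n ^ K2 * x ^ n)) \<longlonglongrightarrow> real K1 * c ^ K2 * 0"
    unfolding x_def by (intro tendsto_mult tendsto_const power_times_power_limit_0) auto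
  then have "eventually (\<lambda>n. real K1 * c ^ K2 * (real n ^ K2 * x ^ n) < 1) sequentially"
    by (intro order_tendstoD(2)) auto
  then obtain n0 where n0: "\<And>n. n \<ge> n0 \<Longrightarrow> real K1 * c ^ K2 * (real n ^ K2 * x ^ n) < 1"
    unfolding eventually_sequentially by blast
  have "K1 * (m * L + 1) ^ K2 * q ^ n < (q + 1) ^ n"
    if n: "n \<ge> max 1 n0" and m: "real m \<le> C * real n" for n m
  proof -
    have n1: "real n \<ge> 1" using n by simp
    have "real m \<le> (\<bar>C\<bar> + 1) * real n"
      using m n1 mult_right_mono[of C "\<bar>C\<bar> + 1" "real n"] by linarith
    then have "real m * real L \<le> (\<bar>C\<bar> + 1) * real n * real L" by (rule mult_right_mono) simp
    then have "real (m * L + 1) \<le> c * real n"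
      unfolding c_def using n1 by (simp add: algebra_simps)
    then have "real (m * L + 1) ^ K2 \<le> (c * real n) ^ K2" by (intro power_mono) auto
    then have "real K1 * real (m * L + 1) ^ K2 * x ^ n \<le> real K1 * (c * real n) ^ K2 * x ^ n"
      unfolding x_def by (intro mult_right_mono mult_left_mono) auto
    also have "\<dots> = real K1 * c ^ K2 * (real n ^ K2 * x ^ n)" by (simp add: power_mult_distrib)
    also have "\<dots> < 1" using n0 n by simp
    finally have "real K1 * real (m * L + 1) ^ K2 * real q ^ n < real (q + 1) ^ n"
      unfolding x_def by (simp add: power_divide divide_simps del: of_nat_Suc of_nat_add of_nat_mult)
    then have "real (K1 * (m * L + 1) ^ K2 * q ^ n) < real ((q + 1) ^ n)"
      by (simp only: of_nat_mult of_nat_power)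
    then show ?thesis by (simp only: of_nat_less_iff)
  qed
  then show ?thesis by blast
qed

text \<open>v is read as a formal integer combination of elements of A; this is its image under the
  homomorphism from the free abelian group on A that extends h.\<close>

definition group_value :: "'a set \<Rightarrow> 'a monoid \<Rightarrow> ('a \<Rightarrow> 'a) \<Rightarrow> ('a \<Rightarrow> int) \<Rightarrow> 'a" where
  "group_value A \<G> h v = finprod \<G> (\<lambda>a. h a [^]\<^bsub>\<G>\<^esub> v a) A"

lemma group_value_diff:
  assumes "comm_group \<G>" "h ` A \<subseteq> carrier \<G>"
  shows "group_value A \<G> h (v - w) = group_value A \<G> h v \<otimes>\<^bsub>\<G>\<^esub> inv\<^bsub>\<G>\<^esub> group_value A \<G> h w"
proof -
  interpret comm_group \<G> by fact
  have h: "h a \<in> carrier \<G>" if "a \<in> A" for a using assms(2) that by blast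
  have add: "group_value A \<G> h (v + w) = group_value A \<G> h v \<otimes>\<^bsub>\<G>\<^esub> group_value A \<G> h w" for v w
  proof -
    have "group_value A \<G> h v \<otimes>\<^bsub>\<G>\<^esub> group_value A \<G> h w = finprod \<G> (\<lambda>a. h a [^]\<^bsub>\<G>\<^esub> v a \<otimes>\<^bsub>\<G>\<^esub> h a [^]\<^bsub>\<G>\<^esub> w a) A"
      unfolding group_value_def using h by (intro finprod_multf[symmetric]) auto
    also have "\<dots> = group_value A \<G> h (v + w)"
      unfolding group_value_def using h by (intro finprod_cong') (auto simp: int_pow_mult)
    finally show ?thesis by simp
  qed
  have G: "group_value A \<G> h v \<in> carrier \<G>" for v
    unfolding group_value_def using h by (intro finprod_closed) auto
  have "group_value A \<G> h v = group_value A \<G> h ((v - w) + w)" by simp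
  also have "\<dots> = group_value A \<G> h (v - w) \<otimes>\<^bsub>\<G>\<^esub> group_value A \<G> h w" by (rule add)
  finally show ?thesis using G by (simp add: inv_solve_right)
qed

lemma group_value_delta:
  assumes "comm_group \<G>" "h ` A \<subseteq> carrier \<G>" "finite A" "x \<in> A"
  shows "group_value A \<G> h (\<lambda>a. if a = x then 1 else 0) = h x"
proof -
  interpret comm_group \<G> by fact
  have h: "h a \<in> carrier \<G>" if "a \<in> A" for a using assms(2) that by blast
  have "group_value A \<G> h (\<lambda>a. if a = x then 1 else 0) = finprod \<G> (\<lambda>a. if x = a then h a else \<one>\<^bsub>\<G>\<^esub>) A"
    unfolding group_value_def using h by (intro finprod_cong') (auto simp: int_pow_1)
  also have "\<dots> = h x" using assms h by (intro finprod_singleton) auto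
  finally show ?thesis .
qed

lemma group_value_exponent:
  assumes "comm_group \<G>" "h ` A \<subseteq> carrier \<G>" "finite (carrier \<G>)" "card (carrier \<G>) \<le> k"
  shows "group_value A \<G> h (of_nat (fact k) * v) = \<one>\<^bsub>\<G>\<^esub>"
proof -
  interpret comm_group \<G> by fact
  have h: "h a \<in> carrier \<G>" if "a \<in> A" for a using assms(2) that by blast
  have "card (carrier \<G>) \<noteq> 0" using assms(3) one_closed by auto
  then have "card (carrier \<G>) dvd fact k" using assms(4) by (intro dvd_fact) auto
  then obtain l where l: "(fact k :: nat) = card (carrier \<G>) * l" by blast
  have "h a [^]\<^bsub>\<G>\<^esub> ((of_nat (fact k) * v) a) = \<one>\<^bsub>\<G>\<^esub>" if "a \<in> A" for a
  proof -
    have "(of_nat (fact k) * v) a = int (card (carrier \<G>)) * (int l * v a)"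
      unfolding l times_fun_apply of_nat_fun_apply by simp
    then have "h a [^]\<^bsub>\<G>\<^esub> ((of_nat (fact k) * v) a) = (h a [^]\<^bsub>\<G>\<^esub> int (card (carrier \<G>))) [^]\<^bsub>\<G>\<^esub> (int l * v a)"
      unfolding int_pow_pow[OF h[OF that]] by (simp only:)
    also have "h a [^]\<^bsub>\<G>\<^esub> int (card (carrier \<G>)) = \<one>\<^bsub>\<G>\<^esub>"
      using power_order_eq_one[OF assms(3) h[OF that]] by (simp add: int_pow_int)
    finally show ?thesis by simp
  qed
  then have "group_value A \<G> h (of_nat (fact k) * v) = finprod \<G> (\<lambda>a. \<one>\<^bsub>\<G>\<^esub>) A"
    unfolding group_value_def by - (rule finprod_cong'[OF refl], simp, blast)
  then show ?thesis by simp
qed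


lemma term_ops_sub:
  assumes "length ss = k" "\<forall>s\<in>set ss. s \<in> term_ops ar F l"
  shows "t \<in> term_ops ar F k \<Longrightarrow> (\<lambda>xs. t (map (\<lambda>s. s xs) ss)) \<in> term_ops ar F l"
proof (induction rule: term_ops.induct)
  case (proj i)
  then have "(\<lambda>xs. map (\<lambda>s. s xs) ss ! i) = ss ! i" using assms(1) by auto
  then show ?case using assms proj by simp
next
  case (comp ts f)
  have "(\<lambda>xs. F f (map (\<lambda>t. t xs) (map (\<lambda>t xs. t (map (\<lambda>s. s xs) ss)) ts))) \<in> term_ops ar F l"
    using comp by (intro term_ops.comp) auto
  then show ?case by (simp add: comp_def)
qed

section \<open>The free abelian group on A modulo a common kernel\<close>

context fin_algebra
begin

lemma A_nonempty: "A \<noteq> {}"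
  using alg unfolding is_algebra_def by blast

text \<open>Dividing by it handles all separated maps at once, with no choice of finitely many
  groups and no product to form.\<close>

definition common_kernel :: "('a \<Rightarrow> int) set" where
  "common_kernel = {v. \<forall>\<G> h. separated_map \<G> h \<longrightarrow> group_value A \<G> h v = \<one>\<^bsub>\<G>\<^esub>}"

lemma separated_mapD:
  assumes "separated_map \<G> h"
  shows "comm_group \<G>" "h ` A \<subseteq> carrier \<G>" "finite (carrier \<G>)" "card (carrier \<G>) \<le> card A"
    "G \<in> pol2 \<Longrightarrow> x \<in> A \<Longrightarrow> y \<in> A \<Longrightarrow> x' \<in> A \<Longrightarrow> y' \<in> A \<Longrightarrow>
      h (G x y) \<otimes>\<^bsub>\<G>\<^esub> h (G x' y') = h (G x y') \<otimes>\<^bsub>\<G>\<^esub> h (G x' y)"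
proof -
  have *: "comm_group \<G>" "carrier \<G> \<subseteq> A" "h ` A \<subseteq> carrier \<G>"
    "\<forall>F\<in>pol2. \<forall>x\<in>A. \<forall>y\<in>A. \<forall>x'\<in>A. \<forall>y'\<in>A.
        h (F x y) \<otimes>\<^bsub>\<G>\<^esub> h (F x' y') = h (F x y') \<otimes>\<^bsub>\<G>\<^esub> h (F x' y)"
    using assms unfolding separated_map_def by simp_all
  show "comm_group \<G>" "h ` A \<subseteq> carrier \<G>" by (fact *)+
  show "finite (carrier \<G>)" "card (carrier \<G>) \<le> card A"
    using *(2) finite_A by (auto intro: finite_subset card_mono)
  show "G \<in> pol2 \<Longrightarrow> x \<in> A \<Longrightarrow> y \<in> A \<Longrightarrow> x' \<in> A \<Longrightarrow> y' \<in> A \<Longrightarrow>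
      h (G x y) \<otimes>\<^bsub>\<G>\<^esub> h (G x' y') = h (G x y') \<otimes>\<^bsub>\<G>\<^esub> h (G x' y)"
    using *(4) by simp
qed

definition delta :: "'a \<Rightarrow> 'a \<Rightarrow> int" where
  "delta x = (\<lambda>a. if a = x then 1 else 0)"

text \<open>Each condition is checked in every group separately. Injectivity on A comes from the
  existence of enough separated maps, and the factorial is a multiple of every group order since
  these are at most \<open>card A\<close>.\<close>

lemma quasi_affine_common_kernel:
  assumes sol: "solvable A ar F" and ss: "semisimple A ar F"
  shows "quasi_affine A (pol_clone A ar F) delta common_kernel (fact (card A))"
proof (intro quasi_affine.intro quasi_affine_axioms.intro clone_axioms A_nonempty)
  show "add_subgroup common_kernel"
    unfolding add_subgroup_def
  proof (intro conjI ballI)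
    have diff: "v - w \<in> common_kernel" if "v \<in> common_kernel" "w \<in> common_kernel" for v w
      unfolding common_kernel_def
    proof (intro CollectI allI impI)
      fix \<G> h assume sm: "separated_map \<G> h"
      interpret comm_group \<G> by (rule separated_mapD(1)[OF sm])
      show "group_value A \<G> h (v - w) = \<one>\<^bsub>\<G>\<^esub>"
        using that sm unfolding common_kernel_def group_value_diff[OF separated_mapD(1,2)[OF sm]] by simp
    qed
    then show "v - w \<in> common_kernel" if "v \<in> common_kernel" "w \<in> common_kernel" for v w
      using that by blast
    show "0 \<in> common_kernel"
      unfolding common_kernel_def
    proof (intro CollectI allI impI)
      fix \<G> h assume sm: "separated_map \<G> h"
      interpret comm_group \<G> by (rule separated_mapD(1)[OF sm])
      have "group_value A \<G> h 0 \<in> carrier \<G>"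
        unfolding group_value_def using separated_mapD(2)[OF sm] by (intro finprod_closed) auto
      then show "group_value A \<G> h 0 = \<one>\<^bsub>\<G>\<^esub>"
        using group_value_diff[OF separated_mapD(1,2)[OF sm], of 0 0] by simp
    qed
  qed
  show "x = y" if xy: "x \<in> A" "y \<in> A" "delta x - delta y \<in> common_kernel" for x y
  proof (rule ccontr)
    assume "x \<noteq> y"
    then obtain \<G> h where sm: "separated_map \<G> h" and h: "h x \<noteq> h y"
      using ex_separated_map[OF sol ss xy(1,2)] by blast
    interpret comm_group \<G> by (rule separated_mapD(1)[OF sm])
    note gv = group_value_delta[OF separated_mapD(1,2)[OF sm] finite_A, folded delta_def]
    have hA: "h x \<in> carrier \<G>" "h y \<in> carrier \<G>" using separated_mapD(2)[OF sm] xy by auto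
    have "h x \<otimes>\<^bsub>\<G>\<^esub> inv\<^bsub>\<G>\<^esub> h y = \<one>\<^bsub>\<G>\<^esub>"
      using xy(3) sm group_value_diff[OF separated_mapD(1,2)[OF sm], of "delta x" "delta y"]
      unfolding common_kernel_def gv[OF xy(1)] gv[OF xy(2)] by simp
    then have "h x = h y" using hA by (metis inv_equality inv_inv inv_closed)
    then show False using h by simp
  qed
  show "(0::nat) < fact (card A)" by simp
  show "of_nat (fact (card A)) * v \<in> common_kernel" for v
    unfolding common_kernel_def
    using group_value_exponent[OF separated_mapD(1-4)] by (intro CollectI allI impI)
  show "delta (G x y) + delta (G x' y') - delta (G x y') - delta (G x' y) \<in> common_kernel"
    if G: "G \<in> pol2" and A: "x \<in> A" "y \<in> A" "x' \<in> A" "y' \<in> A" for G x y x' y'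
    unfolding common_kernel_def
  proof (intro CollectI allI impI)
    fix \<G> h assume sm: "separated_map \<G> h"
    interpret comm_group \<G> by (rule separated_mapD(1)[OF sm])
    note gv = group_value_delta[OF separated_mapD(1,2)[OF sm] finite_A, folded delta_def]
    note diff = group_value_diff[OF separated_mapD(1,2)[OF sm]]
    have hA: "h (G u v) \<in> carrier \<G>" if "u \<in> A" "v \<in> A" for u v
      using separated_mapD(2)[OF sm] pol2_rng[OF G that] by auto
    define p q r s where pqrs: "p = h (G x y)" "q = h (G x y')" "r = h (G x' y)" "s = h (G x' y')"
    have c: "p \<in> carrier \<G>" "q \<in> carrier \<G>" "r \<in> carrier \<G>" "s \<in> carrier \<G>"
      unfolding pqrs using hA A by auto
    have "p \<otimes>\<^bsub>\<G>\<^esub> s = q \<otimes>\<^bsub>\<G>\<^esub> r" unfolding pqrs by (rule separated_mapD(5)[OF sm G A])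
    then have "p = q \<otimes>\<^bsub>\<G>\<^esub> r \<otimes>\<^bsub>\<G>\<^esub> inv\<^bsub>\<G>\<^esub> s" using c by (simp add: inv_solve_right)
    then have "p \<otimes>\<^bsub>\<G>\<^esub> inv\<^bsub>\<G>\<^esub> q = (q \<otimes>\<^bsub>\<G>\<^esub> r \<otimes>\<^bsub>\<G>\<^esub> inv\<^bsub>\<G>\<^esub> s) \<otimes>\<^bsub>\<G>\<^esub> inv\<^bsub>\<G>\<^esub> q"
      by (simp only:)
    also have "\<dots> = (q \<otimes>\<^bsub>\<G>\<^esub> inv\<^bsub>\<G>\<^esub> q) \<otimes>\<^bsub>\<G>\<^esub> (r \<otimes>\<^bsub>\<G>\<^esub> inv\<^bsub>\<G>\<^esub> s)"
      using c by (simp only: m_ac m_closed inv_closed)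
    finally have eq: "p \<otimes>\<^bsub>\<G>\<^esub> inv\<^bsub>\<G>\<^esub> q = r \<otimes>\<^bsub>\<G>\<^esub> inv\<^bsub>\<G>\<^esub> s" using c by simp
    have "delta (G x y) + delta (G x' y') - delta (G x y') - delta (G x' y) =
        (delta (G x y) - delta (G x y')) - (delta (G x' y) - delta (G x' y'))" by simp
    then show "group_value A \<G> h (delta (G x y) + delta (G x' y') - delta (G x y') - delta (G x' y)) = \<one>\<^bsub>\<G>\<^esub>"
      using gv pol2_rng[OF G] A c eq by (simp only: diff pqrs) (simp add: pqrs[symmetric])
  qed
qed

lemma maximal_congruence_relation:
  assumes "maximal_congruence A ar F \<theta>"
  shows "maximal_relation \<theta>"
  unfolding maximal_relation_def
proof (intro conjI ballI allI impI)
  have c: "is_congruence A ar F \<theta>" using assms unfolding maximal_congruence_def by blast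
  then show "equiv A \<theta>" unfolding is_congruence_def by blast
  show "(g x, g y) \<in> \<theta>" if "g \<in> pol1" "(x, y) \<in> \<theta>" for g x y
    using cong_pol1[OF c that] .
  show "(a, b) \<in> (\<theta> \<union> trans_step x y)\<^sup>*"
    if "x \<in> A" "y \<in> A" "(x, y) \<notin> \<theta>" "a \<in> A" "b \<in> A" for x y a b
    using maximal_generated[OF assms that] .
qed

text \<open>The same p works in all coordinates because the operations of the power act
  coordinatewise. So the number of generators becomes the number of variables of p.\<close>

lemma gen_polynomial:
  assumes gs: "set gs = X" "X \<subseteq> pow_carrier A n"
  shows "w \<in> gen ar (pow_op F n) X \<Longrightarrow>
    \<exists>p\<in>pol_funs A ar F. \<forall>k<n. w ! k = p (\<lambda>j. if j < length gs then gs ! j ! k else a)"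
proof (induction rule: gen.induct)
  case (base x)
  then obtain j where "j < length gs" "gs ! j = x" using gs by (metis in_set_conv_nth)
  then show ?case by (intro bexI[OF _ pol_funs.var[of j]]) simp
next
  case (op xs f)
  then have *: "\<forall>x\<in>set xs. \<exists>p. p \<in> pol_funs A ar F \<and> (\<forall>k<n. x ! k = p (\<lambda>j. if j < length gs then gs ! j ! k else a))"
    by blast
  then obtain S where S: "\<forall>x\<in>set xs. S x \<in> pol_funs A ar F \<and>
      (\<forall>k<n. x ! k = S x (\<lambda>j. if j < length gs then gs ! j ! k else a))"
    using bchoice[OF *] by (elim exE)
  have "(\<lambda>\<rho>. F f (map (\<lambda>t. t \<rho>) (map S xs))) \<in> pol_funs A ar F"
    using op(1) S by (intro pol_funs.comp) auto
  then show ?case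
    by (rule bexI[rotated]) (use S in \<open>auto simp: pow_op_def comp_def intro!: arg_cong[of _ _ "F f"]\<close>)
qed

lemma d_gen_generators:
  obtains X where "X \<subseteq> pow_carrier A n" "finite X" "card X = d_gen A ar F n"
    "gen ar (pow_op F n) X = pow_carrier A n"
proof -
  have fp: "finite (pow_carrier A n)"
    using finite_lists_length_eq[OF finite_A] unfolding pow_carrier_def by (simp add: conj_commute)
  have "w \<in> pow_carrier A n" if "w \<in> gen ar (pow_op F n) (pow_carrier A n)" for w
    using that
  proof (induction rule: gen.induct)
    case (op xs f)
    have "F f (map (\<lambda>t. t ! i) xs) \<in> A" if "i < n" for i
    proof -
      have "set (map (\<lambda>t. t ! i) xs) \<subseteq> A" using op that unfolding pow_carrier_def by fastforce
      then show ?thesis using alg op(1) unfolding is_algebra_def by simp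
    qed
    then show ?case unfolding pow_op_def pow_carrier_def by auto
  qed
  then have "gen ar (pow_op F n) (pow_carrier A n) = pow_carrier A n" by (auto intro: gen.base)
  then have "\<exists>k X. X \<subseteq> pow_carrier A n \<and> finite X \<and> card X = k \<and> gen ar (pow_op F n) X = pow_carrier A n"
    using fp by blast
  from LeastI_ex[OF this] show ?thesis using that unfolding d_gen_def by blast
qed

end

section \<open>Polynomial growth gives a Maltsev operation\<close>

context fin_algebra
begin

lemma term_blocks:
  assumes qa: "quasi_affine A (pol_clone A ar F) \<phi> N E" and t: "t \<in> term_ops ar F k"
    and len: "length x1 = k" "length x2 = k" "length x3 = k" "length x4 = k"
    and sub: "set x1 \<subseteq> A" "set x2 \<subseteq> A" "set x3 \<subseteq> A" "set x4 \<subseteq> A"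
    and blocks: "\<And>j. j < k \<Longrightarrow> (x1 ! j = x2 ! j \<and> x3 ! j = x4 ! j) \<or> (x1 ! j = x3 ! j \<and> x2 ! j = x4 ! j)"
  shows "\<phi> (t x1) - \<phi> (t x2) - (\<phi> (t x3) - \<phi> (t x4)) \<in> N"
proof -
  interpret Q: quasi_affine A "pol_clone A ar F" \<phi> N E by (rule qa)
  define f where "f = (\<lambda>\<rho>::nat \<Rightarrow> 'a. t (map \<rho> [0..<k]))"
  have f: "f \<in> pol_clone A ar F" unfolding f_def by (rule pol_cloneI[OF term_ops_pol_funs[OF t]])
  define env where "env = (\<lambda>xs v. if v < k then xs ! v else Q.a0)"
  have rng: "range (env xs) \<subseteq> A" if "length xs = k" "set xs \<subseteq> A" for xs
    unfolding env_def using that Q.a0_in by (auto dest: nth_mem)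
  have "f (Q.trunc k (env xs)) = t xs" if "length xs = k" for xs
  proof -
    have "map (Q.trunc k (env xs)) [0..<k] = xs"
      using that by (intro nth_equalityI) (auto simp: Q.trunc_def env_def)
    then show ?thesis unfolding f_def by simp
  qed
  note val = this[OF len(1)] this[OF len(2)] this[OF len(3)] this[OF len(4)]
  have "\<phi> (f (Q.trunc k (env x1))) - \<phi> (f (Q.trunc k (env x2))) -
      (\<phi> (f (Q.trunc k (env x3))) - \<phi> (f (Q.trunc k (env x4)))) \<in> N"
    using blocks by (intro Q.sep_blocks[OF f] rng len sub) (simp add: env_def)
  then show ?thesis unfolding val .
qed

lemma term_ops_in:
  assumes t: "t \<in> term_ops ar F k" and xs: "length xs = k" "set xs \<subseteq> A"
  shows "t xs \<in> A"
  using t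
proof (induction rule: term_ops.induct)
  case (comp ts f)
  then have "set (map (\<lambda>t. t xs) ts) \<subseteq> A" by auto
  then show ?case using alg comp(1) unfolding is_algebra_def by simp
qed (use xs in auto)

text \<open>By \<open>term_blocks\<close> the differences before and after exchanging a for b agree
  modulo N; if the first is zero, injectivity of \<phi> modulo N makes the other two values
  equal.\<close>

lemma quasi_affine_abelian:
  assumes qa: "quasi_affine A (pol_clone A ar F) \<phi> N E"
  shows "abelian A ar F"
proof -
  interpret Q: quasi_affine A "pol_clone A ar F" \<phi> N E by (rule qa)
  have "is_congruence A ar F (Id_on A)"
    by (rule congruenceI) (auto simp: equiv_def refl_on_def sym_def trans_def Id_on_iff pol1_rng)
  moreover have "term_condition A ar F (A \<times> A) (A \<times> A) (Id_on A)"
    unfolding term_condition_def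
  proof (intro allI impI, elim conjE)
    fix n m t a b c d
    assume t: "t \<in> term_ops ar F (n + m)"
      and carrier: "a \<in> pow_carrier A n" "b \<in> pow_carrier A n" "c \<in> pow_carrier A m" "d \<in> pow_carrier A m"
      and eq: "(t (a @ c), t (a @ d)) \<in> Id_on A"
    have l: "length a = n" "length b = n" "length c = m" "length d = m"
      and s: "set a \<subseteq> A" "set b \<subseteq> A" "set c \<subseteq> A" "set d \<subseteq> A"
      using carrier unfolding pow_carrier_def by auto
    have "\<phi> (t (b @ c)) - \<phi> (t (b @ d)) - (\<phi> (t (a @ c)) - \<phi> (t (a @ d))) \<in> N"
      by (rule term_blocks[OF qa t]) (use l s in \<open>auto simp: nth_append\<close>)
    moreover have "t (a @ c) = t (a @ d)" using eq by (simp add: Id_on_iff)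
    ultimately have "\<phi> (t (b @ c)) - \<phi> (t (b @ d)) \<in> N" by simp
    moreover have "t (b @ c) \<in> A" "t (b @ d) \<in> A"
      using term_ops_in[OF t] l s by auto
    ultimately have "t (b @ c) = t (b @ d)" using Q.\<phi>_inj by blast
    then show "(t (b @ c), t (b @ d)) \<in> Id_on A" using \<open>t (b @ c) \<in> A\<close> by (simp add: Id_on_iff)
  qed
  ultimately have "commutator A ar F (A \<times> A) (A \<times> A) \<subseteq> Id_on A"
    unfolding commutator_def by blast
  moreover have "Id_on A \<subseteq> commutator A ar F (A \<times> A) (A \<times> A)"
    using congD(2)[OF congruence_commutator] by auto
  ultimately show ?thesis unfolding abelian_def by blast
qed

text \<open>With \<open>t (x, y, z, as) = x - y + z\<close> one has
  \<open>t (x, y, z, us) = x - y + z + \<kappa> us\<close>, and the translation part cancels in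
  \<open>t (x, t (y, z, y, us), y, us)\<close> with \<open>us = (y, ..., y)\<close>.\<close>

lemma maltsev_term:
  assumes rich: "rich A (pol_clone A ar F) \<phi> N E f m T P"
    and dC: "(\<lambda>\<rho>. rich.d A \<phi> N (\<rho> 0) (\<rho> 1) (\<rho> 2)) \<in> pol_clone A ar F"
  shows "has_maltsev_polynomial A ar F \<and> has_maltsev_term A ar F"
proof -
  interpret R: rich A "pol_clone A ar F" \<phi> N E f m T P by (rule rich)
  obtain p where p: "p \<in> pol_funs A ar F" "\<And>\<rho>. range \<rho> \<subseteq> A \<Longrightarrow> R.d (\<rho> 0) (\<rho> 1) (\<rho> 2) = p \<rho>"
    using pol_cloneE[OF dC] by metis
  have val: "p (\<lambda>v. if v < 3 then [x, y, z] ! v else R.a0) = R.d x y z"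
    if "x \<in> A" "y \<in> A" "z \<in> A" for x y z
  proof -
    have "range (\<lambda>v. if v < 3 then [x, y, z] ! v else R.a0) \<subseteq> A"
      using that R.a0_in by (auto simp: less_Suc_eq numeral_3_eq_3)
    from p(2)[OF this] show ?thesis by simp
  qed
  obtain u where u: "u \<in> poly_ops A ar F 3" "\<And>xs. u xs = p (\<lambda>v. if v < 3 then xs ! v else R.a0)"
    using pol_funs_poly_ops[OF R.a0_in p(1), of 3] by metis
  have "is_maltsev_op A u"
    unfolding is_maltsev_op_def u(2) using val R.d_left R.d_right by simp
  then have poly: "has_maltsev_polynomial A ar F"
    unfolding has_maltsev_polynomial_def using u(1) by blast
  obtain as where as: "set as = A" using finite_A finite_list by blast
  define l where "l = length as"
  obtain t where t: "t \<in> term_ops ar F (3 + l)"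
    "\<And>xs. length xs = 3 \<Longrightarrow> p (\<lambda>v. if v < 3 then xs ! v else R.a0) = t (xs @ as)"
    using pol_funs_term[OF R.a0_in as p(1), of 3] unfolding l_def by metis
  have td: "t ([x, y, z] @ as) = R.d x y z" if "x \<in> A" "y \<in> A" "z \<in> A" for x y z
    using t(2)[of "[x, y, z]"] val[OF that] by simp
  define pj where "pj = (\<lambda>i xs. xs ! i :: 'a)"
  have pj: "pj i \<in> term_ops ar F 3" if "i < 3" for i
    unfolding pj_def by (rule term_ops.proj[OF that])
  define s where "s = (\<lambda>xs. t (map (\<lambda>h. h xs) ([pj 1, pj 2, pj 1] @ replicate l (pj 1))))"
  have s: "s \<in> term_ops ar F 3"
    unfolding s_def by (rule term_ops_sub[OF _ _ t(1)]) (use pj in auto)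
  define M where "M = (\<lambda>xs. t (map (\<lambda>h. h xs) ([pj 0, s, pj 1] @ replicate l (pj 1))))"
  have M: "M \<in> term_ops ar F 3"
    unfolding M_def by (rule term_ops_sub[OF _ _ t(1)]) (use pj s in auto)
  have key: "M [x, y, z] = R.d x y z" if A: "x \<in> A" "y \<in> A" "z \<in> A" for x y z
  proof -
    define b where "b = (\<lambda>x' y' z'. t ([x', y', z'] @ replicate l y))"
    have bA: "b x' y' z' \<in> A" if "x' \<in> A" "y' \<in> A" "z' \<in> A" for x' y' z'
      unfolding b_def using that A by (intro term_ops_in[OF t(1)]) auto
    define w where "w = b y z y"
    have wA: "w \<in> A" unfolding w_def using bA A by blast
    have Mw: "M [x, y, z] = b x w y"
      unfolding M_def s_def pj_def w_def b_def by simp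
    \<comment> \<open>So b x' y' z' is x' - y' + z' + \<tau> with the fixed translation \<tau> = b y
      y y - y. Then w is y - z + y + \<tau>, and b x w y = x - w + y + \<tau> becomes x - y +
      z.\<close>
    have shift: "\<phi> (b x' y' z') - \<phi> (b y y y) - (\<phi> x' - \<phi> y' + \<phi> z' - \<phi> y) \<in> N"
      if B: "x' \<in> A" "y' \<in> A" "z' \<in> A" for x' y' z'
    proof -
      have blocks: "\<phi> (t (e1 @ replicate l y)) - \<phi> (t (e2 @ replicate l y)) -
          (\<phi> (t (e1 @ as)) - \<phi> (t (e2 @ as))) \<in> N"
        if "length e1 = 3" "length e2 = 3" "set e1 \<subseteq> A" "set e2 \<subseteq> A" for e1 e2
        by (rule term_blocks[OF R.quasi_affine_axioms t(1)])
          (use that A as in \<open>auto simp: l_def nth_append\<close>)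
      have "\<phi> (t ([x', y', z'] @ replicate l y)) - \<phi> (t ([y, y, y] @ replicate l y)) -
          (\<phi> (t ([x', y', z'] @ as)) - \<phi> (t ([y, y, y] @ as))) \<in> N"
        by (rule blocks) (use A B in auto)
      then have "\<phi> (b x' y' z') - \<phi> (b y y y) - (\<phi> (R.d x' y' z') - \<phi> y) \<in> N"
        unfolding td[OF B] td[OF A(2) A(2) A(2)] R.d_left[OF A(2) A(2)] b_def .
      from this R.d_\<phi>[OF B] show ?thesis by (rule R.N_lin2) simp
    qed
    have "\<phi> (b x w y) - (\<phi> x - \<phi> y + \<phi> z) \<in> N"
      using shift[OF A(1) wA A(2)] shift[OF A(2) A(3) A(2), folded w_def] by (rule R.N_lin2') simp
    then show ?thesis
      unfolding Mw using R.d_eqI[OF A bA[OF A(1) wA A(2)]] by simp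
  qed
  have "is_maltsev_op A M"
    unfolding is_maltsev_op_def using key R.d_left R.d_right by simp
  then have "has_maltsev_term A ar F"
    unfolding has_maltsev_term_def using M by blast
  then show ?thesis using poly by blast
qed

lemma ex_rich:
  assumes qa: "quasi_affine A (pol_clone A ar F) \<phi> N E"
    and growth: "(\<lambda>n. real (d_gen A ar F n)) \<in> O(\<lambda>n. real n)"
  shows "\<exists>f m T P. rich A (pol_clone A ar F) \<phi> N E f m T P"
proof -
  interpret Q: quasi_affine A "pol_clone A ar F" \<phi> N E by (rule qa)
  define L where "L = card A ^ card A"
  define T where "T = 3 * E * L"
  have cA: "card A > 0" using finite_A A_nonempty by (simp add: card_gt_0_iff)
  have L: "L > 0" unfolding L_def using cA by simp
  obtain C where C: "eventually (\<lambda>n. norm (real (d_gen A ar F n)) \<le> C * norm (real n)) at_top"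
    using growth by (elim landau_o.bigE) blast
  then obtain n1 where n1: "\<And>n. n \<ge> n1 \<Longrightarrow> real (d_gen A ar F n) \<le> C * real n"
    unfolding eventually_sequentially by auto
  obtain n0 where n0: "\<And>n m. n \<ge> n0 \<Longrightarrow> real m \<le> C * real n \<Longrightarrow>
      card A * 2 ^ L * (m * L + 1) ^ (T * L) * (card A - 1) ^ n < (card A - 1 + 1) ^ n"
    using exponential_beats_polynomial[OF L, of C "card A * 2 ^ L" "T * L" "card A - 1"] by blast
  \<comment> \<open>A single power is enough: n only has to pass the threshold of the linear bound
    and that of the counting inequality.\<close>
  define n where "n = max n0 n1"
  obtain X where X: "X \<subseteq> pow_carrier A n" "finite X" "card X = d_gen A ar F n"
    "gen ar (pow_op F n) X = pow_carrier A n"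
    by (rule d_gen_generators)
  obtain gs where gs: "set gs = X" "distinct gs" using finite_distinct_list[OF X(2)] by blast
  define m where "m = length gs"
  have m: "m = d_gen A ar F n" unfolding m_def using distinct_card[OF gs(2)] gs(1) X(3) by simp
  have "\<exists>f\<in>pol_clone A ar F. \<forall>x\<in>A. \<forall>y\<in>A. \<phi> x - \<phi> y \<in> Q.span (Q.frequent_types T m f) (f (\<lambda>_. Q.a0))"
  proof (rule Q.ex_full_span[where g = "\<lambda>j k. gs ! j ! k", OF _ _ L_def])
    fix w assume "w \<in> pow_carrier A n"
    then have "w \<in> gen ar (pow_op F n) X" using X(4) by simp
    from gen_polynomial[OF gs(1) X(1) this]
    obtain p where p: "p \<in> pol_funs A ar F" "\<forall>k<n. w ! k = p (\<lambda>j. if j < length gs then gs ! j ! k else Q.a0)"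
      by blast
    then show "\<exists>p\<in>pol_clone A ar F. \<forall>k<n. w ! k = p (\<lambda>j. if j < m then gs ! j ! k else Q.a0)"
      unfolding m_def by (intro bexI[OF _ pol_cloneI[OF p(1)]])
  next
    fix j k assume "j < m" "k < n"
    then have "gs ! j \<in> pow_carrier A n" using gs(1) X(1) unfolding m_def by (metis nth_mem subsetD)
    then show "gs ! j ! k \<in> A" using \<open>k < n\<close> unfolding pow_carrier_def by auto
  next
    have "real m \<le> C * real n" unfolding m using n1[of n] unfolding n_def by simp
    then show "card A * 2 ^ L * (m * L + 1) ^ (T * L) * (card A - 1) ^ n < card A ^ n"
      using n0[of n m] cA unfolding n_def by simp
  qed
  then obtain f where f: "f \<in> pol_clone A ar F"
    "\<forall>x\<in>A. \<forall>y\<in>A. \<phi> x - \<phi> y \<in> Q.span (Q.frequent_types T m f) (f (\<lambda>_. Q.a0))"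
    by (elim bexE)
  have "rich A (pol_clone A ar F) \<phi> N E f m T (Q.frequent_types T m f)"
    by (intro rich.intro rich_axioms.intro qa f(1) Q.frequent_types_def)
      (use f(2) in \<open>simp_all add: T_def L_def\<close>)
  then show ?thesis by blast
qed

end

theorem theorem8p1:
  fixes A :: "'a set" and ar :: "'f \<Rightarrow> nat" and F :: "'f \<Rightarrow> 'a list \<Rightarrow> 'a"
  assumes "is_algebra A ar F"
    and "finite A"
    and "semisimple A ar F"
    and "solvable A ar F"
    and "(\<lambda>n. real (d_gen A ar F n)) \<in> O(\<lambda>n. real n)"
  shows "has_maltsev_polynomial A ar F \<and> affine A ar F"
proof -
  interpret fin_algebra A ar F using assms(1,2) by (rule fin_algebra.intro)
  have qa: "quasi_affine A (pol_clone A ar F) delta common_kernel (fact (card A))"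
    by (rule quasi_affine_common_kernel[OF assms(4,3)])
  obtain f m T P where rich: "rich A (pol_clone A ar F) delta common_kernel (fact (card A)) f m T P"
    using ex_rich[OF qa assms(5)] by blast
  then interpret R: rich A "pol_clone A ar F" delta common_kernel "fact (card A)" f m T P .
  have "\<exists>\<theta>. maximal_relation \<theta> \<and> (x, y) \<notin> \<theta>" if xy: "x \<in> A" "y \<in> A" "x \<noteq> y" for x y
  proof -
    have "(x, y) \<notin> (A \<times> A) \<inter> \<Inter> {\<theta>. maximal_congruence A ar F \<theta>}"
      using assms(3) xy unfolding semisimple_def by (simp add: Id_on_iff)
    then obtain \<theta> where "maximal_congruence A ar F \<theta>" "(x, y) \<notin> \<theta>" using xy(1,2) by blast
    then show ?thesis using maximal_congruence_relation by blast
  qed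
  then have "(\<lambda>\<rho>. R.d (\<rho> 0) (\<rho> 1) (\<rho> 2)) \<in> pol_clone A ar F" by (rule R.d_in_C)
  then show ?thesis
    unfolding affine_def using maltsev_term[OF rich] quasi_affine_abelian[OF qa] by blast
qed

end
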